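(* Suppose $t\in\mathbb{R}$, $t\neq\frac12$, and $E$ is an interior weight on $\Omega$. Then $$\int_\Omega E^{2t}|\nabla u|_A^2\,dx\ \ge\ \left(t-\tfrac12\right)^2\int_\Omega|\nabla E|_A^2E^{2t-2}u^2\,dx\qquad\text{for all }u\in X_t.$$ Moreover the constant $(t-\frac12)^2$ is optimal (it cannot be replaced by a larger one) and is not attained (equality does not hold for any nonzero $u\in X_t$).
   Context: $\Omega\subset\mathbb{R}^n$ is a bounded connected domain with smooth boundary. $A(x)=(a^{i,j}(x))$ is an $n\times n$ symmetric, uniformly positive definite matrix with $a^{i,j}\in C^\infty(\overline\Omega)$. For $\xi\in\mathbb{R}^n$, $|\xi|_A^2:=A(x)\xi\cdot\xi$, and $\mathcal L_A(E):=-\mathrm{div}(A\nabla E)$ (in the distributional sense). $E$ is called an interior weight on $\Omega$ if $E>0$ in $\Omega$; $\mathcal L_A(E)$ is a nonnegative nonzero finite measure in $\Omega$, denoted $\mu$; and, with $K\subset\Omega$ denoting the (compact) support of $\mu$, $E\in C^\infty(\overline\Omega\setminus K)$, $E=\infty$ on $K$, and $\dim_{box}(K)<n-2$. For compact $K\subset\mathbb{R}^n$, $\dim_{box}(K):=n-\lim_{r\searrow0}\frac{\log(\mathcal H^n(K_r))}{\log r}$ provided the limit exists, where $K_r:=\{x\in\Omega:\mathrm{dist}(x,K)<r\}$ and $\mathcal H^n$ is $n$-dimensional Hausdorff measure. $X_t$ is the completion of $C_c^{0,1}(\Omega\setminus K)$ (Lipschitz functions with compact support in $\Omega\setminus K$)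 with respect to the norm $\|u\|_t$, where $\|u\|_t^2:=\int_\Omega E^{2t}|\nabla u|_A^2\,dx$. *)

theory Defs
  imports "HOL-Analysis.Analysis"
begin

subsection \<open>Smooth functions\<close>

definition pd :: "'n::finite \<Rightarrow> (real^'n \<Rightarrow> real) \<Rightarrow> real^'n \<Rightarrow> real" where
  "pd i f x = frechet_derivative f (at x) (axis i 1)"

definition grad :: "(real^'n::finite \<Rightarrow> real) \<Rightarrow> real^'n \<Rightarrow> real^'n" where
  "grad f x = (\<chi> i. pd i f x)"

definition pds :: "'n::finite list \<Rightarrow> (real^'n \<Rightarrow> real) \<Rightarrow> real^'n \<Rightarrow> real" where
  "pds is f = foldr pd is f"

(* Used for open U only: f is C^\<infinity> iff all its iterated partial derivatives are
   differentiable (hence continuous). *)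
definition smooth_in :: "(real^'n::finite) set \<Rightarrow> (real^'n \<Rightarrow> real) \<Rightarrow> bool" where
  "smooth_in U f \<longleftrightarrow> (\<forall>is. \<forall>x\<in>U. pds is f differentiable (at x))"

(* For U open and U \<subseteq> T \<subseteq> closure U: f is in C^\<infinity>(T), i.e. f is smooth in U and every
   derivative extends continuously to T. Values of f outside U are irrelevant. *)
definition smooth_up_to :: "(real^'n::finite) set \<Rightarrow> (real^'n) set \<Rightarrow> (real^'n \<Rightarrow> real) \<Rightarrow> bool" where
  "smooth_up_to U T f \<longleftrightarrow> smooth_in U f \<and>
     (\<forall>is. \<exists>g. continuous_on T g \<and> (\<forall>x\<in>U. g x = pds is f x))"

definition compactly_supported_in :: "'a::topological_space set \<Rightarrow> ('a \<Rightarrow> real) \<Rightarrow> bool" where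
  "compactly_supported_in U f \<longleftrightarrow>
     compact (closure {x. f x \<noteq> 0}) \<and> closure {x. f x \<noteq> 0} \<subseteq> U"

(* C_c^\<infinity>(U), its elements being extended by zero *)
definition test_functions :: "(real^'n::finite) set \<Rightarrow> (real^'n \<Rightarrow> real) set" where
  "test_functions U = {f. smooth_in UNIV f \<and> compactly_supported_in U f}"

(* C_c^{0,1}(U), its elements being extended by zero *)
definition lipschitz_functions :: "(real^'n::finite) set \<Rightarrow> (real^'n \<Rightarrow> real) set" where
  "lipschitz_functions U = {f. (\<exists>L. L-lipschitz_on UNIV f) \<and> compactly_supported_in U f}"


subsection \<open>The domain and the matrix field\<close>

(* Near every boundary point, \<Omega> is a sublevel set of a smooth function without critical points. *)
definition smooth_boundary :: "(real^'n::finite) set \<Rightarrow> bool" where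
  "smooth_boundary \<Omega> \<longleftrightarrow>
     (\<forall>p\<in>frontier \<Omega>. \<exists>U g. open U \<and> p \<in> U \<and> smooth_in U g \<and>
        (\<forall>x\<in>U. grad g x \<noteq> 0) \<and> \<Omega> \<inter> U = {x\<in>U. g x < 0})"

definition smooth_bounded_domain :: "(real^'n::finite) set \<Rightarrow> bool" where
  "smooth_bounded_domain \<Omega> \<longleftrightarrow>
     open \<Omega> \<and> connected \<Omega> \<and> \<Omega> \<noteq> {} \<and> bounded \<Omega> \<and> smooth_boundary \<Omega>"

definition normA_sq :: "(real^'n::finite \<Rightarrow> real^'n^'n) \<Rightarrow> real^'n \<Rightarrow> real^'n \<Rightarrow> real" where
  "normA_sq A x \<xi> = (A x *v \<xi>) \<bullet> \<xi>"

definition elliptic_coefficients :: "(real^'n::finite) set \<Rightarrow> (real^'n \<Rightarrow> real^'n^'n) \<Rightarrow> bool" where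
  "elliptic_coefficients \<Omega> A \<longleftrightarrow>
     (\<forall>i j. smooth_up_to \<Omega> (closure \<Omega>) (\<lambda>x. A x $ i $ j)) \<and>
     (\<forall>x\<in>\<Omega>. transpose (A x) = A x) \<and>
     (\<exists>c>0. \<forall>x\<in>\<Omega>. \<forall>\<xi>. normA_sq A x \<xi> \<ge> c * (norm \<xi>)\<^sup>2)"

definition div_A_grad ::
  "(real^'n::finite \<Rightarrow> real^'n^'n) \<Rightarrow> (real^'n \<Rightarrow> real) \<Rightarrow> real^'n \<Rightarrow> real" where
  "div_A_grad A f x = (\<Sum>i\<in>UNIV. pd i (\<lambda>y. (A y *v grad f y) $ i) x)"


subsection \<open>Distributional notions\<close>

definition locally_integrable :: "(real^'n::finite) set \<Rightarrow> (real^'n \<Rightarrow> real) \<Rightarrow> bool" where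
  "locally_integrable U f \<longleftrightarrow> (\<forall>C. compact C \<and> C \<subseteq> U \<longrightarrow> set_integrable lebesgue C f)"

(* -div (A \<nabla> E) = \<mu> in the sense of distributions on \<Omega>, where \<mu> is a measure on the Borel
   subsets of \<Omega>. As A is smooth and symmetric, the distribution -div (A \<nabla> E) maps a test
   function \<phi> to minus the integral of E div (A \<nabla> \<phi>). *)
definition distributional_L_A_eq ::
  "(real^'n::finite) set \<Rightarrow> (real^'n \<Rightarrow> real^'n^'n) \<Rightarrow> (real^'n \<Rightarrow> real) \<Rightarrow> (real^'n) measure \<Rightarrow> bool" where
  "distributional_L_A_eq \<Omega> A E \<mu> \<longleftrightarrow>
     locally_integrable \<Omega> E \<and>
     (\<forall>\<phi>\<in>test_functions \<Omega>.
        - (LINT x:\<Omega>|lebesgue. E x * div_A_grad A \<phi> x) = (\<integral>x. \<phi> x \<partial>\<mu>))"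

definition has_weak_grad ::
  "(real^'n::finite) set \<Rightarrow> (real^'n \<Rightarrow> real) \<Rightarrow> (real^'n \<Rightarrow> real^'n) \<Rightarrow> bool" where
  "has_weak_grad U u G \<longleftrightarrow>
     locally_integrable U u \<and> (\<forall>i. locally_integrable U (\<lambda>x. G x $ i)) \<and>
     (\<forall>\<phi>\<in>test_functions U. \<forall>i.
        (LINT x:U|lebesgue. u x * pd i \<phi> x) = - (LINT x:U|lebesgue. G x $ i * \<phi> x))"

(* unique up to null sets in U when it exists *)
definition weak_grad ::
  "(real^'n::finite) set \<Rightarrow> (real^'n \<Rightarrow> real) \<Rightarrow> real^'n \<Rightarrow> real^'n" where
  "weak_grad U u = (SOME G. has_weak_grad U u G)"


subsection \<open>Interior weights\<close>

definition supp_measure :: "(real^'n::finite) set \<Rightarrow> (real^'n) measure \<Rightarrow> (real^'n) set" where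
  "supp_measure \<Omega> \<mu> = {x\<in>\<Omega>. \<forall>U. open U \<and> x \<in> U \<longrightarrow> emeasure \<mu> (U \<inter> \<Omega>) > 0}"

(* The limit exists and the box dimension of K equals d. Here n-dimensional Hausdorff measure
   on n-space is Lebesgue measure (another normalisation would not change the limit). *)
definition has_box_dim :: "(real^'n::finite) set \<Rightarrow> (real^'n) set \<Rightarrow> real \<Rightarrow> bool" where
  "has_box_dim \<Omega> K d \<longleftrightarrow>
     ((\<lambda>r. ln (measure lebesgue {x\<in>\<Omega>. infdist x K < r}) / ln r)
        \<longlongrightarrow> real CARD('n) - d) (at_right 0)"

(* K is the support of \<mu>. The value E = \<infinity> on K is expressed by E tending to \<infinity> at every point
   of K; the values on K of the real-valued function E, which do not matter as K is a null
   set, are left arbitrary. *)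
definition interior_weight ::
  "(real^'n::finite) set \<Rightarrow> (real^'n \<Rightarrow> real^'n^'n) \<Rightarrow> (real^'n \<Rightarrow> real) \<Rightarrow>
   (real^'n) measure \<Rightarrow> (real^'n) set \<Rightarrow> bool" where
  "interior_weight \<Omega> A E \<mu> K \<longleftrightarrow>
     sets \<mu> = sets (restrict_space borel \<Omega>) \<and> finite_measure \<mu> \<and> emeasure \<mu> \<Omega> \<noteq> 0 \<and>
     distributional_L_A_eq \<Omega> A E \<mu> \<and>
     K = supp_measure \<Omega> \<mu> \<and> compact K \<and>
     (\<forall>x\<in>\<Omega> - K. E x > 0) \<and>
     smooth_up_to (\<Omega> - K) (closure \<Omega> - K) E \<and>
     (\<forall>x\<in>K. filterlim E at_top (at x within \<Omega> - K)) \<and>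
     (\<exists>d. has_box_dim \<Omega> K d \<and> d < real CARD('n) - 2)"


subsection \<open>The energy space\<close>

definition energy ::
  "(real^'n::finite) set \<Rightarrow> (real^'n \<Rightarrow> real^'n^'n) \<Rightarrow> (real^'n \<Rightarrow> real) \<Rightarrow> real \<Rightarrow>
   (real^'n \<Rightarrow> real^'n) \<Rightarrow> ennreal" where
  "energy \<Omega> A E t G =
     (\<integral>\<^sup>+x\<in>\<Omega>. ennreal (E x powr (2 * t) * normA_sq A x (G x)) \<partial>lebesgue)"

(* The completion of C_c^{0,1}(\<Omega> - K) in the norm whose square is the energy of the gradient,
   realised as a space of (representatives of) locally integrable functions on \<Omega> - K: u belongs
   to it iff some Cauchy sequence \<phi> of Lipschitz functions, with gradients \<Gamma>, converges to u in
   L^1_loc(\<Omega> - K). Lipschitz functions always have a weak gradient (their a.e. gradient).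
   For an interior weight and t \<noteq> 1/2 every Cauchy sequence has such a limit, and the limit
   vanishes only if the norms tend to 0, so this is indeed the completion. *)
definition X_space ::
  "(real^'n::finite) set \<Rightarrow> (real^'n \<Rightarrow> real^'n^'n) \<Rightarrow> (real^'n \<Rightarrow> real) \<Rightarrow> (real^'n) set \<Rightarrow> real \<Rightarrow>
   (real^'n \<Rightarrow> real) set" where
  "X_space \<Omega> A E K t = {u. locally_integrable (\<Omega> - K) u \<and>
     (\<exists>\<phi> \<Gamma>.
        (\<forall>m::nat. \<phi> m \<in> lipschitz_functions (\<Omega> - K) \<and> has_weak_grad (\<Omega> - K) (\<phi> m) (\<Gamma> m)) \<and>
        (\<forall>\<epsilon>>0. \<exists>N. \<forall>m\<ge>N. \<forall>k\<ge>N. energy \<Omega> A E t (\<lambda>x. \<Gamma> m x - \<Gamma> k x) < ennreal \<epsilon>) \<and>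
        (\<forall>C. compact C \<and> C \<subseteq> \<Omega> - K \<longrightarrow>
           (\<lambda>m. \<integral>\<^sup>+x\<in>C. ennreal \<bar>\<phi> m x - u x\<bar> \<partial>lebesgue) \<longlonglongrightarrow> 0))}"

definition hardy_term ::
  "(real^'n::finite) set \<Rightarrow> (real^'n \<Rightarrow> real^'n^'n) \<Rightarrow> (real^'n \<Rightarrow> real) \<Rightarrow> real \<Rightarrow>
   (real^'n \<Rightarrow> real) \<Rightarrow> ennreal" where
  "hardy_term \<Omega> A E t u =
     (\<integral>\<^sup>+x\<in>\<Omega>. ennreal (normA_sq A x (grad E x) * E x powr (2 * t - 2) * (u x)\<^sup>2) \<partial>lebesgue)"

end

theory Submission
  imports Defs
begin

text \<open>
  Put \<open>U = \<Omega> - K\<close>. On \<open>U\<close> the weight \<open>E\<close> is smooth and positive, and \<open>div (A \<nabla>E) = 0\<close>, because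
  \<open>\<mu>\<close> is carried by \<open>K\<close>. For \<open>u\<close> Lipschitz with compact support in \<open>U\<close> put
  \<open>v = E\<^bsup>t - 1/2\<^esup> u\<close>. Expanding \<open>\<nabla>u\<close> produces the cross term \<open>(1/2 - t) A \<nabla>E \<bullet> \<nabla>(v\<^sup>2)\<close>,
  whose integral vanishes as \<open>A \<nabla>E\<close> is divergence free; hence
  \<open>\<integral> E\<^bsup>2t\<^esup> |\<nabla>u|\<^sub>A\<^sup>2 = (t - 1/2)\<^sup>2 \<integral> |\<nabla>E|\<^sub>A\<^sup>2 E\<^bsup>2t - 2\<^esup> u\<^sup>2 + \<integral> E |\<nabla>v|\<^sub>A\<^sup>2\<close>
  (lemma \<open>hardy_identity\<close>). Fatou's lemma along an almost everywhere convergent subsequence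
  turns this into \<open>(t - 1/2)\<^sup>2\<close> Hardy term + remainder \<open>\<le>\<close> energy for every \<open>u\<close> in the completion
  (lemma \<open>hardy_remainder_closure\<close>), which contains the inequality.

  Let \<open>W\<close> be a connected component of \<open>U\<close>. As \<open>\<Omega>\<close> is connected, \<open>W\<close> reaches \<open>K\<close>, so \<open>E\<close> is unbounded
  on \<open>W\<close>, and for large \<open>a\<close> the sets where \<open>a \<le> ln E \<le> b\<close> are compact in \<open>W\<close>. Testing the equation
  with \<open>H (ln E)\<close> on \<open>W\<close> gives
  \<open>\<integral>\<^sub>W H' (ln E) |\<nabla>E|\<^sub>A\<^sup>2 / E = 0\<close> for smooth \<open>H\<close> supported in large values, and therefore
  \<open>\<integral>\<^sub>W g (ln E) |\<nabla>E|\<^sub>A\<^sup>2 / E = m \<integral> g\<close> with a constant \<open>m\<close>. The constant is positive: otherwise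
  \<open>\<nabla>E\<close> would vanish at high levels and \<open>E\<close> would be constant on \<open>W\<close> (lemma \<open>level_density\<close>).
  So on functions \<open>u = E\<^bsup>1/2 - t\<^esup> h (ln E)\<close> the remainder is \<open>m \<integral> h'\<^sup>2\<close> and the Hardy term
  is \<open>m \<integral> h\<^sup>2\<close>; stretching \<open>h\<close> makes their quotient tend to 0, and the constant is optimal.

  If equality holds for \<open>u\<close>, then the remainder of \<open>u\<close> is zero, so \<open>v\<close> has vanishing weak gradient and
  is almost everywhere equal to a constant \<open>k\<close> on each component \<open>W\<close>. The Hardy term of \<open>u\<close> is then at
  least \<open>k\<^sup>2 \<integral>\<^sub>W |\<nabla>E|\<^sub>A\<^sup>2 / E\<close>. That integral is infinite by the level set formula, while elements of
  the completion have finite energy; so \<open>k = 0\<close>. The bound on the box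
  dimension shows that \<open>K\<close> is a nonempty null set, so integrals over \<open>\<Omega>\<close> and \<open>U\<close> agree.
\<close>

section \<open>Differentiability of finite order\<close>

text \<open>
  \<open>Cn n U f\<close> says that \<open>f\<close> is \<open>n\<close> times differentiable at every point of \<open>U\<close>; the \<open>n\<close>th
  derivatives need not be continuous. The gradient is existentially quantified, so that closure
  under algebraic operations follows by induction on \<open>n\<close>. Smoothness is \<open>Cn n U f\<close> for all \<open>n\<close>.
  The type is that of a Euclidean space in order to cover the real line as well.
\<close>
primrec Cn :: "nat \<Rightarrow> 'a::euclidean_space set \<Rightarrow> ('a \<Rightarrow> real) \<Rightarrow> bool" where
  "Cn 0 U f \<longleftrightarrow> True"
| "Cn (Suc n) U f \<longleftrightarrow> (\<exists>g. (\<forall>x\<in>U. (f has_derivative (\<lambda>h. g x \<bullet> h)) (at x)) \<and>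
     (\<forall>b\<in>Basis. Cn n U (\<lambda>x. g x \<bullet> b)))"

lemma Cn_SucD: "Cn (Suc n) U f \<Longrightarrow> Cn n U f"
proof (induction n arbitrary: f)
  case (Suc n)
  from Suc.prems obtain g where "\<forall>x\<in>U. (f has_derivative (\<lambda>h. g x \<bullet> h)) (at x)"
    "\<forall>b\<in>Basis. Cn (Suc n) U (\<lambda>x. g x \<bullet> b)" unfolding Cn.simps(2)[of "Suc n"] by blast
  with Suc.IH show ?case unfolding Cn.simps(2)[of n] by blast
qed simp

lemma Cn_cong:
  assumes "Cn n U f" "open U" "\<And>x. x \<in> U \<Longrightarrow> f x = g x"
  shows "Cn n U g"
proof (cases n)
  case (Suc m)
  with assms(1) obtain f' where f': "\<forall>x\<in>U. (f has_derivative (\<lambda>h. f' x \<bullet> h)) (at x)"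
    "\<forall>b\<in>Basis. Cn m U (\<lambda>x. f' x \<bullet> b)" by auto
  have "\<forall>x\<in>U. (g has_derivative (\<lambda>h. f' x \<bullet> h)) (at x)"
    using f'(1) assms(2,3) has_derivative_transform_within_open by blast
  with f'(2) Suc show ?thesis by auto
qed simp

lemma Cn_subset: "Cn n U f \<Longrightarrow> V \<subseteq> U \<Longrightarrow> Cn n V f"
proof (induction n arbitrary: f)
  case (Suc n)
  from Suc.prems obtain g where "\<forall>x\<in>U. (f has_derivative (\<lambda>h. g x \<bullet> h)) (at x)"
    "\<forall>b\<in>Basis. Cn n U (\<lambda>x. g x \<bullet> b)" by auto
  with Suc.IH Suc.prems(2) show ?case by (auto intro!: exI[of _ g])
qed simp

lemma Cn_const: "Cn n U (\<lambda>x. c)"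
proof (induction n arbitrary: c)
  case (Suc n)
  then show ?case by (auto intro!: exI[of _ "\<lambda>x. 0"])
qed simp

lemma Cn_inner: "Cn n U (\<lambda>x. x \<bullet> a)"
proof (cases n)
  case (Suc n)
  have "\<And>x. ((\<lambda>x. x \<bullet> a) has_derivative (\<lambda>h. a \<bullet> h)) (at x)"
    by (auto intro!: derivative_eq_intros simp: inner_commute)
  then show ?thesis unfolding Suc by (auto intro!: exI[of _ "\<lambda>x. a"] Cn_const)
qed simp

lemma Cn_add: "Cn n U f \<Longrightarrow> Cn n U g \<Longrightarrow> Cn n U (\<lambda>x. f x + g x)"
proof (induction n arbitrary: f g)
  case (Suc n)
  from Suc.prems obtain f' g' where
    "\<forall>x\<in>U. (f has_derivative (\<lambda>h. f' x \<bullet> h)) (at x)" "\<forall>b\<in>Basis. Cn n U (\<lambda>x. f' x \<bullet> b)"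
    "\<forall>x\<in>U. (g has_derivative (\<lambda>h. g' x \<bullet> h)) (at x)" "\<forall>b\<in>Basis. Cn n U (\<lambda>x. g' x \<bullet> b)"
    by auto
  with Suc.IH show ?case
    by (auto intro!: exI[of _ "\<lambda>x. f' x + g' x"] derivative_eq_intros simp: inner_add_left)
qed simp

lemma Cn_mult: "Cn n U f \<Longrightarrow> Cn n U g \<Longrightarrow> Cn n U (\<lambda>x. f x * g x)"
proof (induction n arbitrary: f g)
  case (Suc n)
  from Suc.prems obtain f' g' where d:
    "\<forall>x\<in>U. (f has_derivative (\<lambda>h. f' x \<bullet> h)) (at x)" "\<forall>b\<in>Basis. Cn n U (\<lambda>x. f' x \<bullet> b)"
    "\<forall>x\<in>U. (g has_derivative (\<lambda>h. g' x \<bullet> h)) (at x)" "\<forall>b\<in>Basis. Cn n U (\<lambda>x. g' x \<bullet> b)"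
    by auto
  have "Cn n U f" "Cn n U g" using Suc.prems Cn_SucD by blast+
  then have "\<forall>b\<in>Basis. Cn n U (\<lambda>x. (f x *\<^sub>R g' x + g x *\<^sub>R f' x) \<bullet> b)"
    using d Suc.IH by (simp add: inner_add_left Cn_add)
  moreover have "\<forall>x\<in>U. ((\<lambda>x. f x * g x) has_derivative (\<lambda>h. (f x *\<^sub>R g' x + g x *\<^sub>R f' x) \<bullet> h)) (at x)"
    using d by (auto intro!: derivative_eq_intros simp: inner_add_left algebra_simps)
  ultimately show ?case unfolding Cn.simps(2) by (intro exI[of _ "\<lambda>x. f x *\<^sub>R g' x + g x *\<^sub>R f' x"] conjI)
qed simp

lemma Cn_cmult: "Cn n U f \<Longrightarrow> Cn n U (\<lambda>x. c * f x)"
  by (intro Cn_mult Cn_const)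

lemma Cn_diff: "Cn n U f \<Longrightarrow> Cn n U g \<Longrightarrow> Cn n U (\<lambda>x. f x - g x)"
  using Cn_add[of n U f "\<lambda>x. (-1) * g x"] Cn_cmult[of n U g "-1"] by simp

lemma Cn_sum: "(\<And>i. i \<in> I \<Longrightarrow> Cn n U (f i)) \<Longrightarrow> Cn n U (\<lambda>x. \<Sum>i\<in>I. f i x)"
  by (induction I rule: infinite_finite_induct) (auto intro: Cn_const Cn_add)

lemma Cn_prod: "(\<And>i. i \<in> I \<Longrightarrow> Cn n U (f i)) \<Longrightarrow> Cn n U (\<lambda>x. \<Prod>i\<in>I. f i x)"
  by (induction I rule: infinite_finite_induct) (auto intro: Cn_const Cn_mult)

lemma Cn_power: "Cn n U f \<Longrightarrow> Cn n U (\<lambda>x. f x ^ k)"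
  by (induction k) (auto intro: Cn_const Cn_mult)

lemma Cn_compose:
  fixes h :: "real \<Rightarrow> real"
  shows "Cn n V h \<Longrightarrow> Cn n U f \<Longrightarrow> (\<And>x. x \<in> U \<Longrightarrow> f x \<in> V) \<Longrightarrow> Cn n U (\<lambda>x. h (f x))"
proof (induction n arbitrary: h)
  case (Suc n)
  from Suc.prems obtain f' h' where d:
    "\<forall>x\<in>U. (f has_derivative (\<lambda>h. f' x \<bullet> h)) (at x)" "\<forall>b\<in>Basis. Cn n U (\<lambda>x. f' x \<bullet> b)"
    "\<forall>x\<in>V. (h has_derivative (\<lambda>y. h' x * y)) (at x)" "Cn n V h'"
    by auto
  have "Cn n U (\<lambda>x. h' (f x))"
    by (rule Suc.IH[OF d(4) Cn_SucD[OF Suc.prems(2)] Suc.prems(3)])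
  then have "\<forall>b\<in>Basis. Cn n U (\<lambda>x. (h' (f x) *\<^sub>R f' x) \<bullet> b)"
    using d(2) by (simp add: Cn_mult)
  moreover have "((\<lambda>x. h (f x)) has_derivative (\<lambda>y. (h' (f x) *\<^sub>R f' x) \<bullet> y)) (at x)" if "x \<in> U" for x
    using diff_chain_at[of f _ x h, OF d(1)[rule_format, OF that] d(3)[rule_format, OF Suc.prems(3)[OF that]]]
    by (simp add: o_def)
  ultimately show ?case unfolding Cn.simps(2) by (intro exI[of _ "\<lambda>x. h' (f x) *\<^sub>R f' x"] conjI) (auto simp del: inner_scaleR_left)
qed simp

lemma inner_unique:
  fixes a b :: "'a::euclidean_space"
  assumes "(f has_derivative (\<lambda>h. a \<bullet> h)) (at x)" "(f has_derivative (\<lambda>h. b \<bullet> h)) (at x)"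
  shows "a = b"
  using has_derivative_unique[OF assms] by (metis vector_eq_rdot inner_commute)

text \<open>
  The gradients obtained from different neighbourhoods agree, as gradients are unique; this is what
  allows them to be glued together.
\<close>
lemma Cn_local:
  assumes "\<And>x. x \<in> U \<Longrightarrow> \<exists>V. open V \<and> x \<in> V \<and> Cn n V f"
  shows "Cn n U f"
  using assms
proof (induction n arbitrary: f)
  case (Suc n)
  define G where "G x = (SOME d. (f has_derivative (\<lambda>h. d \<bullet> h)) (at x))" for x
  have G: "G x = d" if "(f has_derivative (\<lambda>h. d \<bullet> h)) (at x)" for x d
    unfolding G_def using that by (metis (mono_tags, lifting) someI inner_unique)
  have *: "\<exists>V. open V \<and> x \<in> V \<and> (\<forall>y\<in>V. (f has_derivative (\<lambda>h. G y \<bullet> h)) (at y)) \<and> (\<forall>b\<in>Basis. Cn n V (\<lambda>x. G x \<bullet> b))"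
    if "x \<in> U" for x
  proof -
    from Suc.prems[OF that] obtain V g where V: "open V" "x \<in> V" and
     g: "\<forall>x\<in>V. (f has_derivative (\<lambda>h. g x \<bullet> h)) (at x)" "\<forall>b\<in>Basis. Cn n V (\<lambda>x. g x \<bullet> b)" by auto
    have "\<forall>y\<in>V. G y = g y" using g G by blast
    with V g show ?thesis by (intro exI[of _ V] conjI ballI) (auto intro: Cn_cong)
  qed
  then have "\<forall>b\<in>Basis. Cn n U (\<lambda>x. G x \<bullet> b)"
    by (intro ballI Suc.IH) blast
  moreover have "\<forall>x\<in>U. (f has_derivative (\<lambda>h. G x \<bullet> h)) (at x)"
    using * by blast
  ultimately show ?case by auto
qed simp

lemma Cn_translation:
  "Cn n UNIV f \<Longrightarrow> Cn n UNIV (\<lambda>x. f (x - z))"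
proof (induction n arbitrary: f)
  case (Suc n)
  from Suc.prems obtain g where g: "\<And>x. (f has_derivative (\<lambda>h. g x \<bullet> h)) (at x)"
    "\<forall>b\<in>Basis. Cn n UNIV (\<lambda>x. g x \<bullet> b)" by auto
  have "((\<lambda>x. x - z) has_derivative (\<lambda>h. h)) (at x)" for x :: 'a
    by (auto intro!: derivative_eq_intros)
  then have "((\<lambda>x. f (x - z)) has_derivative (\<lambda>h. g (x - z) \<bullet> h)) (at x)" for x
    using diff_chain_at[of "\<lambda>x. x - z" "\<lambda>h. h" x f, OF _ g(1)] by (simp add: o_def)
  then show ?case using Suc.IH g(2) by (auto intro!: exI[of _ "\<lambda>x. g (x - z)"])
qed simp

lemma Cn_powr: "Cn n {0<..} (\<lambda>x::real. x powr r)"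
proof (induction n arbitrary: r)
  case (Suc n)
  have "((\<lambda>x::real. x powr r) has_derivative (\<lambda>h. (r * x powr (r - 1)) \<bullet> h)) (at x)" if "x > 0" for x
    using has_real_derivative_powr[OF that, of r] by (simp add: has_field_derivative_def)
  then show ?case using Suc
    by (auto intro!: exI[of _ "\<lambda>x. r * x powr (r - 1)"] Cn_cmult)
qed simp

lemma Cn_ln: "Cn n {0<..} (ln :: real \<Rightarrow> real)"
proof (cases n)
  case (Suc n)
  have "(ln has_derivative (\<lambda>h. (x powr (-1)) \<bullet> h)) (at x)" if "x > 0" for x :: real
  proof -
    have "(*) (1 / x) = (\<lambda>h. (x powr (-1)) \<bullet> h)"
      using that by (simp add: fun_eq_iff powr_minus_divide)
    then show ?thesis using DERIV_ln_divide[OF that] unfolding has_field_derivative_def by simp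
  qed
  then show ?thesis unfolding Suc using Cn_powr
    by (auto intro!: exI[of _ "\<lambda>x. x powr (-1)"])
qed simp

lemma Cn_differentiable: "Cn (Suc 0) U f \<Longrightarrow> x \<in> U \<Longrightarrow> f differentiable (at x)"
  by (auto simp: differentiable_def)

lemma Cn_continuous_on: "Cn (Suc 0) U f \<Longrightarrow> continuous_on U f"
  by (meson Cn_differentiable continuous_at_imp_continuous_on differentiable_imp_continuous_within)

lemma has_derivative_pd:
  assumes "(f has_derivative f') (at x)"
  shows "pd i f x = f' (axis i 1)"
  unfolding pd_def using frechet_derivative_at[OF assms] by simp

lemma has_derivative_grad:
  assumes "f differentiable (at x)"
  shows "(f has_derivative (\<lambda>h. grad f x \<bullet> h)) (at x)"
proof -
  obtain f' where f': "(f has_derivative f') (at x)" using assms by (auto simp: differentiable_def)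
  interpret bounded_linear f' using f' by (rule has_derivative_bounded_linear)
  have "f' h = grad f x \<bullet> h" for h
  proof -
    have "f' h = f' (\<Sum>i\<in>UNIV. h $ i *\<^sub>R axis i 1)"
      by (simp add: basis_expansion flip: scalar_mult_eq_scaleR)
    also have "\<dots> = (\<Sum>i\<in>UNIV. h $ i * f' (axis i 1))" by (simp add: sum scaleR)
    also have "\<dots> = grad f x \<bullet> h"
      unfolding inner_vec_def grad_def has_derivative_pd[OF f'] by (simp add: mult.commute)
    finally show ?thesis .
  qed
  then show ?thesis using f' by presburger
qed

lemma grad_eqI: "(f has_derivative (\<lambda>h. g \<bullet> h)) (at x) \<Longrightarrow> grad f x = g"
  using has_derivative_grad[of f x] inner_unique unfolding differentiable_def by blast

lemma grad_nth [simp]: "grad f x $ i = pd i f x"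
  by (simp add: grad_def)

lemma Cn_pd:
  assumes "Cn (Suc n) U f" "open U" shows "Cn n U (pd i f)"
proof -
  from assms obtain g where g: "\<forall>x\<in>U. (f has_derivative (\<lambda>h. g x \<bullet> h)) (at x)"
    "\<forall>b\<in>Basis. Cn n U (\<lambda>x. g x \<bullet> b)" by auto
  have "Cn n U (\<lambda>x. g x \<bullet> axis i 1)" using g(2) by (simp add: axis_in_Basis_iff)
  then show ?thesis
  proof (rule Cn_cong[OF _ assms(2)])
    fix x assume "x \<in> U"
    then show "g x \<bullet> axis i 1 = pd i f x" using has_derivative_pd[OF g(1)[rule_format]] by simp
  qed
qed

lemma smooth_in_iff_Cn:
  assumes "open U"
  shows "smooth_in U f \<longleftrightarrow> (\<forall>n. Cn n U f)"
proof
  assume "smooth_in U f"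
  have "Cn n U f" if "\<And>is x. x \<in> U \<Longrightarrow> pds is f differentiable (at x)" for n f
    using that
  proof (induction n arbitrary: f)
    case (Suc n)
    have "\<And>i is. pds is (pd i f) = pds (is @ [i]) f" by (simp add: pds_def)
    then have "Cn n U (pd i f)" for i using Suc.IH[of "pd i f"] Suc.prems by metis
    then have "\<forall>b\<in>Basis. Cn n U (\<lambda>x. grad f x \<bullet> b)"
      by (auto simp: Basis_vec_def inner_axis)
    moreover have "\<forall>x\<in>U. (f has_derivative (\<lambda>h. grad f x \<bullet> h)) (at x)"
      using Suc.prems[of _ "[]"] by (auto simp: pds_def intro!: has_derivative_grad)
    ultimately show ?case by auto
  qed simp
  with \<open>smooth_in U f\<close> show "\<forall>n. Cn n U f" by (auto simp: smooth_in_def)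
next
  assume f: "\<forall>n. Cn n U f"
  have "\<forall>n. Cn n U (pds is f)" for "is"
  proof (induction "is")
    case (Cons i "is")
    then have "\<forall>n. Cn n U (pd i (pds is f))" using Cn_pd assms by blast
    then show ?case by (simp add: pds_def)
  qed (use f in \<open>simp add: pds_def\<close>)
  then show "smooth_in U f" unfolding smooth_in_def using Cn_differentiable by blast
qed

section \<open>Bump functions and test functions\<close>

text \<open>
  The standard smooth function that vanishes exactly on the nonpositive half line.
\<close>
definition flat :: "real \<Rightarrow> real" where
  "flat x = (if x > 0 then exp (- (1 / x)) else 0)"

lemma flat_aux_tendsto:
  "((\<lambda>x::real. (1/x) ^ k * exp (- (1/x))) \<longlongrightarrow> 0) (at_right 0)"
proof -
  have "filterlim (\<lambda>x::real. 1/x) at_top (at_right 0)"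
    using filterlim_inverse_at_top_right by (simp add: inverse_eq_divide)
  from filterlim_compose[OF tendsto_power_div_exp_0[of k] this]
  show ?thesis by (simp add: exp_minus divide_inverse)
qed

text \<open>
  The statement is generalized over the power of \<open>1/x\<close>, since the derivative of the \<open>k\<close>th function is
  a combination of those with exponents \<open>k + 1\<close> and \<open>k + 2\<close>.
\<close>
lemma Cn_flat_aux: "Cn n UNIV (\<lambda>x::real. if x > 0 then (1/x) ^ k * exp (- (1/x)) else 0)"
proof (induction n arbitrary: k)
  case (Suc n)
  let ?f = "\<lambda>k x::real. if x > 0 then (1/x) ^ k * exp (- (1/x)) else 0"
  have d: "(?f k has_real_derivative (?f (k+2) x - real k * ?f (k+1) x)) (at x)" for x
  proof -
    consider "x > 0" | "x < 0" | "x = 0" by linarith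
    then show ?thesis
    proof cases
      case 1
      have "((\<lambda>x. (1/x) ^ k * exp (- (1/x))) has_real_derivative
          (?f (k+2) x - real k * ?f (k+1) x)) (at x)"
      proof (cases k)
        case 0
        show ?thesis unfolding 0 using 1
          by (auto intro!: derivative_eq_intros simp: power2_eq_square)
      next
        case (Suc m)
        show ?thesis unfolding Suc using 1
          by (auto intro!: derivative_eq_intros simp: divide_simps power2_eq_square)
             (cases m; simp add: algebra_simps)
      qed
      then show ?thesis
        by (rule has_field_derivative_transform_within_open[of _ _ _ "{0<..}"]) (use 1 in auto)
    next
      case 2
      have "((\<lambda>x. 0::real) has_real_derivative (?f (k+2) x - real k * ?f (k+1) x)) (at x)"
        using 2 by simp
      then show ?thesis
        by (rule has_field_derivative_transform_within_open[of _ _ _ "{..<0}"]) (use 2 in auto)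
    next
      case 3
      have "((\<lambda>y. ?f k y / y) \<longlongrightarrow> 0) (at_left 0)"
        by (rule tendsto_eventually) (auto simp: eventually_at_filter)
      moreover have "((\<lambda>y. ?f k y / y) \<longlongrightarrow> 0) (at_right 0)"
        by (rule Lim_transform_eventually[OF flat_aux_tendsto[of "Suc k"]])
           (auto simp: eventually_at_filter)
      ultimately have "((\<lambda>y. ?f k y / y) \<longlongrightarrow> 0) (at 0)"
        by (simp add: filterlim_split_at)
      then show ?thesis using 3 by (simp add: has_field_derivative_iff)
    qed
  qed
  have "\<forall>x. (?f k has_derivative (\<lambda>h. (?f (k+2) x - real k * ?f (k+1) x) \<bullet> h)) (at x)"
    using d unfolding has_field_derivative_def by (simp add: inner_real_def[abs_def])
  moreover have "Cn n UNIV (\<lambda>x. ?f (k+2) x - real k * ?f (k+1) x)"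
    using Suc by (intro Cn_diff Cn_cmult)
  ultimately show ?case unfolding Cn.simps(2)
    by (intro exI[of _ "\<lambda>x. ?f (k+2) x - real k * ?f (k+1) x"]) (simp del: of_nat_Suc)
qed simp

lemma Cn_flat: "Cn n UNIV flat"
  using Cn_flat_aux[of n 0] by (simp add: flat_def[abs_def] cong: if_cong)

lemma flat_nonneg: "flat x \<ge> 0" and flat_pos_iff: "flat x > 0 \<longleftrightarrow> x > 0" and flat_less_1: "flat x < 1"
  by (auto simp: flat_def)

lemma flat_eq_0_iff: "flat x = 0 \<longleftrightarrow> x \<le> 0"
  by (auto simp: flat_def)

lemma Cn_flat_compose: "Cn n U f \<Longrightarrow> Cn n U (\<lambda>x. flat (f x))"
  by (rule Cn_compose[OF Cn_flat]) auto

text \<open>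
  A smooth function that is positive exactly on the open box with corners \<open>p\<close> and \<open>q\<close>.
\<close>
definition box_bump :: "'a::euclidean_space \<Rightarrow> 'a \<Rightarrow> 'a \<Rightarrow> real" where
  "box_bump p q x = (\<Prod>b\<in>Basis. flat (x \<bullet> b - p \<bullet> b) * flat (q \<bullet> b - x \<bullet> b))"

lemma Cn_box_bump: "Cn n U (box_bump p q)"
  unfolding box_bump_def[abs_def]
  by (intro Cn_prod Cn_mult Cn_flat_compose Cn_diff Cn_inner Cn_const)

lemma box_bump_nonneg: "box_bump p q x \<ge> 0"
  unfolding box_bump_def by (intro prod_nonneg mult_nonneg_nonneg) (auto simp: flat_nonneg)

lemma box_bump_pos: "x \<in> box p q \<Longrightarrow> box_bump p q x > 0"
  unfolding box_bump_def
  by (intro prod_pos mult_pos_pos) (auto simp: flat_pos_iff mem_box)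

lemma box_bump_eq_0: "x \<notin> box p q \<Longrightarrow> box_bump p q x = 0"
  unfolding box_bump_def by (auto simp: prod_zero_iff flat_eq_0_iff mem_box not_less)

lemma test_functions_iff:
  "f \<in> test_functions U \<longleftrightarrow> (\<forall>n. Cn n UNIV f) \<and> (\<exists>S. compact S \<and> S \<subseteq> U \<and> (\<forall>x. x \<notin> S \<longrightarrow> f x = 0))"
proof -
  have "compactly_supported_in U f \<longleftrightarrow> (\<exists>S. compact S \<and> S \<subseteq> U \<and> (\<forall>x. x \<notin> S \<longrightarrow> f x = 0))"
  proof
    assume "compactly_supported_in U f"
    then show "\<exists>S. compact S \<and> S \<subseteq> U \<and> (\<forall>x. x \<notin> S \<longrightarrow> f x = 0)"
      unfolding compactly_supported_in_def using closure_subset[of "{x. f x \<noteq> 0}"]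
      by (intro exI[of _ "closure {x. f x \<noteq> 0}"]) auto
  next
    assume "\<exists>S. compact S \<and> S \<subseteq> U \<and> (\<forall>x. x \<notin> S \<longrightarrow> f x = 0)"
    then obtain S where S: "compact S" "S \<subseteq> U" "\<forall>x. x \<notin> S \<longrightarrow> f x = 0" by blast
    then have "{x. f x \<noteq> 0} \<subseteq> S" by blast
    then have "closure {x. f x \<noteq> 0} \<subseteq> S" using S(1) by (simp add: closure_minimal compact_imp_closed)
    then show "compactly_supported_in U f"
      unfolding compactly_supported_in_def
      using compact_Int_closed[OF S(1) closed_closure, of "{x. f x \<noteq> 0}"] S(2) by (auto simp: inf.absorb2)
  qed
  then show ?thesis by (auto simp: test_functions_def smooth_in_iff_Cn)
qed

lemma test_functionsI:
  assumes "\<And>n. Cn n UNIV f" "compact S" "S \<subseteq> U" "\<And>x. x \<notin> S \<Longrightarrow> f x = 0"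
  shows "f \<in> test_functions U"
  using assms by (auto simp: test_functions_iff)

lemma test_functionsE:
  assumes "f \<in> test_functions U"
  obtains S where "\<And>n. Cn n UNIV f" "compact S" "S \<subseteq> U" "\<And>x. x \<notin> S \<Longrightarrow> f x = 0"
  using assms by (auto simp: test_functions_iff)

lemma test_functions_mono: "f \<in> test_functions U \<Longrightarrow> U \<subseteq> V \<Longrightarrow> f \<in> test_functions V"
  by (auto simp: test_functions_iff)

text \<open>
  Extension by zero of a function that is smooth on \<open>V\<close> and vanishes outside a compact subset.
\<close>
lemma test_functions_extend:
  assumes "open V" "\<And>n. Cn n V f" "compact S" "S \<subseteq> V" "S \<subseteq> U" "\<And>x. x \<in> V \<Longrightarrow> x \<notin> S \<Longrightarrow> f x = 0"
  shows "(\<lambda>x. if x \<in> V then f x else 0) \<in> test_functions U"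
proof (rule test_functionsI[OF _ assms(3,5)])
  fix n
  let ?g = "\<lambda>x. if x \<in> V then f x else 0"
  have "Cn n V ?g" by (rule Cn_cong[OF assms(2,1)]) auto
  moreover have "Cn n (- S) ?g"
    by (rule Cn_cong[OF Cn_const[of _ _ 0]]) (use assms in \<open>auto simp: compact_imp_closed open_Compl\<close>)
  moreover have "open (- S)" using assms(3) by (simp add: compact_imp_closed open_Compl)
  ultimately show "Cn n UNIV ?g"
  proof (intro Cn_local)
    fix x
    show "\<exists>W. open W \<and> x \<in> W \<and> Cn n W ?g"
      by (cases "x \<in> V") (use \<open>Cn n V ?g\<close> \<open>Cn n (- S) ?g\<close> \<open>open (- S)\<close> assms(1,4) in blast)+
  qed
qed (use assms(6) in simp)

lemma test_functions_mult_smooth: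
  assumes "open U" "\<And>n. Cn n U f" "w \<in> test_functions U"
  shows "(\<lambda>x. if x \<in> U then f x * w x else 0) \<in> test_functions U"
proof -
  obtain S where S: "\<And>n. Cn n UNIV w" "compact S" "S \<subseteq> U" "\<And>x. x \<notin> S \<Longrightarrow> w x = 0"
    using assms(3) by (rule test_functionsE) blast
  show ?thesis
  proof (rule test_functions_extend[OF assms(1) _ S(2,3,3)])
    show "Cn n U (\<lambda>x. f x * w x)" for n
      by (rule Cn_mult[OF assms(2) Cn_subset[OF S(1)]]) simp
  qed (simp add: S(4))
qed

lemma has_derivative_zero_off_closed:
  fixes f :: "'a::real_normed_vector \<Rightarrow> real"
  assumes "closed S" "\<And>x. x \<notin> S \<Longrightarrow> f x = 0" "x \<notin> S"
  shows "(f has_derivative (\<lambda>_. 0)) (at x)"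
  by (rule has_derivative_transform_within_open[of "\<lambda>x. 0" _ _ _ "- S"]) (use assms in auto)

lemma test_functions_pd:
  assumes "w \<in> test_functions U" shows "pd i w \<in> test_functions U"
  using assms
proof (rule test_functionsE)
  fix S assume w: "\<And>n. Cn n UNIV w" "compact S" "S \<subseteq> U" "\<And>x. x \<notin> S \<Longrightarrow> w x = 0"
  have "pd i w x = 0" if "x \<notin> S" for x
    using has_derivative_pd[OF has_derivative_zero_off_closed[OF compact_imp_closed[OF w(2)] w(4) that]] .
  then show ?thesis using Cn_pd[OF w(1) open_UNIV] w(2,3) by (intro test_functionsI[of _ S])
qed

lemma test_functions_mult:
  "w \<in> test_functions U \<Longrightarrow> (\<And>n. Cn n UNIV f) \<Longrightarrow> (\<lambda>x. f x * w x) \<in> test_functions U"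
  by (erule test_functionsE, rule test_functionsI) (rule Cn_mult, auto)

text \<open>
  Finitely many box bumps cover \<open>S\<close>. Their sum exceeds some \<open>d > 0\<close> on \<open>S\<close> and is composed with a
  smooth step from 0 to 1 on the interval from 0 to \<open>d\<close>. The cutoff is 1 on a neighbourhood of \<open>S\<close>,
  so its gradient vanishes there.
\<close>
lemma smooth_cutoff:
  fixes S :: "(real^'n::finite) set"
  assumes "compact S" "open U" "S \<subseteq> U"
  obtains \<eta> V where "\<eta> \<in> test_functions U" "open V" "S \<subseteq> V" "V \<subseteq> U" "\<And>x. x \<in> V \<Longrightarrow> \<eta> x = 1"
    "\<And>x. 0 \<le> \<eta> x" "\<And>x. \<eta> x \<le> 1"
proof -
  have "\<exists>p q. x \<in> box p q \<and> cbox p q \<subseteq> U" if "x \<in> S" for x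
  proof -
    have "x \<in> U" using that assms(3) by blast
    then show ?thesis using open_contains_cbox[OF assms(2), of x] by metis
  qed
  then obtain p q where pq: "\<And>x. x \<in> S \<Longrightarrow> x \<in> box (p x) (q x) \<and> cbox (p x) (q x) \<subseteq> U" by metis
  have cov: "S \<subseteq> (\<Union>x\<in>S. box (p x) (q x))" using pq by blast
  obtain F where F: "F \<subseteq> S" "finite F" "S \<subseteq> (\<Union>x\<in>F. box (p x) (q x))"
    using compactE_image[OF assms(1) open_box cov] by blast
  define \<sigma> where "\<sigma> y = (\<Sum>x\<in>F. box_bump (p x) (q x) y)" for y
  have C\<sigma>: "Cn n UNIV \<sigma>" for n unfolding \<sigma>_def by (intro Cn_sum Cn_box_bump)
  have \<sigma>_nn: "\<sigma> y \<ge> 0" for y unfolding \<sigma>_def by (intro sum_nonneg box_bump_nonneg)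
  have \<sigma>_pos: "\<sigma> y > 0" if "y \<in> S" for y
  proof -
    from that F(3) obtain x where "x \<in> F" "y \<in> box (p x) (q x)" by blast
    then show ?thesis unfolding \<sigma>_def using F(2)
      by (intro sum_pos2[of _ x]) (auto simp: box_bump_pos box_bump_nonneg)
  qed
  have cont: "continuous_on UNIV \<sigma>" using C\<sigma> Cn_continuous_on by blast
  obtain c where c: "c > 0" "\<And>y. y \<in> S \<Longrightarrow> \<sigma> y \<ge> c"
  proof (cases "S = {}")
    case False
    obtain y where "y \<in> S" "\<forall>z\<in>S. \<sigma> y \<le> \<sigma> z"
      using continuous_attains_inf[OF assms(1) False continuous_on_subset[OF cont]] by auto
    then show ?thesis using \<sigma>_pos that[of "\<sigma> y"] by auto
  qed (use that[of 1] in auto)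
  define d where "d = c / 2"
  have d: "d > 0" "\<And>y. y \<in> S \<Longrightarrow> \<sigma> y > d" using c unfolding d_def by fastforce+
  define \<eta> where "\<eta> y = flat (\<sigma> y) * (flat (\<sigma> y) + flat (d - \<sigma> y)) powr (- 1)" for y
  \<comment> \<open>At least one of the two arguments is positive, as their sum \<open>d\<close> is.\<close>
  have den: "flat s + flat (d - s) > 0" for s
    using flat_pos_iff[of s] flat_pos_iff[of "d - s"] flat_nonneg[of s] flat_nonneg[of "d - s"] d(1)
    by (smt (verit))
  have \<eta>: "\<eta> y = flat (\<sigma> y) / (flat (\<sigma> y) + flat (d - \<sigma> y))" for y
    unfolding \<eta>_def using den[of "\<sigma> y"] by (simp add: powr_minus_divide)
  have "Cn n UNIV \<eta>" for n unfolding \<eta>_def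
    by (intro Cn_mult Cn_flat_compose C\<sigma> Cn_compose[OF Cn_powr] Cn_add Cn_diff Cn_const) (use den in auto)
  moreover have "compact (\<Union>x\<in>F. cbox (p x) (q x))" using F(2) by (intro compact_UN) auto
  moreover have "(\<Union>x\<in>F. cbox (p x) (q x)) \<subseteq> U" using pq F by blast
  moreover have "\<eta> y = 0" if "y \<notin> (\<Union>x\<in>F. cbox (p x) (q x))" for y
  proof -
    have "\<sigma> y = 0" unfolding \<sigma>_def using that box_subset_cbox by (intro sum.neutral ballI box_bump_eq_0) blast
    then show ?thesis unfolding \<eta> by (simp add: flat_def)
  qed
  ultimately have "\<eta> \<in> test_functions U" by (intro test_functionsI)
  moreover have "open {y. \<sigma> y > d}" using cont by (intro open_Collect_less continuous_on_const)
  moreover have "\<eta> y = 1" if "\<sigma> y > d" for y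
    unfolding \<eta> using that d by (simp add: flat_def)
  moreover have "0 \<le> \<eta> y" "\<eta> y \<le> 1" for y unfolding \<eta> using den[of "\<sigma> y"] flat_nonneg by (auto simp: divide_le_eq)
  ultimately show ?thesis using assms d(2)
    by (intro that[of \<eta> "{y. \<sigma> y > d} \<inter> U"]) auto
qed

text \<open>
  An almost everywhere statement may be checked near each point, by Lindelof's theorem.
\<close>
lemma AE_local:
  fixes W :: "'a::second_countable_topology set"
  assumes "\<And>x. x \<in> W \<Longrightarrow> \<exists>V. open V \<and> x \<in> V \<and> (AE y in M. y \<in> V \<longrightarrow> P y)"
  shows "AE y in M. y \<in> W \<longrightarrow> P y"
proof -
  define \<F> where "\<F> = {V. open V \<and> (AE y in M. y \<in> V \<longrightarrow> P y)}"
  have "open V" if "V \<in> \<F>" for V using that by (simp add: \<F>_def)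
  then obtain \<F>' where F: "\<F>' \<subseteq> \<F>" "countable \<F>'" "\<Union>\<F>' = \<Union>\<F>"
    by (rule Lindelof)
  have ae: "AE y in M. \<forall>V\<in>\<F>'. y \<in> V \<longrightarrow> P y"
  proof (subst AE_ball_countable[OF F(2)], intro ballI)
    fix V assume "V \<in> \<F>'"
    then have "V \<in> \<F>" using F(1) by (rule rev_subsetD)
    then show "AE y in M. y \<in> V \<longrightarrow> P y" by (simp add: \<F>_def)
  qed
  have sub: "W \<subseteq> \<Union>\<F>'"
  proof
    fix x assume "x \<in> W"
    from assms[OF this] obtain V where "V \<in> \<F>" "x \<in> V" unfolding \<F>_def by blast
    then show "x \<in> \<Union>\<F>'" unfolding F(3) by blast
  qed
  from ae show ?thesis by eventually_elim (use sub in auto)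
qed

lemma locally_integrable_test:
  assumes "locally_integrable U g" "compact S" "S \<subseteq> U" "f \<in> borel_measurable lebesgue"
    "\<And>x. \<bar>f x\<bar> \<le> B" "\<And>x. x \<notin> S \<Longrightarrow> f x = 0"
  shows "integrable lebesgue (\<lambda>x. g x * f x)"
proof -
  have g: "integrable lebesgue (\<lambda>x. indicator S x *\<^sub>R g x)"
    using assms by (auto simp: locally_integrable_def set_integrable_def)
  have eq: "g x * f x = (indicator S x *\<^sub>R g x) * f x" for x
    using assms(6)[of x] by (cases "x \<in> S") auto
  show ?thesis unfolding eq
    
  proof (rule Bochner_Integration.integrable_bound[of _ "\<lambda>x. B * (indicator S x *\<^sub>R g x)"])
    show "integrable lebesgue (\<lambda>x. B * (indicator S x *\<^sub>R g x))" using g by (rule integrable_mult_right)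
    show "(\<lambda>x. indicator S x *\<^sub>R g x * f x) \<in> borel_measurable lebesgue"
      using g assms(4) by (intro borel_measurable_times) (auto dest: borel_measurable_integrable)
    have "B \<ge> 0" using assms(5)[of undefined] by linarith
    then show "AE x in lebesgue. norm (indicator S x *\<^sub>R g x * f x) \<le> norm (B * (indicator S x *\<^sub>R g x))"
      using assms(5) by (intro AE_I2) (auto simp: abs_mult mult.commute[of "\<bar>g _\<bar>"] intro!: mult_right_mono split: split_indicator)
  qed
qed

section \<open>Testing with smooth functions, difference quotients and integration by parts\<close>

lemma borel_lebesgue: "f \<in> borel_measurable borel \<Longrightarrow> f \<in> borel_measurable lebesgue"
  by (rule measurable_completion) simp

lemma continuous_lebesgue_measurable:
  "continuous_on UNIV f \<Longrightarrow> f \<in> borel_measurable lebesgue"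
  by (intro borel_lebesgue borel_measurable_continuous_onI)

lemma test_continuous: "f \<in> test_functions U \<Longrightarrow> continuous_on UNIV f"
  by (auto simp: test_functions_iff intro: Cn_continuous_on)

lemma set_integrable_compact:
  "locally_integrable U g \<Longrightarrow> compact C \<Longrightarrow> C \<subseteq> U \<Longrightarrow> integrable lebesgue (\<lambda>x. indicator C x *\<^sub>R g x)"
  by (simp only: locally_integrable_def set_integrable_def)

text \<open>
  Indicator functions of compact sets are pointwise limits of test functions with a common compact
  support.
\<close>
lemma cutoff_sequence:
  fixes C :: "(real^'n::finite) set"
  assumes "compact C" "open U" "C \<subseteq> U"
  obtains \<eta> D where "\<And>k::nat. \<eta> k \<in> test_functions U" "compact D" "D \<subseteq> U" "\<And>k x. x \<notin> D \<Longrightarrow> \<eta> k x = 0"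
    "\<And>k x. 0 \<le> \<eta> k x" "\<And>k x. \<eta> k x \<le> 1" "\<And>x. (\<lambda>k. \<eta> k x) \<longlonglongrightarrow> indicator C x"
proof (cases "C = {}")
  case True
  show ?thesis
    by (rule that[of "\<lambda>_ _. 0" "{}"]) (auto simp: True intro!: test_functionsI[of _ "{}"] Cn_const)
next
  case False
  obtain \<eta>0 V0 where \<eta>0: "\<eta>0 \<in> test_functions U" "C \<subseteq> V0" "\<And>x. x \<in> V0 \<Longrightarrow> \<eta>0 x = 1"
    "\<And>x. 0 \<le> \<eta>0 x" "\<And>x. \<eta>0 x \<le> 1"
    using smooth_cutoff[OF assms] by metis
  obtain D where D: "\<And>n. Cn n UNIV \<eta>0" "compact D" "D \<subseteq> U" "\<And>x. x \<notin> D \<Longrightarrow> \<eta>0 x = 0"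
    using \<eta>0(1) by (rule test_functionsE) blast
  define N where "N k = {x. infdist x C < 1 / real (Suc k)}" for k
  have N: "open (N k)" "C \<subseteq> N k" for k
    unfolding N_def by (auto intro!: open_Collect_less continuous_intros)
  have "\<exists>\<eta>. \<eta> \<in> test_functions (N k) \<and> (\<forall>x\<in>C. \<eta> x = 1) \<and> (\<forall>x. 0 \<le> \<eta> x \<and> \<eta> x \<le> 1)" for k
    using smooth_cutoff[OF assms(1) N] by (metis subsetD)
  then obtain \<eta>' where \<eta>': "\<And>k. \<eta>' k \<in> test_functions (N k)" "\<And>k x. x \<in> C \<Longrightarrow> \<eta>' k x = 1"
     "\<And>k x. 0 \<le> \<eta>' k x" "\<And>k x. \<eta>' k x \<le> 1" by metis
  show ?thesis
  proof (rule that[of "\<lambda>k x. \<eta>' k x * \<eta>0 x" D])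
    show "(\<lambda>x. \<eta>' k x * \<eta>0 x) \<in> test_functions U" for k
      using \<eta>'(1)[of k] by (intro test_functions_mult \<eta>0) (auto simp: test_functions_iff)
    show "\<eta>' k x * \<eta>0 x \<le> 1" for k x
      using mult_mono[OF \<eta>'(4)[of k x] \<eta>0(5)[of x]] \<eta>0(4)[of x] by simp
    show "(\<lambda>k. \<eta>' k x * \<eta>0 x) \<longlonglongrightarrow> indicator C x" for x
    proof (cases "x \<in> C")
      case True
      then have "\<eta>0 x = 1" using \<eta>0(2,3) by blast
      then show ?thesis using True \<eta>'(2) by simp
    next
      case False
      have "closed C" using assms(1) by (rule compact_imp_closed)
      then have "infdist x C > 0"
        using infdist_pos_not_in_closed[OF _ \<open>C \<noteq> {}\<close> False] by simp
      then obtain n where n: "inverse (real (Suc n)) < infdist x C" using reals_Archimedean by blast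
      have "\<eta>' k x = 0" if "k \<ge> n" for k
      proof -
        have "1 / real (Suc k) \<le> 1 / real (Suc n)" using that by (intro divide_left_mono) auto
        then have "x \<notin> N k" using n by (simp add: N_def inverse_eq_divide)
        moreover obtain S where "S \<subseteq> N k" "\<And>x. x \<notin> S \<Longrightarrow> \<eta>' k x = 0"
          using \<eta>'(1)[of k] by (rule test_functionsE) blast
        ultimately show ?thesis by blast
      qed
      then have "eventually (\<lambda>k. \<eta>' k x * \<eta>0 x = 0) sequentially"
        by (intro eventually_sequentiallyI[of n]) simp
      then show ?thesis using False by (simp add: tendsto_eventually)
    qed
  qed (use D \<eta>'(3) \<eta>0(4) in auto)
qed

text \<open>
  A locally integrable function that is nonnegative as a distribution is nonnegative almost everywhere:
  its integral over each compact set is nonnegative, and a set of positive measure contains a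
  compact set of positive measure.
\<close>
lemma test_nonneg_imp_AE_nonneg:
  fixes g :: "real^'n::finite \<Rightarrow> real"
  assumes U: "open U" and g: "locally_integrable U g"
    and 0: "\<And>\<psi>. \<psi> \<in> test_functions U \<Longrightarrow> (\<And>x. \<psi> x \<ge> 0) \<Longrightarrow> 0 \<le> (LINT x:U|lebesgue. g x * \<psi> x)"
  shows "AE x in lebesgue. x \<in> U \<longrightarrow> g x \<ge> 0"
proof -
  have compact: "0 \<le> (\<integral>x. indicator C x *\<^sub>R g x \<partial>lebesgue)" if C: "compact C" "C \<subseteq> U" for C
  proof -
    obtain \<eta> D where \<eta>: "\<And>k::nat. \<eta> k \<in> test_functions U" and D: "compact D" "D \<subseteq> U" "\<And>k x. x \<notin> D \<Longrightarrow> \<eta> k x = 0"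
      and \<eta>01: "\<And>k x. 0 \<le> \<eta> k x" "\<And>k x. \<eta> k x \<le> 1" and lim: "\<And>x. (\<lambda>k. \<eta> k x) \<longlonglongrightarrow> indicator C x"
      using cutoff_sequence[OF C(1) U C(2)] by metis
    have e: "(LINT x:U|lebesgue. g x * \<eta> k x) = (\<integral>x. (indicator D x *\<^sub>R g x) * \<eta> k x \<partial>lebesgue)" for k
      unfolding set_lebesgue_integral_def
    proof (intro Bochner_Integration.integral_cong refl)
      fix x
      show "indicat_real U x *\<^sub>R (g x * \<eta> k x) = indicat_real D x *\<^sub>R g x * \<eta> k x"
        using D(2) D(3)[of x k] by (cases "x \<in> D") auto
    qed
    have CD: "C \<subseteq> D"
    proof
      fix x assume "x \<in> C"
      then have "(\<lambda>k. \<eta> k x) \<longlonglongrightarrow> 1" using lim[of x] by simp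
      moreover have "\<eta> k x = 0" if "x \<notin> D" for k using D(3) that .
      ultimately show "x \<in> D" using LIMSEQ_const_iff[of "0::real" 1] by fastforce
    qed
    have "(\<lambda>k. \<integral>x. (indicator D x *\<^sub>R g x) * \<eta> k x \<partial>lebesgue) \<longlonglongrightarrow> (\<integral>x. (indicator D x *\<^sub>R g x) * indicator C x \<partial>lebesgue)"
    proof (rule integral_dominated_convergence[where w = "\<lambda>x. \<bar>indicator D x *\<^sub>R g x\<bar>"])
      have i: "integrable lebesgue (\<lambda>x. indicator D x *\<^sub>R g x)" using g D(1,2) by (rule set_integrable_compact)
      show "integrable lebesgue (\<lambda>x. \<bar>indicator D x *\<^sub>R g x\<bar>)" using i by (rule integrable_abs)
      show "(\<lambda>x. (indicator D x *\<^sub>R g x) * \<eta> k x) \<in> borel_measurable lebesgue" for k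
        by (intro borel_measurable_times[OF borel_measurable_integrable[OF i]] continuous_lebesgue_measurable test_continuous[OF \<eta>])
      show "(\<lambda>x. (indicator D x *\<^sub>R g x) * indicator C x) \<in> borel_measurable lebesgue"
        using C(1) by (intro borel_measurable_times[OF borel_measurable_integrable[OF i]] borel_measurable_indicator)
          (simp add: compact_imp_closed)
      show "AE x in lebesgue. norm (indicator D x *\<^sub>R g x * \<eta> k x) \<le> \<bar>indicator D x *\<^sub>R g x\<bar>" for k
        using \<eta>01[of k] by (intro AE_I2) (simp add: abs_mult mult_left_le)
      show "AE x in lebesgue. (\<lambda>k. indicator D x *\<^sub>R g x * \<eta> k x) \<longlonglongrightarrow> indicator D x *\<^sub>R g x * indicator C x"
        by (intro AE_I2 tendsto_mult tendsto_const lim)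
    qed
    moreover have "0 \<le> (\<integral>x. (indicator D x *\<^sub>R g x) * \<eta> k x \<partial>lebesgue)" for k
      using 0[OF \<eta> \<eta>01(1), of k] unfolding e .
    ultimately have "0 \<le> (\<integral>x. (indicator D x *\<^sub>R g x) * indicator C x \<partial>lebesgue)"
      by (intro LIMSEQ_le_const) auto
    also have "\<dots> = (\<integral>x. indicator C x *\<^sub>R g x \<partial>lebesgue)"
      by (intro Bochner_Integration.integral_cong refl) (use CD in \<open>auto split: split_indicator\<close>)
    finally show ?thesis .
  qed
  show ?thesis
  proof (rule AE_local)
    fix x0 assume "x0 \<in> U"
    obtain a b where ab: "cbox a b \<subseteq> U" "x0 \<in> box a b"
      using open_contains_cbox[OF U \<open>x0 \<in> U\<close>] by metis
    have i: "integrable lebesgue (\<lambda>x. indicator (cbox a b) x *\<^sub>R g x)"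
      using g compact_cbox ab(1) by (rule set_integrable_compact)
    define S where "S = {x. indicator (cbox a b) x *\<^sub>R g x < 0}"
    have S: "S \<in> sets lebesgue" unfolding S_def
      using borel_measurable_integrable[OF i, unfolded borel_measurable_iff_less, rule_format, of 0] by simp
    have S': "S \<subseteq> cbox a b" "\<And>x. x \<in> S \<Longrightarrow> g x < 0" unfolding S_def by (auto split: split_indicator_asm)
    have "emeasure lebesgue S = 0"
    proof (rule ccontr)
      assume "emeasure lebesgue S \<noteq> 0"
      have fin: "emeasure lebesgue S < \<infinity>"
        using emeasure_mono[OF S'(1), of lebesgue] emeasure_lborel_cbox_finite[of a b] by auto
      then have m: "measure lebesgue S > 0" using \<open>emeasure lebesgue S \<noteq> 0\<close>
        by (simp add: measure_def enn2real_positive_iff zero_less_iff_neq_zero)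
      obtain T where T: "closed T" "T \<subseteq> S" "emeasure lebesgue (S - T) < ennreal (measure lebesgue S)"
        using sets_lebesgue_inner_closed[OF S m] by metis
      have cT: "compact T" using T(1,2) S'(1) compact_Int_closed[OF compact_cbox T(1), of a b] by (simp add: inf.absorb2)
      have iT: "integrable lebesgue (\<lambda>x. indicator T x *\<^sub>R g x)"
        using g cT by (rule set_integrable_compact) (use T(2) S'(1) ab(1) in blast)
      have "0 \<le> (\<integral>x. indicator T x *\<^sub>R g x \<partial>lebesgue)"
        by (rule compact[OF cT]) (use T(2) S'(1) ab(1) in blast)
      moreover have "0 \<le> (\<integral>x. - (indicator T x *\<^sub>R g x) \<partial>lebesgue)"
        using T(2) S'(2) by (intro integral_nonneg_AE AE_I2) (auto split: split_indicator intro: less_imp_le)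
      ultimately have "(\<integral>x. - (indicator T x *\<^sub>R g x) \<partial>lebesgue) = 0" by simp
      then have "AE x in lebesgue. - (indicator T x *\<^sub>R g x) = 0"
        using T(2) S'(2) by (subst (asm) integral_nonneg_eq_0_iff_AE[OF integrable_minus[OF iT]])
          (auto split: split_indicator intro: less_imp_le)
      then have "AE x in lebesgue. x \<notin> T"
        by eventually_elim (use T(2) S'(2) in \<open>force split: split_indicator_asm\<close>)
      moreover have sT: "T \<in> sets lebesgue" using T(1) by simp
      ultimately have "emeasure lebesgue T = 0" using AE_iff_null_sets[OF sT] by (simp add: null_sets_def)
      then have "emeasure lebesgue S \<le> emeasure lebesgue (S - T)"
        using emeasure_subadditive[of "S - T" lebesgue T] S sT T(2) by (simp add: Un_absorb2)
      also have "\<dots> < ennreal (measure lebesgue S)" by (rule T(3))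
      also have "\<dots> = emeasure lebesgue S" using fin by (simp add: emeasure_eq_ennreal_measure)
      finally show False by simp
    qed
    then have "S \<in> null_sets lebesgue" using S by (simp add: null_sets_def)
    then have "AE x in lebesgue. x \<notin> S" by (rule AE_not_in)
    then have "AE x in lebesgue. x \<in> box a b \<longrightarrow> g x \<ge> 0"
    proof eventually_elim
      case (elim x)
      then show ?case using box_subset_cbox[of a b] by (auto simp: S_def not_less)
    qed
    then show "\<exists>V. open V \<and> x0 \<in> V \<and> (AE y in lebesgue. y \<in> V \<longrightarrow> g y \<ge> 0)"
      using ab(2) open_box by blast
  qed
qed

lemma du_bois_reymond:
  fixes g :: "real^'n::finite \<Rightarrow> real"
  assumes U: "open U" and g: "locally_integrable U g"
    and 0: "\<And>\<psi>. \<psi> \<in> test_functions U \<Longrightarrow> (LINT x:U|lebesgue. g x * \<psi> x) = 0"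
  shows "AE x in lebesgue. x \<in> U \<longrightarrow> g x = 0"
proof -
  have "AE x in lebesgue. x \<in> U \<longrightarrow> g x \<ge> 0"
    by (rule test_nonneg_imp_AE_nonneg[OF U g]) (simp add: 0)
  moreover have "AE x in lebesgue. x \<in> U \<longrightarrow> - g x \<ge> 0"
  proof (rule test_nonneg_imp_AE_nonneg[OF U])
    show "locally_integrable U (\<lambda>x. - g x)"
      using g unfolding locally_integrable_def set_integrable_def by auto
    show "0 \<le> (LINT x:U|lebesgue. - g x * \<psi> x)" if "\<psi> \<in> test_functions U" for \<psi>
      using 0[OF that] by (simp add: set_lebesgue_integral_def)
  qed
  ultimately show ?thesis by eventually_elim auto
qed

lemma directional_quotient_tendsto:
  fixes \<psi> :: "'a::real_normed_vector \<Rightarrow> real" and h :: "nat \<Rightarrow> real"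
  assumes "(\<psi> has_derivative \<psi>') (at x)" "\<And>k. h k \<noteq> 0" "h \<longlonglongrightarrow> 0"
  shows "(\<lambda>k. (\<psi> (x + h k *\<^sub>R e) - \<psi> x) / h k) \<longlonglongrightarrow> \<psi>' e"
proof -
  interpret bounded_linear \<psi>' using assms(1) by (rule has_derivative_bounded_linear)
  have "((\<lambda>s. x + s *\<^sub>R e) has_derivative (\<lambda>s. s *\<^sub>R e)) (at 0)"
    by (auto intro!: derivative_eq_intros)
  from diff_chain_at[OF this, of \<psi> \<psi>'] assms(1)
  have "((\<lambda>s. \<psi> (x + s *\<^sub>R e)) has_derivative (\<lambda>s. \<psi>' (s *\<^sub>R e))) (at 0)"
    by (simp add: o_def)
  moreover have "(\<lambda>s. \<psi>' (s *\<^sub>R e)) = (*) (\<psi>' e)" by (auto simp: scaleR)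
  ultimately have "((\<lambda>s. \<psi> (x + s *\<^sub>R e)) has_real_derivative \<psi>' e) (at 0)"
    by (simp add: has_field_derivative_def)
  then have "((\<lambda>s. (\<psi> (x + s *\<^sub>R e) - \<psi> x) / s) \<longlongrightarrow> \<psi>' e) (at 0)"
    by (simp add: has_field_derivative_iff)
  moreover have "filterlim h (at 0) sequentially"
    using assms(2,3) by (intro filterlim_atI) auto
  ultimately show ?thesis by (rule filterlim_compose)
qed

text \<open>
  Weak convergence of difference quotients. The factor \<open>f\<close> only has to be integrable on a set \<open>C\<close> that
  contains the supports of all the difference quotients.
\<close>
lemma diff_quotient_integral_tendsto:
  fixes \<psi> :: "'a::euclidean_space \<Rightarrow> real" and h :: "nat \<Rightarrow> real"
  assumes f: "integrable lebesgue (\<lambda>x. indicator C x *\<^sub>R f x)"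
    and lip: "L-lipschitz_on UNIV \<psi>"
    and d: "\<And>x. (\<psi> has_derivative \<psi>' x) (at x)"
    and h: "\<And>k. h k \<noteq> 0" "h \<longlonglongrightarrow> 0"
    and supp: "\<And>x k. x \<notin> C \<Longrightarrow> \<psi> (x + h k *\<^sub>R e) = 0" "\<And>x. x \<notin> C \<Longrightarrow> \<psi> x = 0"
  shows "(\<lambda>k. \<integral>x. f x * ((\<psi> (x + h k *\<^sub>R e) - \<psi> x) / h k) \<partial>lebesgue) \<longlonglongrightarrow> (\<integral>x. f x * \<psi>' x e \<partial>lebesgue)"
proof -
  let ?q = "\<lambda>k x. (\<psi> (x + h k *\<^sub>R e) - \<psi> x) / h k"
  have q0: "?q k x = 0" if "x \<notin> C" for x k using supp that by simp
  have e: "f x * ?q k x = (indicator C x *\<^sub>R f x) * ?q k x" for x k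
    using q0[of x k] by (cases "x \<in> C") auto
  have lim: "(\<lambda>k. f x * ?q k x) \<longlonglongrightarrow> f x * \<psi>' x e" for x
    by (intro tendsto_mult tendsto_const directional_quotient_tendsto d h)
  have cont: "continuous_on UNIV \<psi>" using lip by (rule lipschitz_on_continuous_on)
  have "continuous_on UNIV (?q k)" for k
    by (intro continuous_intros continuous_on_compose2[OF cont]) (use h in auto)
  then have meas: "(\<lambda>x. f x * ?q k x) \<in> borel_measurable lebesgue" for k
    unfolding e
    by (intro borel_measurable_times[OF borel_measurable_integrable[OF f]] continuous_lebesgue_measurable)
  show ?thesis
  proof (rule integral_dominated_convergence[where w = "\<lambda>x. (L * norm e) * norm (indicator C x *\<^sub>R f x)"])
    show "(\<lambda>x. f x * \<psi>' x e) \<in> borel_measurable lebesgue"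
      by (rule borel_measurable_LIMSEQ_metric[OF meas lim])
    show "integrable lebesgue (\<lambda>x. (L * norm e) * norm (indicator C x *\<^sub>R f x))"
      using f by (intro integrable_mult_right integrable_norm)
    show "AE x in lebesgue. norm (f x * ?q k x) \<le> (L * norm e) * norm (indicator C x *\<^sub>R f x)" for k
    proof (rule AE_I2)
      fix x
      have "\<bar>\<psi> (x + h k *\<^sub>R e) - \<psi> x\<bar> \<le> L * norm (h k *\<^sub>R e)"
        using lipschitz_onD[OF lip, of "x + h k *\<^sub>R e" x] by (simp add: dist_norm)
      then have "\<bar>?q k x\<bar> \<le> L * norm e" using h(1)[of k] by (simp add: field_simps)
      then show "norm (f x * ?q k x) \<le> (L * norm e) * norm (indicator C x *\<^sub>R f x)"
        unfolding e by (simp only: abs_mult real_norm_def mult.commute[of _ "\<bar>?q k x\<bar>"]) (intro mult_right_mono abs_ge_zero)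
    qed
  qed (use meas lim in auto)
qed

lemma lebesgue_integral_translation:
  fixes f :: "'a::euclidean_space \<Rightarrow> real"
  assumes "f \<in> borel_measurable borel"
  shows "(\<integral>x. f (x + a) \<partial>lebesgue) = (\<integral>x. f x \<partial>lebesgue)"
proof -
  have [measurable]: "f \<in> borel_measurable borel" by fact
  have "(\<integral>x. f x \<partial>lebesgue) = (\<integral>x. f x \<partial>lborel)" by (rule integral_completion) simp
  also have "\<dots> = (\<integral>x. f x \<partial>distr lborel borel ((+) a))" by (simp add: lborel_distr_plus)
  also have "\<dots> = (\<integral>x. f (a + x) \<partial>lborel)" by (rule integral_distr) auto
  also have "\<dots> = (\<integral>x. f (x + a) \<partial>lebesgue)" by (subst integral_completion) (auto simp: add.commute)
  finally show ?thesis by simp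
qed

lemma continuous_compact_support_integrable:
  fixes f :: "'a::euclidean_space \<Rightarrow> real"
  assumes "continuous_on UNIV f" "compact S" "\<And>x. x \<notin> S \<Longrightarrow> f x = 0"
  shows "integrable lebesgue f"
proof -
  have "integrable lborel (\<lambda>x. indicator S x *\<^sub>R f x)"
    using assms by (intro borel_integrable_compact) (auto intro: continuous_on_subset)
  moreover have "(\<lambda>x. indicator S x *\<^sub>R f x) = f" using assms(3) by (auto split: split_indicator)
  ultimately show ?thesis
    using assms(1) by (subst integrable_completion) (auto intro: borel_measurable_continuous_onI)
qed

lemma continuous_locally_integrable:
  assumes "continuous_on U f"
  shows "locally_integrable U f"
  unfolding locally_integrable_def
proof (intro allI impI)
  fix C assume "compact C \<and> C \<subseteq> U"
  then have i: "integrable lborel (\<lambda>x. indicator C x *\<^sub>R f x)"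
    using assms by (intro borel_integrable_compact) (auto intro: continuous_on_subset)
  then show "set_integrable lebesgue C f"
    unfolding set_integrable_def
    by (subst integrable_completion) (auto dest: borel_measurable_integrable)
qed

lemma test_differentiable: "f \<in> test_functions U \<Longrightarrow> f differentiable (at x)"
  by (auto simp: test_functions_iff intro!: Cn_differentiable[of UNIV])

lemma test_integrable: "f \<in> test_functions U \<Longrightarrow> integrable lebesgue f"
  by (metis test_functionsE test_continuous continuous_compact_support_integrable)

lemma test_bounded:
  assumes "f \<in> test_functions U" obtains B where "\<And>x. \<bar>f x\<bar> \<le> B" "B > 0"
proof -
  obtain S where S: "compact S" "\<And>x. x \<notin> S \<Longrightarrow> f x = 0" using assms by (rule test_functionsE) blast
  have "compact (f ` S)" using S(1) test_continuous[OF assms] by (meson compact_continuous_image continuous_on_subset subset_UNIV)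
  then obtain B where B: "B > 0" "\<And>y. y \<in> f ` S \<Longrightarrow> \<bar>y\<bar> \<le> B"
    using compact_imp_bounded bounded_pos by (metis real_norm_def)
  have "\<bar>f x\<bar> \<le> B" for x using B S(2)[of x] by (cases "x \<in> S") auto
  with B(1) that show ?thesis by blast
qed

lemma set_integral_restrict_support:
  assumes "\<And>x. x \<notin> U \<Longrightarrow> f x = 0"
  shows "(LINT x:U|M. f x) = (\<integral>x. f x \<partial>M)"
  unfolding set_lebesgue_integral_def
  by (intro Bochner_Integration.integral_cong refl) (use assms in \<open>auto split: split_indicator\<close>)

lemma integrable_mult_test:
  assumes "locally_integrable U g" "w \<in> test_functions U"
  shows "integrable lebesgue (\<lambda>x. g x * w x)" "(LINT x:U|lebesgue. g x * w x) = (\<integral>x. g x * w x \<partial>lebesgue)"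
proof -
  obtain S where S: "compact S" "S \<subseteq> U" "\<And>x. x \<notin> S \<Longrightarrow> w x = 0" using assms(2) by (rule test_functionsE) blast
  obtain b where b: "\<And>x. \<bar>w x\<bar> \<le> b" using test_bounded[OF assms(2)] by blast
  show "integrable lebesgue (\<lambda>x. g x * w x)"
    using locally_integrable_test[OF assms(1) S(1,2) continuous_lebesgue_measurable[OF test_continuous[OF assms(2)]] b S(3)] .
  have "w x = 0" if "x \<notin> U" for x using that S(2,3) by blast
  then show "(LINT x:U|lebesgue. g x * w x) = (\<integral>x. g x * w x \<partial>lebesgue)"
    by (intro set_integral_restrict_support) simp
qed

lemma set_integrable_mult_test:
  "open U \<Longrightarrow> locally_integrable U g \<Longrightarrow> w \<in> test_functions U \<Longrightarrow> set_integrable lebesgue U (\<lambda>x. g x * w x)"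
  unfolding set_integrable_def by (intro integrable_mult_indicator integrable_mult_test) auto

lemma test_lipschitz:
  assumes "f \<in> test_functions U"
  obtains L where "L-lipschitz_on UNIV f"
proof -
  have "\<exists>B>0. \<forall>x. \<bar>pd i f x\<bar> \<le> B" for i
    using test_bounded[OF test_functions_pd[OF assms, of i]] by metis
  then obtain B where B: "\<And>i. B i > 0" "\<And>i x. \<bar>pd i f x\<bar> \<le> B i" by metis
  have "(\<Sum>i\<in>UNIV. B i)-lipschitz_on UNIV f"
  proof (rule bounded_derivative_imp_lipschitz)
    show "(f has_derivative (\<lambda>h. grad f x \<bullet> h)) (at x within UNIV)" for x
      using has_derivative_grad[OF test_differentiable[OF assms]] by simp
    show "onorm (\<lambda>h. grad f x \<bullet> h) \<le> (\<Sum>i\<in>UNIV. B i)" for x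
    proof (rule onorm_le)
      fix h
      have "norm (grad f x \<bullet> h) \<le> norm (grad f x) * norm h" by (rule Cauchy_Schwarz_ineq2[folded real_norm_def])
      also have "norm (grad f x) \<le> (\<Sum>i\<in>UNIV. \<bar>grad f x $ i\<bar>)" by (rule norm_le_l1_cart)
      also have "\<dots> \<le> (\<Sum>i\<in>UNIV. B i)" using B by (intro sum_mono) simp
      finally show "norm (grad f x \<bullet> h) \<le> (\<Sum>i\<in>UNIV. B i) * norm h"
        by (meson mult_right_mono norm_ge_zero)
    qed
    show "0 \<le> (\<Sum>i\<in>UNIV. B i)" using B(1) by (intro sum_nonneg) (simp add: less_imp_le)
  qed auto
  then show ?thesis using that by blast
qed

lemma compact_translate_support:
  fixes S :: "'a::euclidean_space set"
  assumes "compact S"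
  obtains C where "compact C" "S \<subseteq> C" "\<And>x a. norm a \<le> 1 \<Longrightarrow> x \<notin> C \<Longrightarrow> x + a \<notin> S"
proof -
  obtain R where R: "\<And>x. x \<in> S \<Longrightarrow> norm x \<le> R" using compact_imp_bounded[OF assms] bounded_iff by metis
  show ?thesis
  proof (rule that[of "cball 0 (R + 1)"])
    show "S \<subseteq> cball 0 (R + 1)" using R by force
    fix x a :: 'a assume "norm a \<le> 1" "x \<notin> cball 0 (R + 1)"
    then have "norm (x + a) > R" using norm_diff_ineq[of x a] by simp
    then show "x + a \<notin> S" using R by fastforce
  qed simp
qed

text \<open>
  By translation invariance the integrals of all difference quotients of \<open>f\<close> are zero.
\<close>
lemma integral_pd_test:
  assumes "f \<in> test_functions U"
  shows "(\<integral>x. pd i f x \<partial>lebesgue) = 0"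
proof -
  obtain S where S: "compact S" "\<And>x. x \<notin> S \<Longrightarrow> f x = 0" using assms by (rule test_functionsE) blast
  obtain C where C: "compact C" "S \<subseteq> C" "\<And>x a. norm a \<le> 1 \<Longrightarrow> x \<notin> C \<Longrightarrow> x + a \<notin> S"
    by (rule compact_translate_support[OF S(1)]) blast
  obtain L where L: "L-lipschitz_on UNIV f" using assms by (rule test_lipschitz)
  define h where "h k = 1 / real (Suc k)" for k
  have h: "h k \<noteq> 0" "\<bar>h k\<bar> \<le> 1" for k by (auto simp: h_def)
  have "h \<longlonglongrightarrow> 0" unfolding h_def by (rule LIMSEQ_Suc[OF lim_inverse_n'])
  have 1: "integrable lebesgue (\<lambda>x. indicator C x *\<^sub>R (1::real))"
    using continuous_locally_integrable[of UNIV "\<lambda>x. 1"] C(1)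
    unfolding locally_integrable_def set_integrable_def by (metis continuous_on_const subset_UNIV)
  have "(\<lambda>k. \<integral>x. 1 * ((f (x + h k *\<^sub>R axis i 1) - f x) / h k) \<partial>lebesgue) \<longlonglongrightarrow>
      (\<integral>x. 1 * (grad f x \<bullet> axis i 1) \<partial>lebesgue)"
  proof (rule diff_quotient_integral_tendsto[OF 1 L has_derivative_grad[OF test_differentiable[OF assms]] h(1) \<open>h \<longlonglongrightarrow> 0\<close>])
    show "f (x + h k *\<^sub>R axis i 1) = 0" if "x \<notin> C" for x k
      using S(2) C(3)[OF _ that, of "h k *\<^sub>R axis i 1"] h(2)[of k] by (simp add: norm_axis_1)
    show "f x = 0" if "x \<notin> C" for x using that C(2) S(2) by blast
  qed
  moreover have "(\<integral>x. 1 * ((f (x + h k *\<^sub>R axis i 1) - f x) / h k) \<partial>lebesgue) = 0" for k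
  proof -
    have fb: "f \<in> borel_measurable borel" using test_continuous[OF assms] by (rule borel_measurable_continuous_onI)
    have tr: "(\<integral>x. f (x + a) \<partial>lebesgue) = (\<integral>x. f x \<partial>lebesgue)" for a
      by (rule lebesgue_integral_translation[OF fb])
    have "integrable lebesgue (\<lambda>x. f (x + a))" if "norm a \<le> 1" for a
    proof (rule continuous_compact_support_integrable[OF _ C(1)])
      show "continuous_on UNIV (\<lambda>x. f (x + a))"
        by (intro continuous_on_compose2[OF test_continuous[OF assms]] continuous_intros) auto
      show "f (x + a) = 0" if "x \<notin> C" for x using S(2) C(3)[OF \<open>norm a \<le> 1\<close> that] by blast
    qed
    then have "integrable lebesgue (\<lambda>x. f (x + h k *\<^sub>R axis i 1))" using h(2)[of k] by (simp add: norm_axis_1)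
    then show ?thesis using test_integrable[OF assms] by (simp add: tr)
  qed
  ultimately have "(\<integral>x. 1 * (grad f x \<bullet> axis i 1) \<partial>lebesgue) = 0" by (simp only: LIMSEQ_const_iff)
  then show ?thesis by (simp add: inner_axis)
qed

lemma test_extend_integrable:
  assumes "open U" "\<And>n. Cn n U f" "w \<in> test_functions U"
  shows "integrable lebesgue (\<lambda>x. indicator U x *\<^sub>R (f x * w x))"
proof -
  have "(\<lambda>x. indicator U x *\<^sub>R (f x * w x)) = (\<lambda>x. if x \<in> U then f x * w x else 0)"
    by (auto split: split_indicator)
  then show ?thesis using test_integrable[OF test_functions_mult_smooth[OF assms]] by simp
qed

lemma pd_mult:
  assumes "f differentiable (at x)" "g differentiable (at x)"
  shows "pd i (\<lambda>x. f x * g x) x = f x * pd i g x + pd i f x * g x"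
  using has_derivative_pd[OF has_derivative_mult[OF has_derivative_grad[OF assms(1)] has_derivative_grad[OF assms(2)]]]
  by (simp add: inner_axis)

lemma pd_cong:
  assumes "open V" "x \<in> V" "\<And>y. y \<in> V \<Longrightarrow> f y = g y" "g differentiable (at x)"
  shows "pd i f x = pd i g x"
proof -
  have "(f has_derivative (\<lambda>h. grad g x \<bullet> h)) (at x)"
    using has_derivative_transform_within_open[OF has_derivative_grad[OF assms(4)] assms(1,2)] assms(3) by simp
  then show ?thesis using has_derivative_pd by (fastforce simp: inner_axis)
qed

lemma integration_by_parts:
  assumes U: "open U" and f: "\<And>n. Cn n U f" and w: "w \<in> test_functions U"
  shows "(LINT x:U|lebesgue. f x * pd i w x) = - (LINT x:U|lebesgue. pd i f x * w x)"
proof -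
  let ?p = "\<lambda>x. if x \<in> U then f x * w x else 0"
  have p: "?p \<in> test_functions U" by (rule test_functions_mult_smooth[OF U f w])
  obtain S where S: "compact S" "S \<subseteq> U" "\<And>x. x \<notin> S \<Longrightarrow> w x = 0" using w by (rule test_functionsE) blast
  have 0: "pd i ?p x = 0" if "x \<notin> U" for x
  proof (rule has_derivative_pd[OF has_derivative_zero_off_closed[OF compact_imp_closed[OF S(1)]]])
    show "x \<notin> S" using that S(2) by blast
  qed (simp add: S(3))
  have eq: "pd i ?p x = indicator U x *\<^sub>R (f x * pd i w x) + indicator U x *\<^sub>R (pd i f x * w x)" for x
  proof (cases "x \<in> U")
    case True
    have d: "f differentiable (at x)" "w differentiable (at x)"
      using Cn_differentiable[OF f True] test_differentiable[OF w] by auto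
    have "pd i ?p x = pd i (\<lambda>x. f x * w x) x"
      by (rule pd_cong[OF U True]) (use d in auto)
    then show ?thesis using True pd_mult[OF d] by simp
  qed (use 0 in simp)
  have "0 = (\<integral>x. indicator U x *\<^sub>R (f x * pd i w x) + indicator U x *\<^sub>R (pd i f x * w x) \<partial>lebesgue)"
    using integral_pd_test[OF p, of i] unfolding eq by simp
  also have "\<dots> = (LINT x:U|lebesgue. f x * pd i w x) + (LINT x:U|lebesgue. pd i f x * w x)"
    unfolding set_lebesgue_integral_def
    by (intro Bochner_Integration.integral_add test_extend_integrable U f w test_functions_pd Cn_pd)
  finally show ?thesis by simp
qed

lemma has_weak_grad_smooth:
  assumes "open U" "\<And>n. Cn n U f"
  shows "has_weak_grad U f (grad f)"
  unfolding has_weak_grad_def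
  using assms by (auto intro!: continuous_locally_integrable Cn_continuous_on Cn_pd integration_by_parts)

section \<open>Weak gradients of Lipschitz functions\<close>

lemma Cn_real_polynomial:
  fixes p :: "'a::euclidean_space \<Rightarrow> real"
  shows "real_polynomial_function p \<Longrightarrow> Cn n U p"
proof (induction rule: real_polynomial_function.induct)
  case (linear f)
  then interpret bounded_linear f .
  have "f x = (\<Sum>b\<in>Basis. f b * (x \<bullet> b))" for x
  proof -
    have "f x = f (\<Sum>b\<in>Basis. (x \<bullet> b) *\<^sub>R b)" by (simp add: euclidean_representation)
    also have "\<dots> = (\<Sum>b\<in>Basis. f b * (x \<bullet> b))" by (simp add: sum scaleR mult.commute)
    finally show ?thesis .
  qed
  then have "f = (\<lambda>x. \<Sum>b\<in>Basis. f b * (x \<bullet> b))" by blast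
  moreover have "Cn n U (\<lambda>x. \<Sum>b\<in>Basis. f b * (x \<bullet> b))"
    by (intro Cn_sum Cn_cmult Cn_inner)
  ultimately show ?case by simp
qed (auto intro: Cn_const Cn_add Cn_mult)

text \<open>
  Uniform approximation by test functions with a common support: polynomials from the
  Stone--Weierstrass theorem times a cutoff function.
\<close>
lemma test_function_uniform_approx:
  fixes g :: "real^'n::finite \<Rightarrow> real"
  assumes "open U" "compact S" "S \<subseteq> U" "continuous_on UNIV g" "\<And>x. x \<notin> S \<Longrightarrow> g x = 0"
  obtains C where "compact C" "C \<subseteq> U" "S \<subseteq> C"
    "\<And>\<epsilon>. \<epsilon> > 0 \<Longrightarrow> \<exists>f\<in>test_functions U. (\<forall>x. \<bar>g x - f x\<bar> \<le> \<epsilon>) \<and> (\<forall>x. x \<notin> C \<longrightarrow> f x = 0)"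
proof -
  obtain \<eta> V where \<eta>: "\<eta> \<in> test_functions U" "S \<subseteq> V" "\<And>x. x \<in> V \<Longrightarrow> \<eta> x = 1" "\<And>x. 0 \<le> \<eta> x" "\<And>x. \<eta> x \<le> 1"
    using smooth_cutoff[OF assms(2,1,3)] by metis
  obtain C where C: "compact C" "C \<subseteq> U" "\<And>x. x \<notin> C \<Longrightarrow> \<eta> x = 0"
    using \<eta>(1) by (rule test_functionsE) blast
  have SC: "S \<subseteq> C" using C(3) \<eta>(2,3) by force
  show ?thesis
  proof (rule that[OF C(1,2) SC])
    fix \<epsilon> :: real assume "\<epsilon> > 0"
    obtain p where p: "real_polynomial_function p" "\<And>x. x \<in> C \<Longrightarrow> \<bar>g x - p x\<bar> < \<epsilon>"
      using Stone_Weierstrass_real_polynomial_function[OF C(1) continuous_on_subset[OF assms(4)] \<open>\<epsilon> > 0\<close>]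
      by auto
    let ?f = "\<lambda>x. p x * \<eta> x"
    have "?f \<in> test_functions U" by (intro test_functions_mult \<eta>(1) Cn_real_polynomial p(1))
    moreover have "\<bar>g x - ?f x\<bar> \<le> \<epsilon>" for x
    proof (cases "x \<in> C")
      case True
      have "g x = g x * \<eta> x" using assms(5)[of x] \<eta>(2,3) by (cases "x \<in> S") auto
      then have "\<bar>g x - ?f x\<bar> = \<bar>g x - p x\<bar> * \<eta> x"
        using \<eta>(4)[of x] by (metis abs_mult abs_of_nonneg left_diff_distrib)
      also have "\<dots> \<le> \<epsilon> * 1" using p(2)[OF True] \<eta>(4,5)[of x] \<open>\<epsilon> > 0\<close> by (intro mult_mono) auto
      finally show ?thesis by simp
    next
      case False
      have gx: "g x = 0" using False assms(5) SC by blast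
      have fx: "?f x = 0" using C(3)[OF False] by simp
      show ?thesis unfolding gx fx using \<open>\<epsilon> > 0\<close> by simp
    qed
    moreover have "\<forall>x. x \<notin> C \<longrightarrow> ?f x = 0" using C(3) by simp
    ultimately show "\<exists>f\<in>test_functions U. (\<forall>x. \<bar>g x - f x\<bar> \<le> \<epsilon>) \<and> (\<forall>x. x \<notin> C \<longrightarrow> f x = 0)"
      by (intro bexI[of _ ?f] conjI allI) blast+
  qed
qed

lemma lipschitz_functionsE:
  assumes "\<phi> \<in> lipschitz_functions U"
  obtains L S where "L > 0" "L-lipschitz_on UNIV \<phi>" "compact S" "S \<subseteq> U" "\<And>x. x \<notin> S \<Longrightarrow> \<phi> x = 0"
    "S = closure {x. \<phi> x \<noteq> 0}" "continuous_on UNIV \<phi>"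
proof -
  obtain L where L: "L-lipschitz_on UNIV \<phi>" using assms by (auto simp: lipschitz_functions_def)
  have L1: "(max L 1)-lipschitz_on UNIV \<phi>" by (rule lipschitz_on_mono[OF L]) auto
  have cs: "compact (closure {x. \<phi> x \<noteq> 0})" "closure {x. \<phi> x \<noteq> 0} \<subseteq> U"
    using assms by (auto simp: lipschitz_functions_def compactly_supported_in_def)
  have 0: "\<phi> x = 0" if "x \<notin> closure {x. \<phi> x \<noteq> 0}" for x
    using that closure_subset[of "{x. \<phi> x \<noteq> 0}"] by auto
  show ?thesis
    by (rule that[OF _ L1 cs 0 refl lipschitz_on_continuous_on[OF L1]]) auto
qed

lemma test_lipschitz_functions: "f \<in> test_functions U \<Longrightarrow> f \<in> lipschitz_functions U"
  using test_lipschitz[of f U] by (auto simp: lipschitz_functions_def test_functions_def)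

lemma lipschitz_diff_quotient:
  fixes \<phi> :: "'a::real_normed_vector \<Rightarrow> real"
  assumes "L-lipschitz_on UNIV \<phi>" "h \<noteq> 0" "norm e = 1"
  shows "continuous_on UNIV (\<lambda>x. (\<phi> (x + h *\<^sub>R e) - \<phi> x) / h)" "\<bar>(\<phi> (x + h *\<^sub>R e) - \<phi> x) / h\<bar> \<le> L"
proof -
  have c: "continuous_on UNIV \<phi>" using assms(1) by (rule lipschitz_on_continuous_on)
  show "continuous_on UNIV (\<lambda>x. (\<phi> (x + h *\<^sub>R e) - \<phi> x) / h)"
    by (intro continuous_intros c continuous_on_compose2[OF c]) (use assms(2) in auto)
  have "\<bar>\<phi> (x + h *\<^sub>R e) - \<phi> x\<bar> \<le> L * \<bar>h\<bar>"
    using lipschitz_onD[OF assms(1), of "x + h *\<^sub>R e" x] assms(3) by (simp add: dist_norm)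
  then show "\<bar>(\<phi> (x + h *\<^sub>R e) - \<phi> x) / h\<bar> \<le> L" using assms(2) by (simp add: field_simps)
qed

lemma diff_quotient_adjoint:
  fixes \<phi> \<psi> :: "'a::euclidean_space \<Rightarrow> real"
  assumes \<phi>: "continuous_on UNIV \<phi>" "compact S" "\<And>x. x \<notin> S \<Longrightarrow> \<phi> x = 0" and \<psi>: "continuous_on UNIV \<psi>"
    and "h \<noteq> 0"
  shows "(\<integral>x. (\<phi> (x + h *\<^sub>R e) - \<phi> x) / h * \<psi> x \<partial>lebesgue) =
     - (\<integral>x. \<phi> x * ((\<psi> (x + (- h) *\<^sub>R e) - \<psi> x) / (- h)) \<partial>lebesgue)"
proof -
  let ?F = "\<lambda>x. \<phi> x * \<psi> (x - h *\<^sub>R e)"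
  have cF: "continuous_on UNIV ?F"
    by (intro continuous_intros \<phi>(1) continuous_on_compose2[OF \<psi>]) auto
  have F: "integrable lebesgue ?F"
    using cF \<phi>(2) by (rule continuous_compact_support_integrable) (simp add: \<phi>(3))
  have G: "integrable lebesgue (\<lambda>x. \<phi> x * \<psi> x)"
    by (rule continuous_compact_support_integrable[OF _ \<phi>(2)]) (auto intro!: continuous_intros \<phi>(1) \<psi> simp: \<phi>(3))
  have tr: "(\<integral>x. \<phi> (x + h *\<^sub>R e) * \<psi> x \<partial>lebesgue) = (\<integral>x. ?F x \<partial>lebesgue)"
    using lebesgue_integral_translation[OF borel_measurable_continuous_onI[OF cF], of "h *\<^sub>R e"] by simp
  have H: "integrable lebesgue (\<lambda>x. \<phi> (x + h *\<^sub>R e) * \<psi> x)"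
  proof (rule continuous_compact_support_integrable)
    show "continuous_on UNIV (\<lambda>x. \<phi> (x + h *\<^sub>R e) * \<psi> x)"
      by (intro continuous_intros \<psi> continuous_on_compose2[OF \<phi>(1)]) auto
    show "compact ((+) (- h *\<^sub>R e) ` S)" using \<phi>(2) by (rule compact_translation)
    show "\<phi> (x + h *\<^sub>R e) * \<psi> x = 0" if "x \<notin> (+) (- h *\<^sub>R e) ` S" for x
    proof -
      have "x + h *\<^sub>R e \<notin> S"
      proof
        assume "x + h *\<^sub>R e \<in> S"
        then have "(+) (- h *\<^sub>R e) (x + h *\<^sub>R e) \<in> (+) (- h *\<^sub>R e) ` S" by blast
        then show False using that by simp
      qed
      then show ?thesis using \<phi>(3) by simp
    qed
  qed
  have "(\<integral>x. (\<phi> (x + h *\<^sub>R e) - \<phi> x) / h * \<psi> x \<partial>lebesgue)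
      = (\<integral>x. (\<phi> (x + h *\<^sub>R e) * \<psi> x - \<phi> x * \<psi> x) / h \<partial>lebesgue)"
    by (simp add: algebra_simps diff_divide_distrib)
  also have "\<dots> = ((\<integral>x. ?F x \<partial>lebesgue) - (\<integral>x. \<phi> x * \<psi> x \<partial>lebesgue)) / h"
    using H G by (simp add: tr)
  also have "\<dots> = (\<integral>x. (?F x - \<phi> x * \<psi> x) / h \<partial>lebesgue)"
    using F G by simp
  also have "\<dots> = - (\<integral>x. \<phi> x * ((\<psi> (x + (- h) *\<^sub>R e) - \<psi> x) / (- h)) \<partial>lebesgue)"
    by (subst Bochner_Integration.integral_minus[symmetric])
       (intro Bochner_Integration.integral_cong refl, use \<open>h \<noteq> 0\<close> in \<open>simp add: field_simps\<close>)
  finally show ?thesis .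
qed

lemma diff_quotient_test_tendsto:
  fixes \<phi> :: "real^'n::finite \<Rightarrow> real" and h :: "nat \<Rightarrow> real"
  assumes \<phi>: "continuous_on UNIV \<phi>" "compact S" "\<And>x. x \<notin> S \<Longrightarrow> \<phi> x = 0"
    and \<psi>: "\<psi> \<in> test_functions U" and h: "\<And>k. h k \<noteq> 0" "\<And>k. \<bar>h k\<bar> \<le> 1" "h \<longlonglongrightarrow> 0"
  shows "(\<lambda>k. \<integral>x. (\<phi> (x + h k *\<^sub>R axis i 1) - \<phi> x) / h k * \<psi> x \<partial>lebesgue)
    \<longlonglongrightarrow> - (\<integral>x. \<phi> x * pd i \<psi> x \<partial>lebesgue)"
proof -
  obtain T where T: "compact T" "\<And>x. x \<notin> T \<Longrightarrow> \<psi> x = 0" using \<psi> by (rule test_functionsE) blast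
  obtain C where C: "compact C" "T \<subseteq> C" "\<And>x a. norm a \<le> 1 \<Longrightarrow> x \<notin> C \<Longrightarrow> x + a \<notin> T"
    by (rule compact_translate_support[OF T(1)]) blast
  obtain L where L: "L-lipschitz_on UNIV \<psi>" using \<psi> by (rule test_lipschitz)
  have f: "integrable lebesgue (\<lambda>x. indicator C x *\<^sub>R \<phi> x)"
    using continuous_locally_integrable[OF \<phi>(1)] C(1) unfolding locally_integrable_def set_integrable_def by blast
  have "(\<lambda>k. \<integral>x. \<phi> x * ((\<psi> (x + (- h k) *\<^sub>R axis i 1) - \<psi> x) / (- h k)) \<partial>lebesgue)
     \<longlonglongrightarrow> (\<integral>x. \<phi> x * (grad \<psi> x \<bullet> axis i 1) \<partial>lebesgue)"
  proof (rule diff_quotient_integral_tendsto[OF f L has_derivative_grad[OF test_differentiable[OF \<psi>]]])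
    show "\<psi> (x + (- h k) *\<^sub>R axis i 1) = 0" if "x \<notin> C" for x k
    proof -
      have "norm ((- h k) *\<^sub>R axis i 1 :: real^'n) \<le> 1" using h(2)[of k] by simp
      then show ?thesis using T(2) C(3) that by blast
    qed
    show "\<psi> x = 0" if "x \<notin> C" for x using that C(2) T(2) by blast
    show "- h k \<noteq> 0" for k using h(1) by simp
    show "(\<lambda>k. - h k) \<longlonglongrightarrow> 0" using tendsto_minus[OF h(3)] by simp
  qed
  then have "(\<lambda>k. - (\<integral>x. \<phi> x * ((\<psi> (x + (- h k) *\<^sub>R axis i 1) - \<psi> x) / (- h k)) \<partial>lebesgue))
     \<longlonglongrightarrow> - (\<integral>x. \<phi> x * (grad \<psi> x \<bullet> axis i 1) \<partial>lebesgue)" by (rule tendsto_minus)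
  moreover have eq: "(\<integral>x. (\<phi> (x + h k *\<^sub>R axis i 1) - \<phi> x) / h k * \<psi> x \<partial>lebesgue)
    = - (\<integral>x. \<phi> x * ((\<psi> (x + (- h k) *\<^sub>R axis i 1) - \<psi> x) / (- h k)) \<partial>lebesgue)" for k
    by (rule diff_quotient_adjoint[OF \<phi> test_continuous[OF \<psi>] h(1)])
  ultimately show ?thesis unfolding eq by (simp add: inner_axis)
qed

lemma has_weak_gradD:
  assumes "has_weak_grad U u G"
  shows "locally_integrable U u" "locally_integrable U (\<lambda>x. G x $ i)"
    "\<And>\<psi>. \<psi> \<in> test_functions U \<Longrightarrow>
      (LINT x:U|lebesgue. u x * pd i \<psi> x) = - (LINT x:U|lebesgue. G x $ i * \<psi> x)"
  using assms by (auto simp: has_weak_grad_def)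

text \<open>
  The difference quotients of a Lipschitz function converge to its weak gradient not only against test
  functions but against all continuous functions with compact support, because they are bounded
  and test functions are uniformly dense. This replaces Rademacher's theorem.
\<close>
lemma diff_quotient_weak_tendsto:
  fixes \<phi> :: "real^'n::finite \<Rightarrow> real" and h :: "nat \<Rightarrow> real"
  assumes U: "open U" and \<phi>: "\<phi> \<in> lipschitz_functions U" and \<Gamma>: "has_weak_grad U \<phi> \<Gamma>"
    and g: "continuous_on UNIV g" "compact S" "S \<subseteq> U" "\<And>x. x \<notin> S \<Longrightarrow> g x = 0"
    and h: "\<And>k. h k \<noteq> 0" "\<And>k. \<bar>h k\<bar> \<le> 1" "h \<longlonglongrightarrow> 0"
  shows "(\<lambda>k. \<integral>x. (\<phi> (x + h k *\<^sub>R axis i 1) - \<phi> x) / h k * g x \<partial>lebesgue)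
    \<longlonglongrightarrow> (\<integral>x. \<Gamma> x $ i * g x \<partial>lebesgue)"
proof -
  obtain L T where L: "L > 0" "L-lipschitz_on UNIV \<phi>" and T: "compact T" "T \<subseteq> U" "\<And>x. x \<notin> T \<Longrightarrow> \<phi> x = 0"
    and c\<phi>: "continuous_on UNIV \<phi>"
    using \<phi> by (rule lipschitz_functionsE) blast
  obtain C where C: "compact C" "C \<subseteq> U" "S \<subseteq> C" and
    approx: "\<And>\<epsilon>. \<epsilon> > 0 \<Longrightarrow> \<exists>f\<in>test_functions U. (\<forall>x. \<bar>g x - f x\<bar> \<le> \<epsilon>) \<and> (\<forall>x. x \<notin> C \<longrightarrow> f x = 0)"
    by (rule test_function_uniform_approx[OF U g(2,3,1,4)]) blast+
  define D where "D k x = (\<phi> (x + h k *\<^sub>R axis i 1) - \<phi> x) / h k" for k x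
  have cD: "continuous_on UNIV (D k)" and bD: "\<bar>D k x\<bar> \<le> L" for k x
    unfolding D_def[abs_def] by (intro lipschitz_diff_quotient[OF L(2) h(1) norm_axis_1])+
  have iC: "integrable lebesgue (\<lambda>x. indicator C x *\<^sub>R (1::real))"
    using continuous_locally_integrable[of UNIV "\<lambda>x. 1"] C(1)
    unfolding locally_integrable_def set_integrable_def by (metis continuous_on_const subset_UNIV)
  have i\<Gamma>: "integrable lebesgue (\<lambda>x. indicator C x *\<^sub>R (\<Gamma> x $ i))"
    using has_weak_gradD(2)[OF \<Gamma>, of i] C unfolding locally_integrable_def set_integrable_def by blast
  define B where "B = L * (\<integral>x. indicator C x *\<^sub>R 1 \<partial>lebesgue) + (\<integral>x. \<bar>indicator C x *\<^sub>R (\<Gamma> x $ i)\<bar> \<partial>lebesgue) + 1"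
  have B: "B > 0" unfolding B_def using L(1) 
    by (intro add_nonneg_pos add_nonneg_nonneg mult_nonneg_nonneg integral_nonneg_AE AE_I2) auto
  have intD: "integrable lebesgue (\<lambda>x. D k x * f x)" if "continuous_on UNIV f" "\<And>x. x \<notin> C \<Longrightarrow> f x = 0" for k f
    by (rule continuous_compact_support_integrable[OF _ C(1)])
       (use that cD in \<open>auto intro: continuous_on_mult\<close>)
  have int\<Gamma>: "integrable lebesgue (\<lambda>x. \<Gamma> x $ i * f x)"
    if "continuous_on UNIV f" "\<And>x. x \<notin> C \<Longrightarrow> f x = 0" "\<And>x. \<bar>f x\<bar> \<le> b" for f b
    using locally_integrable_test[OF has_weak_gradD(2)[OF \<Gamma>] C(1,2) continuous_lebesgue_measurable[OF that(1)] that(3,2)] .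
  show ?thesis
    unfolding D_def[symmetric]
  proof (rule LIMSEQ_I)
    fix r :: real assume "r > 0"
    define \<epsilon> where "\<epsilon> = r / (2 * B)"
    have \<epsilon>: "\<epsilon> > 0" using \<open>r > 0\<close> B by (simp add: \<epsilon>_def)
    obtain f where f: "f \<in> test_functions U" "\<And>x. \<bar>g x - f x\<bar> \<le> \<epsilon>" "\<And>x. x \<notin> C \<Longrightarrow> f x = 0"
      using approx[OF \<epsilon>] by blast
    have cf: "continuous_on UNIV f" using f(1) by (rule test_continuous)
    obtain b where b: "\<And>x. \<bar>f x\<bar> \<le> b" using test_bounded[OF f(1)] by blast
    have gC: "g x = 0" if "x \<notin> C" for x using g(4) C(3) that by blast
    have gb: "\<bar>g x\<bar> \<le> b + \<epsilon>" for x using b[of x] f(2)[of x] by linarith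
    have lim: "(\<lambda>k. \<integral>x. D k x * f x \<partial>lebesgue) \<longlonglongrightarrow> (\<integral>x. \<Gamma> x $ i * f x \<partial>lebesgue)"
    proof -
      have "(\<integral>x. \<phi> x * pd i f x \<partial>lebesgue) = (LINT x:U|lebesgue. \<phi> x * pd i f x)"
        by (rule set_integral_restrict_support[symmetric]) (use T in auto)
      also have "\<dots> = - (LINT x:U|lebesgue. \<Gamma> x $ i * f x)" by (rule has_weak_gradD(3)[OF \<Gamma> f(1)])
      also have "(LINT x:U|lebesgue. \<Gamma> x $ i * f x) = (\<integral>x. \<Gamma> x $ i * f x \<partial>lebesgue)"
        by (rule set_integral_restrict_support) (use f(3) C in auto)
      finally have eq: "(\<integral>x. \<phi> x * pd i f x \<partial>lebesgue) = - (\<integral>x. \<Gamma> x $ i * f x \<partial>lebesgue)" .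
      have "(\<lambda>k. \<integral>x. D k x * f x \<partial>lebesgue) \<longlonglongrightarrow> - (\<integral>x. \<phi> x * pd i f x \<partial>lebesgue)"
        unfolding D_def by (rule diff_quotient_test_tendsto[OF c\<phi> T(1) T(3) f(1) h])
      then show ?thesis unfolding eq by simp
    qed
    from LIMSEQ_D[OF lim, of "r / 2"] \<open>r > 0\<close> obtain N where
      N: "\<And>k. k \<ge> N \<Longrightarrow> norm ((\<integral>x. D k x * f x \<partial>lebesgue) - (\<integral>x. \<Gamma> x $ i * f x \<partial>lebesgue)) < r / 2" by auto
    have "norm ((\<integral>x. D k x * g x \<partial>lebesgue) - (\<integral>x. \<Gamma> x $ i * g x \<partial>lebesgue)) < r" if "k \<ge> N" for k
    proof -
      have 1: "\<bar>(\<integral>x. D k x * g x \<partial>lebesgue) - (\<integral>x. D k x * f x \<partial>lebesgue)\<bar>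
          \<le> \<epsilon> * L * (\<integral>x. indicator C x *\<^sub>R 1 \<partial>lebesgue)"
      proof -
        have "(\<integral>x. D k x * g x \<partial>lebesgue) - (\<integral>x. D k x * f x \<partial>lebesgue) = (\<integral>x. D k x * (g x - f x) \<partial>lebesgue)"
          using intD[OF g(1) gC, of k] intD[OF cf f(3), of k] by (simp add: right_diff_distrib)
        also have "\<bar>\<dots>\<bar> \<le> (\<integral>x. \<bar>D k x * (g x - f x)\<bar> \<partial>lebesgue)" by (rule integral_abs_bound)
        also have "\<dots> \<le> (\<integral>x. \<epsilon> * L * (indicator C x *\<^sub>R 1) \<partial>lebesgue)"
        proof (rule integral_mono)
          show "integrable lebesgue (\<lambda>x. \<bar>D k x * (g x - f x)\<bar>)"
            by (intro integrable_abs intD continuous_intros g(1) cf) (simp add: gC f(3))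
          show "integrable lebesgue (\<lambda>x. \<epsilon> * L * (indicator C x *\<^sub>R 1))" using iC by (rule integrable_mult_right)
          fix x
          show "\<bar>D k x * (g x - f x)\<bar> \<le> \<epsilon> * L * (indicator C x *\<^sub>R 1)"
          proof (cases "x \<in> C")
            case True
            have "\<bar>D k x * (g x - f x)\<bar> \<le> L * \<epsilon>"
              unfolding abs_mult using bD[of k x] f(2)[of x] L(1) by (intro mult_mono) auto
            then show ?thesis using True by (simp add: mult.commute)
          qed (simp add: gC f(3))
        qed
        also have "\<dots> = \<epsilon> * L * (\<integral>x. indicator C x *\<^sub>R 1 \<partial>lebesgue)" by (rule integral_mult_right_zero)
        finally show ?thesis .
      qed
      have 2: "\<bar>(\<integral>x. \<Gamma> x $ i * f x \<partial>lebesgue) - (\<integral>x. \<Gamma> x $ i * g x \<partial>lebesgue)\<bar>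
          \<le> \<epsilon> * (\<integral>x. \<bar>indicator C x *\<^sub>R (\<Gamma> x $ i)\<bar> \<partial>lebesgue)"
      proof -
        have i: "integrable lebesgue (\<lambda>x. \<Gamma> x $ i * (f x - g x))"
          using f(2) by (intro int\<Gamma>[where b = \<epsilon>] continuous_intros g(1) cf) (auto simp: gC f(3) abs_minus_commute)
        have "(\<integral>x. \<Gamma> x $ i * f x \<partial>lebesgue) - (\<integral>x. \<Gamma> x $ i * g x \<partial>lebesgue) = (\<integral>x. \<Gamma> x $ i * (f x - g x) \<partial>lebesgue)"
          using int\<Gamma>[OF cf f(3) b] int\<Gamma>[OF g(1) gC gb]
          by (simp add: right_diff_distrib)
        also have "\<bar>\<dots>\<bar> \<le> (\<integral>x. \<bar>\<Gamma> x $ i * (f x - g x)\<bar> \<partial>lebesgue)" by (rule integral_abs_bound)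
        also have "\<dots> \<le> (\<integral>x. \<epsilon> * \<bar>indicator C x *\<^sub>R (\<Gamma> x $ i)\<bar> \<partial>lebesgue)"
        proof (rule integral_mono)
          show "integrable lebesgue (\<lambda>x. \<bar>\<Gamma> x $ i * (f x - g x)\<bar>)" using i by (rule integrable_abs)
          show "integrable lebesgue (\<lambda>x. \<epsilon> * \<bar>indicator C x *\<^sub>R (\<Gamma> x $ i)\<bar>)"
            using i\<Gamma> by (intro integrable_mult_right integrable_abs)
          fix x
          show "\<bar>\<Gamma> x $ i * (f x - g x)\<bar> \<le> \<epsilon> * \<bar>indicator C x *\<^sub>R (\<Gamma> x $ i)\<bar>"
          proof (cases "x \<in> C")
            case True
            have "\<bar>\<Gamma> x $ i * (f x - g x)\<bar> \<le> \<bar>\<Gamma> x $ i\<bar> * \<epsilon>"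
              unfolding abs_mult using f(2)[of x] by (intro mult_left_mono) (auto simp: abs_minus_commute)
            then show ?thesis using True by (simp add: mult.commute)
          qed (simp add: gC f(3))
        qed
        also have "\<dots> = \<epsilon> * (\<integral>x. \<bar>indicator C x *\<^sub>R (\<Gamma> x $ i)\<bar> \<partial>lebesgue)" by (rule integral_mult_right_zero)
        finally show ?thesis .
      qed
      have "\<epsilon> * L * (\<integral>x. indicator C x *\<^sub>R 1 \<partial>lebesgue) + \<epsilon> * (\<integral>x. \<bar>indicator C x *\<^sub>R (\<Gamma> x $ i)\<bar> \<partial>lebesgue)
          = \<epsilon> * (B - 1)" unfolding B_def by (simp add: algebra_simps)
      also have "\<dots> < \<epsilon> * B" using \<epsilon> by simp
      also have "\<dots> = r / 2" using B by (simp add: \<epsilon>_def)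
      finally show ?thesis using 1 2 N[OF that] unfolding real_norm_def by linarith
    qed
    then show "\<exists>N. \<forall>k\<ge>N. norm ((\<integral>x. D k x * g x \<partial>lebesgue) - (\<integral>x. \<Gamma> x $ i * g x \<partial>lebesgue)) < r" by blast
  qed
qed

text \<open>
  The weak chain rule for the square, from the identity
  \<open>D\<^sub>h (\<phi>\<^sup>2) = 2 \<phi> D\<^sub>h \<phi> + h (D\<^sub>h \<phi>)\<^sup>2\<close> for the difference quotient \<open>D\<^sub>h\<close>.
\<close>
lemma weak_grad_square:
  fixes \<phi> :: "real^'n::finite \<Rightarrow> real"
  assumes U: "open U" and \<phi>: "\<phi> \<in> lipschitz_functions U" and \<Gamma>: "has_weak_grad U \<phi> \<Gamma>"
    and \<psi>: "\<psi> \<in> test_functions U"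
  shows "(\<integral>x. (\<phi> x)\<^sup>2 * pd i \<psi> x \<partial>lebesgue) = - (\<integral>x. \<Gamma> x $ i * (2 * \<phi> x * \<psi> x) \<partial>lebesgue)"
proof -
  obtain L T where L: "L > 0" "L-lipschitz_on UNIV \<phi>" and T: "compact T" "T \<subseteq> U" "\<And>x. x \<notin> T \<Longrightarrow> \<phi> x = 0"
    and c\<phi>: "continuous_on UNIV \<phi>"
    using \<phi> by (rule lipschitz_functionsE) blast
  have c\<psi>: "continuous_on UNIV \<psi>" using \<psi> by (rule test_continuous)
  define h where "h k = 1 / real (Suc k)" for k
  have h: "h k \<noteq> 0" "\<bar>h k\<bar> \<le> 1" for k by (auto simp: h_def)
  have h0: "h \<longlonglongrightarrow> 0" unfolding h_def by (rule LIMSEQ_Suc[OF lim_inverse_n'])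
  define D where "D k x = (\<phi> (x + h k *\<^sub>R axis i 1) - \<phi> x) / h k" for k x
  let ?D2 = "\<lambda>k x. ((\<phi> (x + h k *\<^sub>R axis i 1))\<^sup>2 - (\<phi> x)\<^sup>2) / h k"
  have cD: "continuous_on UNIV (D k)" and bD: "\<bar>D k x\<bar> \<le> L" for k x
    unfolding D_def[abs_def] by (intro lipschitz_diff_quotient[OF L(2) h(1) norm_axis_1])+
  have A: "(\<lambda>k. \<integral>x. ?D2 k x * \<psi> x \<partial>lebesgue) \<longlonglongrightarrow> - (\<integral>x. (\<phi> x)\<^sup>2 * pd i \<psi> x \<partial>lebesgue)"
    by (rule diff_quotient_test_tendsto[OF _ T(1) _ \<psi> h h0]) (auto intro!: continuous_intros c\<phi> simp: T(3))
  have B: "(\<lambda>k. \<integral>x. D k x * (2 * \<phi> x * \<psi> x) \<partial>lebesgue) \<longlonglongrightarrow> (\<integral>x. \<Gamma> x $ i * (2 * \<phi> x * \<psi> x) \<partial>lebesgue)"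
    unfolding D_def by (rule diff_quotient_weak_tendsto[OF U \<phi> \<Gamma> _ T(1,2) _ h h0]) (auto intro!: continuous_intros c\<phi> c\<psi> simp: T(3))
  obtain S where S: "compact S" "\<And>x. x \<notin> S \<Longrightarrow> \<psi> x = 0" using \<psi> by (rule test_functionsE) blast
  have i1: "integrable lebesgue (\<lambda>x. D k x * (2 * \<phi> x * \<psi> x))" for k
    by (rule continuous_compact_support_integrable[OF _ S(1)]) (auto intro!: continuous_on_mult continuous_intros c\<phi> c\<psi> cD simp: S(2))
  have i2: "integrable lebesgue (\<lambda>x. (D k x)\<^sup>2 * \<psi> x)" for k
    by (rule continuous_compact_support_integrable[OF _ S(1)]) (auto intro!: continuous_on_mult continuous_on_power c\<psi> cD simp: S(2))
  have split: "(\<integral>x. ?D2 k x * \<psi> x \<partial>lebesgue) = (\<integral>x. D k x * (2 * \<phi> x * \<psi> x) \<partial>lebesgue) + h k * (\<integral>x. (D k x)\<^sup>2 * \<psi> x \<partial>lebesgue)" for k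
  proof -
    have "(\<integral>x. ?D2 k x * \<psi> x \<partial>lebesgue) = (\<integral>x. D k x * (2 * \<phi> x * \<psi> x) + h k * ((D k x)\<^sup>2 * \<psi> x) \<partial>lebesgue)"
      by (intro Bochner_Integration.integral_cong refl) (use h(1)[of k] in \<open>simp add: D_def field_simps power2_eq_square\<close>)
    then show ?thesis using i1 i2 by simp
  qed
  have "(\<lambda>k. h k * (\<integral>x. (D k x)\<^sup>2 * \<psi> x \<partial>lebesgue)) \<longlonglongrightarrow> 0"
  proof (rule Lim_null_comparison[OF always_eventually])
    show "\<forall>k. norm (h k * (\<integral>x. (D k x)\<^sup>2 * \<psi> x \<partial>lebesgue)) \<le> h k * (\<integral>x. L\<^sup>2 * \<bar>\<psi> x\<bar> \<partial>lebesgue)"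
    proof
      fix k
      have "\<bar>\<integral>x. (D k x)\<^sup>2 * \<psi> x \<partial>lebesgue\<bar> \<le> (\<integral>x. \<bar>(D k x)\<^sup>2 * \<psi> x\<bar> \<partial>lebesgue)" by (rule integral_abs_bound)
      also have "\<dots> \<le> (\<integral>x. L\<^sup>2 * \<bar>\<psi> x\<bar> \<partial>lebesgue)"
      proof (rule integral_mono)
        show "integrable lebesgue (\<lambda>x. \<bar>(D k x)\<^sup>2 * \<psi> x\<bar>)" using i2 by (rule integrable_abs)
        show "integrable lebesgue (\<lambda>x. L\<^sup>2 * \<bar>\<psi> x\<bar>)" using test_integrable[OF \<psi>] by (intro integrable_mult_right integrable_abs)
        show "\<bar>(D k x)\<^sup>2 * \<psi> x\<bar> \<le> L\<^sup>2 * \<bar>\<psi> x\<bar>" for x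
          unfolding abs_mult using bD[of k x] L(1) by (intro mult_right_mono) (auto simp del: power_divide simp: abs_le_square_iff[symmetric])
      qed
      finally show "norm (h k * (\<integral>x. (D k x)\<^sup>2 * \<psi> x \<partial>lebesgue)) \<le> h k * (\<integral>x. L\<^sup>2 * \<bar>\<psi> x\<bar> \<partial>lebesgue)"
        by (simp add: abs_mult h_def divide_right_mono)
    qed
    show "(\<lambda>k. h k * (\<integral>x. L\<^sup>2 * \<bar>\<psi> x\<bar> \<partial>lebesgue)) \<longlonglongrightarrow> 0"
      using tendsto_mult_right[OF h0] by simp
  qed
  then have "(\<lambda>k. \<integral>x. ?D2 k x * \<psi> x \<partial>lebesgue) \<longlonglongrightarrow> (\<integral>x. \<Gamma> x $ i * (2 * \<phi> x * \<psi> x) \<partial>lebesgue) + 0"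
    unfolding split by (intro tendsto_add B)
  with A have "- (\<integral>x. (\<phi> x)\<^sup>2 * pd i \<psi> x \<partial>lebesgue) = (\<integral>x. \<Gamma> x $ i * (2 * \<phi> x * \<psi> x) \<partial>lebesgue) + 0"
    by (rule LIMSEQ_unique)
  then show ?thesis by simp
qed

lemma weak_grad_bounded:
  fixes \<phi> :: "real^'n::finite \<Rightarrow> real"
  assumes U: "open U" and \<phi>: "\<phi> \<in> lipschitz_functions U" and \<Gamma>: "has_weak_grad U \<phi> \<Gamma>"
    and L: "L-lipschitz_on UNIV \<phi>"
  shows "AE x in lebesgue. x \<in> U \<longrightarrow> \<bar>\<Gamma> x $ i\<bar> \<le> L"
proof -
  have c\<phi>: "continuous_on UNIV \<phi>" using L by (rule lipschitz_on_continuous_on)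
  define h where "h k = 1 / real (Suc k)" for k
  have h: "h k \<noteq> 0" "\<bar>h k\<bar> \<le> 1" for k by (auto simp: h_def)
  have h0: "h \<longlonglongrightarrow> 0" unfolding h_def by (rule LIMSEQ_Suc[OF lim_inverse_n'])
  define D where "D k x = (\<phi> (x + h k *\<^sub>R axis i 1) - \<phi> x) / h k" for k x
  have cD: "continuous_on UNIV (D k)" and bD: "\<bar>D k x\<bar> \<le> L" for k x
    unfolding D_def[abs_def] by (intro lipschitz_diff_quotient[OF L h(1) norm_axis_1])+
  have bound: "\<bar>LINT x:U|lebesgue. \<Gamma> x $ i * \<psi> x\<bar> \<le> L * (LINT x:U|lebesgue. \<psi> x)"
    and int: "set_integrable lebesgue U (\<lambda>x. \<Gamma> x $ i * \<psi> x)" "set_integrable lebesgue U \<psi>"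
    if \<psi>: "\<psi> \<in> test_functions U" "\<And>x. \<psi> x \<ge> 0" for \<psi>
  proof -
    obtain S where S: "compact S" "S \<subseteq> U" "\<And>x. x \<notin> S \<Longrightarrow> \<psi> x = 0" using \<psi>(1) by (rule test_functionsE) blast
    show "set_integrable lebesgue U (\<lambda>x. \<Gamma> x $ i * \<psi> x)"
      by (rule set_integrable_mult_test[OF U has_weak_gradD(2)[OF \<Gamma>] \<psi>(1)])
    show si: "set_integrable lebesgue U \<psi>"
      using set_integrable_mult_test[OF U continuous_locally_integrable[OF continuous_on_const] \<psi>(1), of 1] by simp
    have lim: "(\<lambda>k. \<integral>x. D k x * \<psi> x \<partial>lebesgue) \<longlonglongrightarrow> (\<integral>x. \<Gamma> x $ i * \<psi> x \<partial>lebesgue)"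
      unfolding D_def by (rule diff_quotient_weak_tendsto[OF U \<phi> \<Gamma> test_continuous[OF \<psi>(1)] S h h0])
    have "\<bar>\<integral>x. D k x * \<psi> x \<partial>lebesgue\<bar> \<le> L * (\<integral>x. \<psi> x \<partial>lebesgue)" for k
    proof -
      have iD: "integrable lebesgue (\<lambda>x. D k x * \<psi> x)"
        by (rule continuous_compact_support_integrable[OF _ S(1)])
          (use cD[of k] test_continuous[OF \<psi>(1)] S(3) in \<open>auto intro: continuous_on_mult\<close>)
      have "\<bar>\<integral>x. D k x * \<psi> x \<partial>lebesgue\<bar> \<le> (\<integral>x. \<bar>D k x * \<psi> x\<bar> \<partial>lebesgue)" by (rule integral_abs_bound)
      also have "\<dots> \<le> (\<integral>x. L * \<psi> x \<partial>lebesgue)"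
        using iD test_integrable[OF \<psi>(1)] bD \<psi>(2)
        by (intro integral_mono integrable_abs integrable_mult_right) (auto simp: abs_mult intro!: mult_right_mono)
      finally show ?thesis by simp
    qed
    then have "\<bar>\<integral>x. \<Gamma> x $ i * \<psi> x \<partial>lebesgue\<bar> \<le> L * (\<integral>x. \<psi> x \<partial>lebesgue)"
      by (intro LIMSEQ_le_const2[OF tendsto_rabs[OF lim]]) blast
    moreover have "(LINT x:U|lebesgue. \<psi> x) = (\<integral>x. \<psi> x \<partial>lebesgue)"
      using S(2,3) by (intro set_integral_restrict_support) blast
    ultimately show "\<bar>LINT x:U|lebesgue. \<Gamma> x $ i * \<psi> x\<bar> \<le> L * (LINT x:U|lebesgue. \<psi> x)"
      by (simp add: integrable_mult_test(2)[OF has_weak_gradD(2)[OF \<Gamma>] \<psi>(1)])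
  qed
  have li: "locally_integrable U (\<lambda>x. L - \<sigma> * \<Gamma> x $ i)" for \<sigma>
    using has_weak_gradD(2)[OF \<Gamma>, of i] continuous_locally_integrable[of U "\<lambda>x. L"]
    unfolding locally_integrable_def by (auto intro!: set_integral_diff)
  have *: "AE x in lebesgue. x \<in> U \<longrightarrow> 0 \<le> L - \<sigma> * \<Gamma> x $ i" if "\<bar>\<sigma>\<bar> = 1" for \<sigma> :: real
  proof (rule test_nonneg_imp_AE_nonneg[OF U li])
    fix \<psi> assume \<psi>: "\<psi> \<in> test_functions U" "\<And>x. 0 \<le> \<psi> x"
    have "(LINT x:U|lebesgue. (L - \<sigma> * \<Gamma> x $ i) * \<psi> x) = (LINT x:U|lebesgue. L * \<psi> x - \<sigma> * (\<Gamma> x $ i * \<psi> x))"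
      by (simp add: algebra_simps)
    also have "\<dots> = L * (LINT x:U|lebesgue. \<psi> x) - \<sigma> * (LINT x:U|lebesgue. \<Gamma> x $ i * \<psi> x)"
      using int[OF \<psi>] by (simp add: set_integral_diff(2))
    finally have eq: "(LINT x:U|lebesgue. (L - \<sigma> * \<Gamma> x $ i) * \<psi> x)
      = L * (LINT x:U|lebesgue. \<psi> x) - \<sigma> * (LINT x:U|lebesgue. \<Gamma> x $ i * \<psi> x)" .
    show "0 \<le> (LINT x:U|lebesgue. (L - \<sigma> * \<Gamma> x $ i) * \<psi> x)"
    proof -
      have "\<sigma> = 1 \<or> \<sigma> = - 1" using that by linarith
      then show ?thesis unfolding eq using bound[OF \<psi>] by auto
    qed
  qed
  have "AE x in lebesgue. x \<in> U \<longrightarrow> 0 \<le> L - \<Gamma> x $ i" using *[of 1] by simp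
  moreover have "AE x in lebesgue. x \<in> U \<longrightarrow> 0 \<le> L + \<Gamma> x $ i" using *[of "-1"] by simp
  ultimately show ?thesis by eventually_elim auto
qed

lemma weak_grad_zero_outside_support:
  fixes \<phi> :: "real^'n::finite \<Rightarrow> real"
  assumes U: "open U" and \<Gamma>: "has_weak_grad U \<phi> \<Gamma>" and S: "closed S" "\<And>x. x \<notin> S \<Longrightarrow> \<phi> x = 0"
  shows "AE x in lebesgue. x \<in> U - S \<longrightarrow> \<Gamma> x $ i = 0"
proof (rule du_bois_reymond)
  show "open (U - S)" using U S(1) by (rule open_Diff)
  show "locally_integrable (U - S) (\<lambda>x. \<Gamma> x $ i)"
    using has_weak_gradD(2)[OF \<Gamma>] unfolding locally_integrable_def by blast
  fix \<psi> assume \<psi>: "\<psi> \<in> test_functions (U - S)"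
  obtain T where T: "T \<subseteq> U - S" "\<And>x. x \<notin> T \<Longrightarrow> \<psi> x = 0" using \<psi> by (rule test_functionsE) blast
  obtain T' where T': "T' \<subseteq> U - S" "\<And>x. x \<notin> T' \<Longrightarrow> pd i \<psi> x = 0" using test_functions_pd[OF \<psi>] by (rule test_functionsE) blast
  have \<psi>U: "\<psi> \<in> test_functions U" using \<psi> by (rule test_functions_mono) blast
  have 0: "\<phi> x * pd i \<psi> x = 0" for x using S(2)[of x] T'(1) T'(2)[of x] by (cases "x \<in> S") auto
  have \<psi>0: "\<psi> x = 0" if "x \<notin> U - S" for x using T that by blast
  have "(LINT x:(U - S)|lebesgue. \<Gamma> x $ i * \<psi> x) = (LINT x:U|lebesgue. \<Gamma> x $ i * \<psi> x)"
    unfolding set_lebesgue_integral_def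
    by (intro Bochner_Integration.integral_cong refl) (use \<psi>0 in \<open>auto split: split_indicator\<close>)
  also have "\<dots> = - (LINT x:U|lebesgue. \<phi> x * pd i \<psi> x)" using has_weak_gradD(3)[OF \<Gamma> \<psi>U, of i] by simp
  also have "\<dots> = 0" unfolding 0 by (simp add: set_lebesgue_integral_def)
  finally show "(LINT x:(U - S)|lebesgue. \<Gamma> x $ i * \<psi> x) = 0" .
qed

section \<open>Functions with vanishing weak gradient\<close>

lemma not_AE_outside_open:
  fixes V :: "'a::euclidean_space set"
  assumes "open V" "V \<noteq> {}"
  shows "\<not> (AE x in lebesgue. x \<notin> V)"
proof
  assume "AE x in lebesgue. x \<notin> V"
  then have "V \<in> null_sets lebesgue"
    using AE_iff_null_sets[of V lebesgue] assms(1) by auto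
  then have "negligible V" by (simp add: negligible_iff_null_sets)
  then show False using open_not_negligible assms by blast
qed

lemma lborel_integral_reflect:
  fixes g :: "'a::euclidean_space \<Rightarrow> real"
  assumes [measurable]: "g \<in> borel_measurable borel"
  shows "(\<integral>y. g (a - y) \<partial>lborel) = (\<integral>y. g y \<partial>lborel)"
proof -
  have "lborel = distr lborel borel (\<lambda>x::'a. a - x)"
    using lborel_affine[of "-1" a] by (simp add: density_1)
  then have "(\<integral>y. g y \<partial>lborel) = (\<integral>y. g y \<partial>distr lborel borel (\<lambda>x. a - x))" by simp
  also have "\<dots> = (\<integral>y. g (a - y) \<partial>lborel)" by (rule integral_distr) auto
  finally show ?thesis by simp
qed

lemma test_functions_translate:
  assumes "\<psi> \<in> test_functions V" "\<And>x. x \<in> V \<Longrightarrow> x + z \<in> U"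
  shows "(\<lambda>x. \<psi> (x - z)) \<in> test_functions U"
proof -
  obtain S where S: "\<And>n. Cn n UNIV \<psi>" "compact S" "S \<subseteq> V" "\<And>x. x \<notin> S \<Longrightarrow> \<psi> x = 0"
    using assms(1) by (rule test_functionsE) blast
  show ?thesis
  proof (rule test_functionsI[of _ "(+) z ` S"])
    show "compact ((+) z ` S)" using S(2) by (rule compact_translation)
    show "(+) z ` S \<subseteq> U" using S(3) assms(2) by (auto simp: add.commute)
    fix x assume "x \<notin> (+) z ` S"
    then have "x - z \<notin> S" by (metis add_diff_cancel_left' diff_add_cancel image_eqI add.commute)
    then show "\<psi> (x - z) = 0" by (rule S(4))
  qed (intro Cn_translation S)
qed

text \<open>
  The derivative of \<open>\<integral> v (x) \<psi> (x - s z) dx\<close> with respect to \<open>s\<close> is zero as long as the support of the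
  translated function stays in \<open>U\<close>.
\<close>
lemma weak_grad_zero_translate:
  fixes v :: "real^'n::finite \<Rightarrow> real"
  assumes U: "open U" and v: "locally_integrable U v"
    and 0: "\<And>\<psi> i. \<psi> \<in> test_functions U \<Longrightarrow> (LINT x:U|lebesgue. v x * pd i \<psi> x) = 0"
    and V: "cball x0 r \<subseteq> U" and \<psi>: "\<psi> \<in> test_functions (ball x0 s)" and z: "s + norm z \<le> r"
  shows "(\<integral>x. v x * \<psi> (x - z) \<partial>lebesgue) = (\<integral>x. v x * \<psi> x \<partial>lebesgue)"
proof -
  let ?C = "cball x0 r"
  have iv: "integrable lebesgue (\<lambda>x. indicator ?C x *\<^sub>R v x)"
    using v V unfolding locally_integrable_def set_integrable_def by (meson compact_cball)
  have in_C: "x + t *\<^sub>R z \<in> ?C" if "x \<in> ball x0 s" "t \<in> {0..1}" for x t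
  proof -
    have "dist x0 (x + t *\<^sub>R z) \<le> dist x0 x + norm (t *\<^sub>R z)"
      by (metis add_diff_cancel_left' dist_commute dist_norm dist_triangle)
    also have "norm (t *\<^sub>R z) \<le> norm z" using that(2) by (simp add: mult_left_le_one_le)
    finally show ?thesis using that(1) z by simp
  qed
  have T: "(\<lambda>x. \<psi> (x - t *\<^sub>R z)) \<in> test_functions U" if "t \<in> {0..1}" for t
    using in_C[OF _ that] V by (intro test_functions_translate[OF \<psi>]) blast
  obtain S where S: "S \<subseteq> ball x0 s" "\<And>x. x \<notin> S \<Longrightarrow> \<psi> x = 0" using \<psi> by (rule test_functionsE) blast
  have T0: "\<psi> (x - t *\<^sub>R z) = 0" if "t \<in> {0..1}" "x \<notin> ?C" for x t
    using in_C[OF _ that(1), of "x - t *\<^sub>R z"] that(2) S by force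
  have int: "integrable lebesgue (\<lambda>x. v x * \<psi> (x - t *\<^sub>R z))" if "t \<in> {0..1}" for t
    by (rule integrable_mult_test(1)[OF v T[OF that]])
  define f where "f t = (\<integral>x. v x * \<psi> (x - t *\<^sub>R z) \<partial>lebesgue)" for t
  have "(f has_field_derivative 0) (at t within {0..1})" if t: "t \<in> {0..1}" for t
    unfolding has_field_derivative_iff tendsto_at_iff_sequentially
  proof (intro allI impI)
    fix X assume X: "\<forall>k. X k \<in> {0..1} - {t}" "X \<longlonglongrightarrow> t"
    let ?P = "\<lambda>x. \<psi> (x - t *\<^sub>R z)"
    obtain L where L: "L-lipschitz_on UNIV ?P" using T[OF t] by (rule test_lipschitz)
    have e: "?P (x + (X k - t) *\<^sub>R (- z)) = \<psi> (x - X k *\<^sub>R z)" for x k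
      by (simp add: algebra_simps)
    have lim: "(\<lambda>k. \<integral>x. v x * ((?P (x + (X k - t) *\<^sub>R (- z)) - ?P x) / (X k - t)) \<partial>lebesgue)
       \<longlonglongrightarrow> (\<integral>x. v x * (grad ?P x \<bullet> (- z)) \<partial>lebesgue)"
    proof (rule diff_quotient_integral_tendsto[OF iv L has_derivative_grad[OF test_differentiable[OF T[OF t]]]])
      show "X k - t \<noteq> 0" for k using X(1) by auto
      show "(\<lambda>k. X k - t) \<longlonglongrightarrow> 0" using X(2) by (simp add: LIM_zero_iff)
      show "?P (x + (X k - t) *\<^sub>R (- z)) = 0" if "x \<notin> ?C" for x k
        unfolding e using X(1) that by (intro T0) auto
      show "?P x = 0" if "x \<notin> ?C" for x using T0[OF t that] .
    qed
    have "(\<integral>x. v x * (grad ?P x \<bullet> (- z)) \<partial>lebesgue) = (\<integral>x. (\<Sum>i\<in>UNIV. - z $ i * (v x * pd i ?P x)) \<partial>lebesgue)"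
      by (intro Bochner_Integration.integral_cong refl)
         (simp add: inner_vec_def sum_distrib_left algebra_simps sum_negf)
    also have "\<dots> = (\<Sum>i\<in>UNIV. - z $ i * (\<integral>x. v x * pd i ?P x \<partial>lebesgue))"
      using integrable_mult_test(1)[OF v test_functions_pd[OF T[OF t]]]
      by (subst Bochner_Integration.integral_sum) auto
    also have "\<dots> = 0"
      using 0[OF T[OF t]] unfolding integrable_mult_test(2)[OF v test_functions_pd[OF T[OF t]]] by simp
    finally have z0: "(\<integral>x. v x * (grad ?P x \<bullet> (- z)) \<partial>lebesgue) = 0" .
    have "(f (X k) - f t) / (X k - t) = (\<integral>x. v x * ((?P (x + (X k - t) *\<^sub>R (- z)) - ?P x) / (X k - t)) \<partial>lebesgue)" for k
    proof -
      have "X k \<in> {0..1}" using X(1) by blast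
      then have "(f (X k) - f t) / (X k - t) = (\<integral>x. (v x * \<psi> (x - X k *\<^sub>R z) - v x * ?P x) / (X k - t) \<partial>lebesgue)"
        unfolding f_def using int t by simp
      then show ?thesis unfolding e by (simp only: right_diff_distrib[symmetric] times_divide_eq_right)
    qed
    then show "((\<lambda>y. (f y - f t) / (y - t)) \<circ> X) \<longlonglongrightarrow> 0"
      using lim unfolding z0 by (simp only: o_def)
  qed
  then obtain c where "\<forall>t\<in>{0..1}. f t = c"
    using has_field_derivative_zero_constant[of "{0..1::real}" f] by auto
  then have "f 1 = f 0" by simp
  then show ?thesis by (simp add: f_def)
qed

text \<open>
  By translation invariance, integrating \<open>v (x) \<psi> (x - y + x0) \<eta> (y)\<close> first over \<open>x\<close> and then over \<open>y\<close>
  gives \<open>\<integral>\<eta> \<integral>v \<psi>\<close>. The double integral is symmetric in \<open>\<psi>\<close> and \<open>\<eta>\<close>, so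
  \<open>\<integral>\<eta> \<integral>v \<psi> = \<integral>\<psi> \<integral>v \<eta>\<close>; for a fixed \<open>\<eta>\<close> this says that \<open>v\<close> minus a constant is orthogonal to
  all test functions supported near \<open>x0\<close>.
\<close>
lemma weak_grad_zero_locally_constant:
  fixes v :: "real^'n::finite \<Rightarrow> real"
  assumes U: "open U" and v: "locally_integrable U v"
    and 0: "\<And>\<psi> i. \<psi> \<in> test_functions U \<Longrightarrow> (LINT x:U|lebesgue. v x * pd i \<psi> x) = 0"
    and "x0 \<in> U"
  shows "\<exists>r>0. \<exists>c. AE x in lebesgue. x \<in> ball x0 r \<longrightarrow> v x = c"
proof -
  obtain R where R: "R > 0" "cball x0 R \<subseteq> U" using open_contains_cball[of U] U \<open>x0 \<in> U\<close> by blast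
  define r where "r = R / 2"
  have r: "r > 0" using R(1) by (simp add: r_def)
  let ?B = "ball x0 r" let ?C = "cball x0 R"
  have BC: "?B \<subseteq> ?C" using r by (auto simp: r_def)
  have iv: "integrable lebesgue (\<lambda>x. indicator ?C x *\<^sub>R v x)"
    using v R(2) unfolding locally_integrable_def set_integrable_def by (meson compact_cball)
  obtain V where V: "V \<in> borel_measurable lborel" "AE x in lborel. indicator ?C x *\<^sub>R v x = V x"
    using completion_ex_borel_measurable_real[OF borel_measurable_integrable[OF iv]] by blast
  have [measurable]: "V \<in> borel_measurable borel" using V(1) by simp
  have V': "AE x in lebesgue. indicator ?C x *\<^sub>R v x = V x" using V(2) by (rule AE_completion)
  have Vl: "V \<in> borel_measurable lebesgue" using V(1) by (rule measurable_completion)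
  have "integrable lebesgue V"
    using integrable_cong_AE[OF borel_measurable_integrable[OF iv] Vl V'] iv by blast
  then have iV: "integrable lborel V" using integrable_completion[OF V(1)] by simp
  have vV: "(\<integral>x. v x * w x \<partial>lebesgue) = (\<integral>x. V x * w x \<partial>lborel)"
    if w: "continuous_on UNIV w" "\<And>x. x \<notin> ?C \<Longrightarrow> w x = 0" for w
  proof -
    have [measurable]: "w \<in> borel_measurable borel" using w(1) by (rule borel_measurable_continuous_onI)
    have "(\<integral>x. v x * w x \<partial>lebesgue) = (\<integral>x. (indicator ?C x *\<^sub>R v x) * w x \<partial>lebesgue)"
      by (intro Bochner_Integration.integral_cong refl) (use w(2) in \<open>auto split: split_indicator\<close>)
    also have "\<dots> = (\<integral>x. V x * w x \<partial>lebesgue)"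
    proof (rule integral_cong_AE)
      show "(\<lambda>x. indicat_real ?C x *\<^sub>R v x * w x) \<in> borel_measurable lebesgue"
        by (intro borel_measurable_times[OF borel_measurable_integrable[OF iv]] continuous_lebesgue_measurable w)
      show "(\<lambda>x. V x * w x) \<in> borel_measurable lebesgue"
        by (intro borel_measurable_times Vl continuous_lebesgue_measurable w)
      show "AE x in lebesgue. indicat_real ?C x *\<^sub>R v x * w x = V x * w x"
        using V' by eventually_elim simp
    qed
    also have "\<dots> = (\<integral>x. V x * w x \<partial>lborel)" by (rule integral_completion) simp
    finally show ?thesis .
  qed
  have fub: "(\<integral>x. \<integral>y. V x * \<psi> (x - (y - x0)) * \<eta> y \<partial>lborel \<partial>lborel) = (\<integral>x. \<eta> x \<partial>lborel) * (\<integral>x. v x * \<psi> x \<partial>lebesgue)"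
    if \<psi>: "\<psi> \<in> test_functions ?B" and \<eta>: "\<eta> \<in> test_functions ?B" for \<psi> \<eta>
  proof -
    have [measurable]: "\<psi> \<in> borel_measurable borel" "\<eta> \<in> borel_measurable borel"
      using test_continuous[OF \<psi>] test_continuous[OF \<eta>] by (auto intro: borel_measurable_continuous_onI)
    have i\<eta>: "integrable lborel \<eta>" using test_integrable[OF \<eta>] by (subst (asm) integrable_completion) auto
    obtain b where b: "\<And>x. \<bar>\<psi> x\<bar> \<le> b" "b > 0" using test_bounded[OF \<psi>] by blast
    obtain S where S: "S \<subseteq> ?B" "\<And>x. x \<notin> S \<Longrightarrow> \<eta> x = 0" using \<eta> by (rule test_functionsE) blast
    obtain S' where S': "S' \<subseteq> ?B" "\<And>x. x \<notin> S' \<Longrightarrow> \<psi> x = 0" using \<psi> by (rule test_functionsE) blast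
    have dom: "integrable (lborel \<Otimes>\<^sub>M lborel) (\<lambda>(x, y). b * (V x * \<eta> y))"
    proof (rule lborel_pair.Fubini_integrable)
      show "integrable lborel (\<lambda>x. \<integral>y. norm (case (x, y) of (x, y) \<Rightarrow> b * (V x * \<eta> y)) \<partial>lborel)"
        using iV by (simp add: abs_mult)
      show "AE x in lborel. integrable lborel (\<lambda>y. case (x, y) of (x, y) \<Rightarrow> b * (V x * \<eta> y))"
        using i\<eta> by simp
    qed measurable
    have int: "integrable (lborel \<Otimes>\<^sub>M lborel) (\<lambda>(x, y). V x * \<psi> (x - (y - x0)) * \<eta> y)"
    proof (rule Bochner_Integration.integrable_bound[OF dom])
      show "AE p in lborel \<Otimes>\<^sub>M lborel. norm (case p of (x, y) \<Rightarrow> V x * \<psi> (x - (y - x0)) * \<eta> y)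
          \<le> norm (case p of (x, y) \<Rightarrow> b * (V x * \<eta> y))"
      proof (intro AE_I2, clarify)
        fix x y
        have "\<bar>V x\<bar> * \<bar>\<psi> (x - (y - x0))\<bar> * \<bar>\<eta> y\<bar> \<le> \<bar>V x\<bar> * b * \<bar>\<eta> y\<bar>"
          by (intro mult_left_mono mult_right_mono b) auto
        then show "norm (V x * \<psi> (x - (y - x0)) * \<eta> y) \<le> norm (b * (V x * \<eta> y))"
          using b(2) by (simp add: abs_mult mult_ac)
      qed
    qed measurable
    have "(\<integral>x. \<integral>y. V x * \<psi> (x - (y - x0)) * \<eta> y \<partial>lborel \<partial>lborel) = (\<integral>y. \<integral>x. V x * \<psi> (x - (y - x0)) * \<eta> y \<partial>lborel \<partial>lborel)"
      using lborel_pair.Fubini_integral[OF int] by simp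
    also have "\<dots> = (\<integral>y. \<eta> y * (\<integral>x. v x * \<psi> x \<partial>lebesgue) \<partial>lborel)"
    proof (intro Bochner_Integration.integral_cong refl)
      fix y
      show "(\<integral>x. V x * \<psi> (x - (y - x0)) * \<eta> y \<partial>lborel) = \<eta> y * (\<integral>x. v x * \<psi> x \<partial>lebesgue)"
      proof (cases "y \<in> S")
        case True
        then have y: "norm (y - x0) < r" using S(1) by (auto simp: dist_norm norm_minus_commute)
        have z: "\<psi> (x - (y - x0)) = 0" if "x \<notin> ?C" for x
        proof -
          have "x - (y - x0) \<notin> ?B"
          proof
            assume "x - (y - x0) \<in> ?B"
            then have "norm (x - (y - x0) - x0) < r" by (simp add: dist_norm norm_minus_commute)
            then have "norm (x - x0) < R" using y norm_triangle_ineq[of "x - (y - x0) - x0" "y - x0"]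
              by (simp add: r_def)
            then show False using that by (simp add: dist_norm norm_minus_commute)
          qed
          then show ?thesis using S' by blast
        qed
        have "(\<integral>x. v x * \<psi> (x - (y - x0)) \<partial>lebesgue) = (\<integral>x. v x * \<psi> x \<partial>lebesgue)"
          by (rule weak_grad_zero_translate[OF U v 0 R(2) \<psi>]) (use y in \<open>auto simp: r_def\<close>)
        moreover have "(\<integral>x. v x * \<psi> (x - (y - x0)) \<partial>lebesgue) = (\<integral>x. V x * \<psi> (x - (y - x0)) \<partial>lborel)"
          by (rule vV) (auto intro!: continuous_on_compose2[OF test_continuous[OF \<psi>]] continuous_intros z)
        ultimately show ?thesis by simp
      qed (simp add: S(2))
    qed
    finally show ?thesis by simp
  qed
  have sym: "(\<integral>x. \<eta> x \<partial>lborel) * (\<integral>x. v x * \<psi> x \<partial>lebesgue) = (\<integral>x. \<psi> x \<partial>lborel) * (\<integral>x. v x * \<eta> x \<partial>lebesgue)"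
    if \<psi>: "\<psi> \<in> test_functions ?B" and \<eta>: "\<eta> \<in> test_functions ?B" for \<psi> \<eta>
  proof -
    have [measurable]: "\<psi> \<in> borel_measurable borel" "\<eta> \<in> borel_measurable borel"
      using test_continuous[OF \<psi>] test_continuous[OF \<eta>] by (auto intro: borel_measurable_continuous_onI)
    have "(\<integral>y. V x * \<psi> (x - (y - x0)) * \<eta> y \<partial>lborel) = (\<integral>y. V x * \<eta> (x - (y - x0)) * \<psi> y \<partial>lborel)" for x
    proof -
      have "(\<integral>y. V x * \<eta> (x - (y - x0)) * \<psi> y \<partial>lborel) = (\<integral>y. (\<lambda>y. V x * \<eta> (x - (y - x0)) * \<psi> y) ((x + x0) - y) \<partial>lborel)"
        by (rule lborel_integral_reflect[symmetric]) measurable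
      also have "\<dots> = (\<integral>y. V x * \<psi> (x - (y - x0)) * \<eta> y \<partial>lborel)"
        by (intro Bochner_Integration.integral_cong refl) (simp add: algebra_simps)
      finally show ?thesis by simp
    qed
    then show ?thesis using fub[OF \<psi> \<eta>] fub[OF \<eta> \<psi>] by simp
  qed
  obtain \<eta> W where \<eta>: "\<eta> \<in> test_functions ?B" "open W" "{x0} \<subseteq> W" "\<And>x. x \<in> W \<Longrightarrow> \<eta> x = 1" "\<And>x. 0 \<le> \<eta> x"
    using smooth_cutoff[of "{x0}" ?B] r by (metis centre_in_ball compact_sing empty_subsetI insert_subset open_ball)
  have \<eta>0: "(\<integral>x. \<eta> x \<partial>lebesgue) \<noteq> 0"
  proof
    assume "(\<integral>x. \<eta> x \<partial>lebesgue) = 0"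
    then have "AE x in lebesgue. \<eta> x = 0"
      using integral_nonneg_eq_0_iff_AE[OF test_integrable[OF \<eta>(1)]] \<eta>(5) by simp
    then have "AE x in lebesgue. x \<notin> W" by eventually_elim (use \<eta>(4) in force)
    then show False using not_AE_outside_open[OF \<eta>(2)] \<eta>(3) by blast
  qed
  define c where "c = (\<integral>x. v x * \<eta> x \<partial>lebesgue) / (\<integral>x. \<eta> x \<partial>lebesgue)"
  have leb: "(\<integral>x. f x \<partial>lebesgue) = (\<integral>x. f x \<partial>lborel)" if "f \<in> test_functions ?B" for f
    using test_continuous[OF that] by (intro integral_completion) (auto intro: borel_measurable_continuous_onI)
  have "AE x in lebesgue. x \<in> ?B \<longrightarrow> v x - c = 0"
  proof (rule du_bois_reymond)
    have vB: "locally_integrable ?B v" using v BC R(2) unfolding locally_integrable_def by (meson order_trans)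
    then show "locally_integrable ?B (\<lambda>x. v x - c)"
      using continuous_locally_integrable[of ?B "\<lambda>x. c"]
      unfolding locally_integrable_def by (auto intro!: set_integral_diff)
    fix \<psi> assume \<psi>: "\<psi> \<in> test_functions ?B"
    have li: "locally_integrable ?B (\<lambda>x. v x - c)" by fact
    have "(LINT x:?B|lebesgue. (v x - c) * \<psi> x) = (\<integral>x. (v x - c) * \<psi> x \<partial>lebesgue)"
      by (rule integrable_mult_test(2)[OF li \<psi>])
    also have "\<dots> = (\<integral>x. v x * \<psi> x \<partial>lebesgue) - c * (\<integral>x. \<psi> x \<partial>lebesgue)"
      using integrable_mult_test(1)[OF vB \<psi>] test_integrable[OF \<psi>] by (simp add: left_diff_distrib)
    also have "\<dots> = 0" using sym[OF \<psi> \<eta>(1)] \<eta>0 unfolding c_def leb[OF \<psi>, symmetric] leb[OF \<eta>(1), symmetric]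
      by (simp add: field_simps)
    finally show "(LINT x:?B|lebesgue. (v x - c) * \<psi> x) = 0" .
  qed simp
  then show ?thesis using r by (intro exI[of _ r] conjI exI[of _ c]) auto
qed

section \<open>The Hardy identity for Lipschitz functions\<close>

lemma compact_exhaustion:
  fixes U :: "'a::euclidean_space set"
  assumes "open U"
  shows "\<exists>C :: nat \<Rightarrow> 'a set. (\<forall>n. compact (C n)) \<and> (\<forall>n. C n \<subseteq> U) \<and>
    (\<forall>K. compact K \<longrightarrow> K \<subseteq> U \<longrightarrow> (\<exists>N. \<forall>n\<ge>N. K \<subseteq> C n))"
proof (rule open_Union_compact_subsets[OF assms])
  fix C :: "nat \<Rightarrow> 'a set"
  assume C: "\<And>n. compact (C n)" "\<And>n. C n \<subseteq> U" "\<And>K. \<lbrakk>compact K; K \<subseteq> U\<rbrakk> \<Longrightarrow> \<exists>N. \<forall>n\<ge>N. K \<subseteq> C n"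
  show ?thesis by (intro exI[of _ C] conjI allI impI C)
qed

lemma locally_integrable_measurable:
  fixes U :: "(real^'n::finite) set"
  assumes "open U" "locally_integrable U f"
  shows "f \<in> borel_measurable (lebesgue_on U)"
proof -
  obtain C :: "nat \<Rightarrow> (real^'n::finite) set" where C: "\<forall>n. compact (C n)" "\<forall>n. C n \<subseteq> U"
    "\<forall>K. compact K \<longrightarrow> K \<subseteq> U \<longrightarrow> (\<exists>N. \<forall>n\<ge>N. K \<subseteq> C n)"
    using compact_exhaustion[OF assms(1)] by blast
  have "(\<lambda>x. indicator (C n) x *\<^sub>R f x) \<in> borel_measurable (lebesgue_on U)" for n
    using borel_measurable_integrable[OF set_integrable_compact[OF assms(2) C(1)[rule_format] C(2)[rule_format]]]
    by (rule measurable_restrict_space1)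
  then show ?thesis
  proof (rule borel_measurable_LIMSEQ_metric)
    fix x assume "x \<in> space (lebesgue_on U)"
    then have "x \<in> U" by simp
    then obtain N where "\<forall>n\<ge>N. {x} \<subseteq> C n" using C(3)[rule_format, of "{x}"] by auto
    then have "eventually (\<lambda>n. indicator (C n) x *\<^sub>R f x = f x) sequentially"
      by (intro eventually_sequentiallyI[of N]) auto
    then show "(\<lambda>n. indicator (C n) x *\<^sub>R f x) \<longlonglongrightarrow> f x" by (rule tendsto_eventually)
  qed
qed

lemma continuous_measurable_on:
  fixes f :: "'a::euclidean_space \<Rightarrow> real"
  shows "open U \<Longrightarrow> continuous_on U f \<Longrightarrow> f \<in> borel_measurable (lebesgue_on U)"
  by (rule continuous_imp_measurable_on_sets_lebesgue) auto

text \<open>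
  The integrals of \<open>f\<close> and \<open>g\<close> may both be infinite.
\<close>
lemma nn_integral_eq_of_integrable_diff:
  fixes f g z :: "'a \<Rightarrow> real"
  assumes "\<And>x. x \<in> space M \<Longrightarrow> f x = g x + z x" "\<And>x. x \<in> space M \<Longrightarrow> f x \<ge> 0" "\<And>x. x \<in> space M \<Longrightarrow> g x \<ge> 0"
    and [measurable]: "f \<in> borel_measurable M" "g \<in> borel_measurable M"
    and z: "integrable M z" "(\<integral>x. z x \<partial>M) = 0"
  shows "(\<integral>\<^sup>+x. ennreal (f x) \<partial>M) = (\<integral>\<^sup>+x. ennreal (g x) \<partial>M)"
proof (cases "integrable M g")
  case True
  have iff: "integrable M f"
    using Bochner_Integration.integrable_add[OF True z(1)]
    by (rule Bochner_Integration.integrable_cong[THEN iffD1, rotated 2]) (auto simp: assms(1))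
  have "(\<integral>x. f x \<partial>M) = (\<integral>x. g x + z x \<partial>M)"
    by (intro Bochner_Integration.integral_cong refl) (simp add: assms(1))
  also have "\<dots> = (\<integral>x. g x \<partial>M)" using True z by simp
  finally show ?thesis
    using nn_integral_eq_integral[OF iff] nn_integral_eq_integral[OF True] assms(2,3) by (simp add: AE_I2)
next
  case False
  have "\<not> integrable M f"
  proof
    assume "integrable M f"
    then have "integrable M (\<lambda>x. f x - z x)" using z(1) by (rule Bochner_Integration.integrable_diff)
    then have "integrable M g"
      by (rule Bochner_Integration.integrable_cong[THEN iffD1, rotated 2]) (auto simp: assms(1))
    with False show False by simp
  qed
  moreover have "(\<integral>\<^sup>+x. ennreal (h x) \<partial>M) = \<infinity>"
    if "\<not> integrable M h" "h \<in> borel_measurable M" "\<And>x. x \<in> space M \<Longrightarrow> h x \<ge> 0" for h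
  proof (rule ccontr)
    assume "(\<integral>\<^sup>+x. ennreal (h x) \<partial>M) \<noteq> \<infinity>"
    then have "(\<integral>\<^sup>+x. ennreal (h x) \<partial>M) < \<infinity>" by (simp add: top.not_eq_extremum)
    from integrableI_nonneg[OF that(2) AE_I2[OF that(3)] this] that(1) show False by simp
  qed
  ultimately show ?thesis using False assms(2-5) by simp
qed

text \<open>
  The integral over \<open>U\<close> of the nonnegative part of a real function.
\<close>
abbreviation nnint :: "'a::euclidean_space set \<Rightarrow> ('a \<Rightarrow> real) \<Rightarrow> ennreal" where
  "nnint U f \<equiv> \<integral>\<^sup>+x. ennreal (f x) \<partial>lebesgue_on U"

text \<open>
  The situation away from \<open>K\<close>: a positive smooth solution \<open>E\<close> of the homogeneous equation on an open
  set \<open>U\<close>. The exponent \<open>t\<close> is a parameter on which no assumption is made.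
\<close>
locale elliptic_harmonic =
  fixes U :: "(real^'n::finite) set" and A :: "real^'n \<Rightarrow> real^'n^'n" and E :: "real^'n \<Rightarrow> real"
    and c t :: real
  assumes open_U: "open U"
    and A_smooth: "\<And>n i j. Cn n U (\<lambda>x. A x $ i $ j)"
    and A_sym: "\<And>x. x \<in> U \<Longrightarrow> transpose (A x) = A x"
    and c_pos: "c > 0"
    and elliptic: "\<And>x \<xi>. x \<in> U \<Longrightarrow> c * (norm \<xi>)\<^sup>2 \<le> normA_sq A x \<xi>"
    and E_smooth: "\<And>n. Cn n U E"
    and E_pos: "\<And>x. x \<in> U \<Longrightarrow> E x > 0"
    and harmonic: "AE x in lebesgue. x \<in> U \<longrightarrow> div_A_grad A E x = 0"
begin

text \<open>
  The vector field \<open>A \<nabla>E\<close>.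
\<close>
definition flux :: "real^'n \<Rightarrow> real^'n" where
  "flux x = A x *v grad E x"

text \<open>
  The integrand of the energy of a function with gradient \<open>G\<close>.
\<close>
definition energy_density :: "(real^'n \<Rightarrow> real^'n) \<Rightarrow> real^'n \<Rightarrow> real" where
  "energy_density G x = E x powr (2 * t) * normA_sq A x (G x)"

text \<open>
  The integrand of the Hardy term.
\<close>
definition hardy_density :: "(real^'n \<Rightarrow> real) \<Rightarrow> real^'n \<Rightarrow> real" where
  "hardy_density u x = normA_sq A x (grad E x) * E x powr (2 * t - 2) * (u x)\<^sup>2"

text \<open>
  The gradient of \<open>v = E\<^bsup>t - 1/2\<^esup> u\<close>, where \<open>G\<close> is the gradient of \<open>u\<close>.
\<close>
definition transformed_grad :: "(real^'n \<Rightarrow> real) \<Rightarrow> (real^'n \<Rightarrow> real^'n) \<Rightarrow> real^'n \<Rightarrow> real^'n" where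
  "transformed_grad u G x = E x powr (t - 1/2) *\<^sub>R G x + ((t - 1/2) * E x powr (t - 3/2) * u x) *\<^sub>R grad E x"

text \<open>
  The integrand of the remainder, which is \<open>E\<close> times the square of the gradient of \<open>v\<close>.
\<close>
definition remainder_density :: "(real^'n \<Rightarrow> real) \<Rightarrow> (real^'n \<Rightarrow> real^'n) \<Rightarrow> real^'n \<Rightarrow> real" where
  "remainder_density u G x = E x * normA_sq A x (transformed_grad u G x)"

text \<open>
  This is \<open>E\<^bsup>2t - 1\<^esup> A \<nabla>E \<bullet> \<nabla>(u\<^sup>2) + u\<^sup>2 A \<nabla>E \<bullet> \<nabla>(E\<^bsup>2t - 1\<^esup>)\<close>, the divergence of
  \<open>u\<^sup>2 E\<^bsup>2t - 1\<^esup> A \<nabla>E\<close>.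
\<close>
definition cross_term :: "(real^'n \<Rightarrow> real) \<Rightarrow> (real^'n \<Rightarrow> real^'n) \<Rightarrow> real^'n \<Rightarrow> real" where
  "cross_term u G x = 2 * u x * E x powr (2 * t - 1) * (flux x \<bullet> G x) + (2 * t - 1) * hardy_density u x"

lemma A_symmetric: "x \<in> U \<Longrightarrow> (A x *v \<xi>) \<bullet> \<zeta> = (A x *v \<zeta>) \<bullet> \<xi>"
  using A_sym[of x] by (metis dot_lmul_matrix inner_commute transpose_matrix_vector)

lemma normA_nonneg: "x \<in> U \<Longrightarrow> normA_sq A x \<xi> \<ge> 0"
  using elliptic[of x \<xi>] c_pos by (meson less_imp_le mult_nonneg_nonneg order_trans zero_le_power2)

lemma normA_add:
  assumes "x \<in> U"
  shows "normA_sq A x (a *\<^sub>R \<xi> + b *\<^sub>R \<zeta>) = a\<^sup>2 * normA_sq A x \<xi> + 2 * a * b * ((A x *v \<zeta>) \<bullet> \<xi>) + b\<^sup>2 * normA_sq A x \<zeta>"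
proof -
  have "normA_sq A x (a *\<^sub>R \<xi> + b *\<^sub>R \<zeta>) = a * a * ((A x *v \<xi>) \<bullet> \<xi>) + a * b * ((A x *v \<xi>) \<bullet> \<zeta>)
     + a * b * ((A x *v \<zeta>) \<bullet> \<xi>) + b * b * ((A x *v \<zeta>) \<bullet> \<zeta>)"
    unfolding normA_sq_def by (simp add: matrix_vector_right_distrib scaleR_matrix_vector_assoc[symmetric]
        matrix_vector_mult_scaleR inner_add_left inner_add_right algebra_simps)
  then show ?thesis using A_symmetric[OF assms, of \<xi> \<zeta>] by (simp add: normA_sq_def power2_eq_square)
qed

lemma E_powr_smooth: "Cn n U (\<lambda>x. E x powr r)"
  by (rule Cn_compose[OF Cn_powr E_smooth]) (simp add: E_pos)

lemma E_powr_derivative: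
  assumes "x \<in> U"
  shows "((\<lambda>y. E y powr p) has_derivative (\<lambda>h. (p * E x powr (p - 1)) * (grad E x \<bullet> h))) (at x)"
proof -
  have dE: "(E has_derivative (\<lambda>h. grad E x \<bullet> h)) (at x)"
    by (rule has_derivative_grad[OF Cn_differentiable[OF E_smooth assms]])
  have dp: "((\<lambda>y. y powr p) has_derivative (*) (p * E x powr (p - 1))) (at (E x))"
    using has_real_derivative_powr[OF E_pos[OF assms], of p] unfolding has_field_derivative_def .
  show ?thesis using diff_chain_at[OF dE dp] unfolding o_def .
qed

lemma flux_nth: "flux x $ i = (\<Sum>j\<in>UNIV. A x $ i $ j * pd j E x)"
  by (simp add: flux_def matrix_vector_mult_def)

lemma flux_smooth: "Cn n U (\<lambda>x. flux x $ i)"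
  unfolding flux_nth by (intro Cn_sum Cn_mult A_smooth Cn_pd E_smooth open_U)

lemma normA_grad: "normA_sq A x (grad E x) = (\<Sum>i\<in>UNIV. flux x $ i * pd i E x)"
  by (simp add: normA_sq_def flux_def inner_vec_def)

lemma normA_grad_smooth: "Cn n U (\<lambda>x. normA_sq A x (grad E x))"
  unfolding normA_grad by (intro Cn_sum Cn_mult flux_smooth Cn_pd E_smooth open_U)

lemma pointwise_hardy_identity:
  assumes "x \<in> U"
  shows "remainder_density u G x + (t - 1/2)\<^sup>2 * hardy_density u x = energy_density G x + (t - 1/2) * cross_term u G x"
proof -
  have E: "E x > 0" using E_pos[OF assms] .
  have p: "E x * (E x powr (t - 1/2))\<^sup>2 = E x powr (2 * t)"
      "E x * (E x powr (t - 1/2) * E x powr (t - 3/2)) = E x powr (2 * t - 1)"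
      "E x * (E x powr (t - 3/2))\<^sup>2 = E x powr (2 * t - 2)"
    using E by (simp_all add: power2_eq_square powr_mult_base flip: powr_add)
  have alg: "e * (a\<^sup>2 * n1 + 2 * a * (s * b * v) * m + (s * b * v)\<^sup>2 * n2)
      = (e * a\<^sup>2) * n1 + 2 * s * v * (e * (a * b)) * m + s\<^sup>2 * v\<^sup>2 * (e * b\<^sup>2) * n2"
    for e a s b v n1 m n2 :: real
    by (simp add: power2_eq_square algebra_simps)
  have "remainder_density u G x = (E x * (E x powr (t - 1/2))\<^sup>2) * normA_sq A x (G x)
     + 2 * (t - 1/2) * u x * (E x * (E x powr (t - 1/2) * E x powr (t - 3/2))) * (flux x \<bullet> G x)
     + (t - 1/2)\<^sup>2 * (u x)\<^sup>2 * (E x * (E x powr (t - 3/2))\<^sup>2) * normA_sq A x (grad E x)"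
    unfolding remainder_density_def transformed_grad_def normA_add[OF assms] flux_def by (rule alg)
  also have "\<dots> = energy_density G x + 2 * (t - 1/2) * u x * E x powr (2 * t - 1) * (flux x \<bullet> G x) + (t - 1/2)\<^sup>2 * hardy_density u x"
    unfolding p energy_density_def hardy_density_def by (simp add: algebra_simps)
  finally show ?thesis unfolding cross_term_def by (simp add: algebra_simps power2_eq_square)
qed

lemma energy_density_nonneg: "x \<in> U \<Longrightarrow> energy_density G x \<ge> 0"
  and hardy_density_nonneg: "x \<in> U \<Longrightarrow> hardy_density u x \<ge> 0"
  and remainder_density_nonneg: "x \<in> U \<Longrightarrow> remainder_density u G x \<ge> 0"
  using E_pos[of x] by (simp_all add: energy_density_def hardy_density_def remainder_density_def normA_nonneg)

lemma energy_density_lower: "x \<in> U \<Longrightarrow> c * E x powr (2 * t) * (norm (G x))\<^sup>2 \<le> energy_density G x"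
  using mult_left_mono[OF elliptic[of x "G x"], of "E x powr (2 * t)"] by (simp add: energy_density_def mult_ac)

lemma A_measurable: "(\<lambda>x. A x $ i $ j) \<in> borel_measurable (lebesgue_on U)"
  and E_measurable: "E \<in> borel_measurable (lebesgue_on U)"
  and gradE_measurable: "(\<lambda>x. pd i E x) \<in> borel_measurable (lebesgue_on U)"
  by (intro continuous_measurable_on open_U Cn_continuous_on A_smooth E_smooth Cn_pd)+

lemma normA_measurable:
  assumes "\<And>i. (\<lambda>x. G x $ i) \<in> borel_measurable (lebesgue_on U)"
  shows "(\<lambda>x. normA_sq A x (G x)) \<in> borel_measurable (lebesgue_on U)"
  unfolding normA_sq_def inner_vec_def matrix_vector_mult_def inner_real_def vec_lambda_beta
  by (intro borel_measurable_sum borel_measurable_times assms A_measurable)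

lemma powr_measurable: "(\<lambda>x. E x powr r) \<in> borel_measurable (lebesgue_on U)"
  by (intro continuous_measurable_on open_U Cn_continuous_on E_powr_smooth)

lemma energy_density_measurable:
  "(\<And>i. (\<lambda>x. G x $ i) \<in> borel_measurable (lebesgue_on U)) \<Longrightarrow> energy_density G \<in> borel_measurable (lebesgue_on U)"
  unfolding energy_density_def[abs_def] by (intro borel_measurable_times powr_measurable normA_measurable)

lemma hardy_density_measurable:
  "u \<in> borel_measurable (lebesgue_on U) \<Longrightarrow> hardy_density u \<in> borel_measurable (lebesgue_on U)"
  unfolding hardy_density_def[abs_def]
  by (intro borel_measurable_times powr_measurable normA_measurable borel_measurable_power)
     (simp_all add: gradE_measurable)

lemma remainder_density_measurable:
  assumes "u \<in> borel_measurable (lebesgue_on U)" "\<And>i. (\<lambda>x. G x $ i) \<in> borel_measurable (lebesgue_on U)"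
  shows "remainder_density u G \<in> borel_measurable (lebesgue_on U)"
  unfolding remainder_density_def[abs_def] transformed_grad_def
  by (intro borel_measurable_times E_measurable normA_measurable)
     (simp, intro borel_measurable_add borel_measurable_times powr_measurable gradE_measurable borel_measurable_const assms)

lemma cross_term_measurable:
  assumes "u \<in> borel_measurable (lebesgue_on U)" "\<And>i. (\<lambda>x. G x $ i) \<in> borel_measurable (lebesgue_on U)"
  shows "cross_term u G \<in> borel_measurable (lebesgue_on U)"
  unfolding cross_term_def[abs_def] inner_vec_def inner_real_def
  by (intro borel_measurable_add borel_measurable_times borel_measurable_sum borel_measurable_const
      powr_measurable hardy_density_measurable assms continuous_measurable_on[OF open_U] Cn_continuous_on flux_smooth)

text \<open>
  The weak gradient of \<open>\<phi>\<^sup>2\<close> is tested with \<open>E\<^bsup>2t - 1\<^esup> A \<nabla>E\<close>, cut off outside a neighbourhood of the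
  support of \<open>\<phi>\<close>.
\<close>
lemma cross_term_integral:
  assumes \<phi>: "\<phi> \<in> lipschitz_functions U" and \<Gamma>: "has_weak_grad U \<phi> \<Gamma>"
  shows "integrable (lebesgue_on U) (cross_term \<phi> \<Gamma>)" "(\<integral>x. cross_term \<phi> \<Gamma> x \<partial>lebesgue_on U) = 0"
proof -
  obtain L S where L: "L > 0" "L-lipschitz_on UNIV \<phi>" and S: "compact S" "S \<subseteq> U" "\<And>x. x \<notin> S \<Longrightarrow> \<phi> x = 0"
    and c\<phi>: "continuous_on UNIV \<phi>"
    using \<phi> by (rule lipschitz_functionsE) blast
  obtain \<eta> V where \<eta>: "\<eta> \<in> test_functions U" and V: "open V" "S \<subseteq> V" "V \<subseteq> U" "\<And>x. x \<in> V \<Longrightarrow> \<eta> x = 1"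
    using smooth_cutoff[OF S(1) open_U S(2)] by metis
  let ?p = "2 * t - 1"
  let ?b = "\<lambda>i x. E x powr ?p * flux x $ i"
  define \<psi> where "\<psi> i x = (if x \<in> U then ?b i x * \<eta> x else 0)" for i x
  have b: "Cn n U (?b i)" for n i by (intro Cn_mult E_powr_smooth flux_smooth)
  have \<psi>: "\<psi> i \<in> test_functions U" for i
    unfolding \<psi>_def by (rule test_functions_mult_smooth[OF open_U b \<eta>])
  have \<psi>V: "\<psi> i x = ?b i x" if "x \<in> V" for x i using that V by (auto simp: \<psi>_def)
  have pd\<psi>: "pd i (\<psi> i) x = ?p * E x powr (2 * t - 2) * (flux x $ i * pd i E x) + E x powr ?p * pd i (\<lambda>y. flux y $ i) x"
    if x: "x \<in> V" for x i
  proof -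
    have xU: "x \<in> U" using x V by blast
    have E: "E x > 0" using E_pos[OF xU] .
    have d: "(\<lambda>x. E x powr ?p) differentiable (at x)" "(\<lambda>x. flux x $ i) differentiable (at x)" "?b i differentiable (at x)"
      using Cn_differentiable[OF E_powr_smooth xU] Cn_differentiable[OF flux_smooth xU] Cn_differentiable[OF b xU] by blast+
    from has_derivative_pd[OF E_powr_derivative[OF xU, of ?p], of i]
    have p: "pd i (\<lambda>y. E y powr ?p) x = ?p * E x powr (2 * t - 2) * pd i E x" by (simp add: inner_axis)
    have "pd i (\<psi> i) x = pd i (?b i) x"
      by (rule pd_cong[OF V(1) x \<psi>V d(3)])
    also have "\<dots> = ?p * E x powr (2 * t - 2) * pd i E x * flux x $ i + E x powr ?p * pd i (\<lambda>y. flux y $ i) x"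
      unfolding pd_mult[OF d(1,2)] p by simp
    finally show ?thesis by (simp add: mult_ac)
  qed
  have S0: "\<phi> x = 0" if "x \<notin> V" for x using that S(3) V(2) by blast
  have i1: "integrable lebesgue (\<lambda>x. (\<phi> x)\<^sup>2 * pd i (\<psi> i) x)" for i
  proof -
    have "continuous_on UNIV (\<lambda>x. (\<phi> x)\<^sup>2 * pd i (\<psi> i) x)"
      using test_continuous[OF test_functions_pd[OF \<psi>]] c\<phi> by (intro continuous_on_mult continuous_on_power)
    then show ?thesis by (rule continuous_compact_support_integrable[OF _ S(1)]) (simp add: S(3))
  qed
  have i2: "integrable lebesgue (\<lambda>x. \<Gamma> x $ i * (2 * \<phi> x * \<psi> i x))" for i
  proof -
    have cf: "continuous_on UNIV (\<lambda>x. 2 * \<phi> x * \<psi> i x)"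
      using test_continuous[OF \<psi>] c\<phi> by (intro continuous_on_mult continuous_on_const)
    have "compact ((\<lambda>x. 2 * \<phi> x * \<psi> i x) ` S)" using compact_continuous_image[OF continuous_on_subset[OF cf] S(1)] by simp
    then obtain B where "B > 0" "\<forall>y\<in>(\<lambda>x. 2 * \<phi> x * \<psi> i x) ` S. norm y \<le> B"
      using compact_imp_bounded bounded_pos by metis
    then have "\<bar>2 * \<phi> x * \<psi> i x\<bar> \<le> B" for x using S(3)[of x] by (cases "x \<in> S") auto
    then show ?thesis
      by (rule locally_integrable_test[OF has_weak_gradD(2)[OF \<Gamma>] S(1,2) continuous_lebesgue_measurable[OF cf]]) (simp add: S(3))
  qed
  let ?F = "\<lambda>x. (\<Sum>i\<in>UNIV. (\<phi> x)\<^sup>2 * pd i (\<psi> i) x) + (\<Sum>i\<in>UNIV. \<Gamma> x $ i * (2 * \<phi> x * \<psi> i x))"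
  have iF: "integrable lebesgue ?F" by (intro Bochner_Integration.integrable_add Bochner_Integration.integrable_sum i1 i2)
  have F0: "(\<integral>x. ?F x \<partial>lebesgue) = 0"
  proof -
    have "(\<integral>x. ?F x \<partial>lebesgue) = (\<Sum>i\<in>UNIV. (\<integral>x. (\<phi> x)\<^sup>2 * pd i (\<psi> i) x \<partial>lebesgue)) + (\<Sum>i\<in>UNIV. (\<integral>x. \<Gamma> x $ i * (2 * \<phi> x * \<psi> i x) \<partial>lebesgue))"
      using i1 i2 by (simp add: Bochner_Integration.integrable_sum)
    also have "\<dots> = 0" by (simp only: weak_grad_square[OF open_U \<phi> \<Gamma> \<psi>]) (simp add: sum_negf)
    finally show ?thesis .
  qed
  have ae: "AE x in lebesgue. x \<in> U \<longrightarrow> ?F x = cross_term \<phi> \<Gamma> x"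
    using harmonic
  proof eventually_elim
    case (elim x)
    show ?case
    proof
      assume xU: "x \<in> U"
      show "?F x = cross_term \<phi> \<Gamma> x"
      proof (cases "x \<in> V")
        case False
        then show ?thesis using S0[OF False] by (simp add: cross_term_def hardy_density_def)
      next
        case True
        have "div_A_grad A E x = (\<Sum>i\<in>UNIV. pd i (\<lambda>y. flux y $ i) x)"
          by (simp add: div_A_grad_def flux_def)
        then have div0: "(\<Sum>i\<in>UNIV. pd i (\<lambda>y. flux y $ i) x) = 0" using elim xU by simp
        have "(\<Sum>i\<in>UNIV. (\<phi> x)\<^sup>2 * pd i (\<psi> i) x) = (\<Sum>i\<in>UNIV. ((\<phi> x)\<^sup>2 * (?p * E x powr (2 * t - 2))) * (flux x $ i * pd i E x)
           + ((\<phi> x)\<^sup>2 * E x powr ?p) * pd i (\<lambda>y. flux y $ i) x)"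
          unfolding pd\<psi>[OF True] by (intro sum.cong refl) (simp add: distrib_left mult_ac)
        also have "\<dots> = ((\<phi> x)\<^sup>2 * (?p * E x powr (2 * t - 2))) * (\<Sum>i\<in>UNIV. flux x $ i * pd i E x)
           + ((\<phi> x)\<^sup>2 * E x powr ?p) * (\<Sum>i\<in>UNIV. pd i (\<lambda>y. flux y $ i) x)"
          by (simp only: sum.distrib sum_distrib_left)
        also have "\<dots> = ?p * hardy_density \<phi> x" unfolding div0 hardy_density_def normA_grad by simp
        finally have 1: "(\<Sum>i\<in>UNIV. (\<phi> x)\<^sup>2 * pd i (\<psi> i) x) = ?p * hardy_density \<phi> x" .
        have 2: "(\<Sum>i\<in>UNIV. \<Gamma> x $ i * (2 * \<phi> x * \<psi> i x)) = 2 * \<phi> x * E x powr ?p * (flux x \<bullet> \<Gamma> x)"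
          unfolding \<psi>V[OF True] inner_vec_def inner_real_def by (simp add: sum_distrib_left algebra_simps)
        show ?thesis unfolding 1 2 cross_term_def by simp
      qed
    qed
  qed
  have mU: "U \<inter> space lebesgue \<in> sets lebesgue" using open_U by simp
  have F_eq: "indicator U x *\<^sub>R ?F x = ?F x" for x
  proof (cases "x \<in> U")
    case False
    then have "\<phi> x = 0" using V(3) by (intro S0) blast
    then show ?thesis by simp
  qed simp
  have iU: "integrable (lebesgue_on U) ?F"
    unfolding integrable_restrict_space[OF mU] F_eq by (rule iF)
  have FU0: "(\<integral>x. ?F x \<partial>lebesgue_on U) = 0"
    unfolding integral_restrict_space[OF mU] F_eq by (rule F0)
  have m: "\<phi> \<in> borel_measurable (lebesgue_on U)" "\<And>i. (\<lambda>x. \<Gamma> x $ i) \<in> borel_measurable (lebesgue_on U)"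
    using has_weak_gradD(1,2)[OF \<Gamma>] locally_integrable_measurable[OF open_U] by auto
  have mc: "cross_term \<phi> \<Gamma> \<in> borel_measurable (lebesgue_on U)" using m by (rule cross_term_measurable)
  have aeU: "AE x in lebesgue_on U. ?F x = cross_term \<phi> \<Gamma> x"
    unfolding AE_restrict_space_iff[OF mU] by (rule ae)
  show "integrable (lebesgue_on U) (cross_term \<phi> \<Gamma>)"
    using integrable_cong_AE[OF borel_measurable_integrable[OF iU] mc aeU] iU by blast
  show "(\<integral>x. cross_term \<phi> \<Gamma> x \<partial>lebesgue_on U) = 0"
    using integral_cong_AE[OF borel_measurable_integrable[OF iU] mc aeU] FU0 by simp
qed

lemma hardy_identity:
  assumes \<phi>: "\<phi> \<in> lipschitz_functions U" and \<Gamma>: "has_weak_grad U \<phi> \<Gamma>"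
  shows "nnint U (\<lambda>x. remainder_density \<phi> \<Gamma> x + (t - 1/2)\<^sup>2 * hardy_density \<phi> x) = nnint U (energy_density \<Gamma>)"
proof (rule nn_integral_eq_of_integrable_diff[where z = "\<lambda>x. (t - 1/2) * cross_term \<phi> \<Gamma> x"])
  have m: "\<phi> \<in> borel_measurable (lebesgue_on U)" "\<And>i. (\<lambda>x. \<Gamma> x $ i) \<in> borel_measurable (lebesgue_on U)"
    using has_weak_gradD(1,2)[OF \<Gamma>] locally_integrable_measurable[OF open_U] by auto
  show "energy_density \<Gamma> \<in> borel_measurable (lebesgue_on U)" using m(2) by (rule energy_density_measurable)
  show "(\<lambda>x. remainder_density \<phi> \<Gamma> x + (t - 1/2)\<^sup>2 * hardy_density \<phi> x) \<in> borel_measurable (lebesgue_on U)"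
    by (intro borel_measurable_add borel_measurable_times borel_measurable_const remainder_density_measurable hardy_density_measurable m)
  show "integrable (lebesgue_on U) (\<lambda>x. (t - 1/2) * cross_term \<phi> \<Gamma> x)"
    by (intro integrable_mult_right cross_term_integral \<phi> \<Gamma>)
  show "(\<integral>x. (t - 1/2) * cross_term \<phi> \<Gamma> x \<partial>lebesgue_on U) = 0"
    using cross_term_integral(2)[OF \<phi> \<Gamma>] by simp
  fix x assume "x \<in> space (lebesgue_on U)"
  then have x: "x \<in> U" by simp
  show "0 \<le> remainder_density \<phi> \<Gamma> x + (t - 1/2)\<^sup>2 * hardy_density \<phi> x" "0 \<le> energy_density \<Gamma> x"
    using x by (auto intro!: add_nonneg_nonneg mult_nonneg_nonneg remainder_density_nonneg hardy_density_nonneg energy_density_nonneg)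
  show "remainder_density \<phi> \<Gamma> x + (t - 1/2)\<^sup>2 * hardy_density \<phi> x = energy_density \<Gamma> x + (t - 1/2) * cross_term \<phi> \<Gamma> x"
    using x by (rule pointwise_hardy_identity)
qed

text \<open>
  The bound of the weak gradient by the Lipschitz constant makes the energy finite; the definition of
  weak gradients alone only makes them locally integrable.
\<close>
lemma energy_finite:
  assumes \<phi>: "\<phi> \<in> lipschitz_functions U" and \<Gamma>: "has_weak_grad U \<phi> \<Gamma>"
  shows "nnint U (energy_density \<Gamma>) < \<infinity>"
proof -
  obtain L S where L: "L > 0" "L-lipschitz_on UNIV \<phi>" and S: "compact S" "S \<subseteq> U" "\<And>x. x \<notin> S \<Longrightarrow> \<phi> x = 0"
    using \<phi> by (rule lipschitz_functionsE) blast
  let ?B = "\<lambda>x. E x powr (2 * t) * (\<Sum>i\<in>UNIV. \<Sum>j\<in>UNIV. \<bar>A x $ i $ j\<bar> * L * L)"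
  have cB: "continuous_on U ?B"
    by (intro continuous_intros Cn_continuous_on E_powr_smooth A_smooth)
  have "AE x in lebesgue. \<forall>i. x \<in> U \<longrightarrow> \<bar>\<Gamma> x $ i\<bar> \<le> L"
    using weak_grad_bounded[OF open_U \<phi> \<Gamma> L(2)] by (simp only: AE_all_countable) simp
  moreover have "AE x in lebesgue. \<forall>i. x \<in> U - S \<longrightarrow> \<Gamma> x $ i = 0"
    using weak_grad_zero_outside_support[OF open_U \<Gamma> compact_imp_closed[OF S(1)] S(3)] by (simp only: AE_all_countable) simp
  ultimately have ae: "AE x in lebesgue. x \<in> U \<longrightarrow> energy_density \<Gamma> x \<le> indicator S x *\<^sub>R ?B x"
  proof eventually_elim
    case (elim x)
    show ?case
    proof
      assume x: "x \<in> U"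
      show "energy_density \<Gamma> x \<le> indicator S x *\<^sub>R ?B x"
      proof (cases "x \<in> S")
        case True
        have "normA_sq A x (\<Gamma> x) = (\<Sum>i\<in>UNIV. \<Sum>j\<in>UNIV. A x $ i $ j * \<Gamma> x $ j * \<Gamma> x $ i)"
          unfolding normA_sq_def inner_vec_def matrix_vector_mult_def by (simp add: sum_distrib_right)
        also have "\<dots> \<le> (\<Sum>i\<in>UNIV. \<Sum>j\<in>UNIV. \<bar>A x $ i $ j\<bar> * L * L)"
        proof (intro sum_mono)
          fix i j
          have "A x $ i $ j * \<Gamma> x $ j * \<Gamma> x $ i \<le> \<bar>A x $ i $ j\<bar> * \<bar>\<Gamma> x $ j\<bar> * \<bar>\<Gamma> x $ i\<bar>"
            by (metis abs_ge_self abs_mult)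
          also have "\<dots> \<le> \<bar>A x $ i $ j\<bar> * L * L" using elim(1) x L(1) by (intro mult_mono) auto
          finally show "A x $ i $ j * \<Gamma> x $ j * \<Gamma> x $ i \<le> \<bar>A x $ i $ j\<bar> * L * L" .
        qed
        finally show ?thesis using True by (simp add: energy_density_def mult_left_mono)
      next
        case False
        then have "\<Gamma> x = 0" using elim(2) x by (simp add: vec_eq_iff)
        then show ?thesis using False by (simp add: energy_density_def normA_sq_def)
      qed
    qed
  qed
  have iB: "integrable lebesgue (\<lambda>x. indicator S x *\<^sub>R ?B x)"
    using continuous_locally_integrable[OF cB] S(1,2) by (rule set_integrable_compact)
  have "nnint U (energy_density \<Gamma>) = (\<integral>\<^sup>+x. ennreal (energy_density \<Gamma> x) * indicator U x \<partial>lebesgue)"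
    using open_U by (simp add: nn_integral_restrict_space)
  also have "\<dots> \<le> (\<integral>\<^sup>+x. ennreal (norm (indicator S x *\<^sub>R ?B x)) \<partial>lebesgue)"
    by (rule nn_integral_mono_AE) (use ae in \<open>eventually_elim, auto intro!: ennreal_leI split: split_indicator\<close>)
  also have "\<dots> < \<infinity>" using iB unfolding integrable_iff_bounded by simp
  finally show ?thesis .
qed

end

section \<open>Convergence in mean and the energy\<close>

lemma AE_summable_of_nn_integrals:
  fixes f :: "nat \<Rightarrow> 'a \<Rightarrow> real"
  assumes [measurable]: "\<And>k. f k \<in> borel_measurable M" and nn: "\<And>k x. x \<in> space M \<Longrightarrow> 0 \<le> f k x"
    and le: "\<And>k. (\<integral>\<^sup>+x. ennreal (f k x) \<partial>M) \<le> ennreal (r k)" and r: "\<And>k. 0 \<le> r k" "summable r"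
  shows "AE x in M. summable (\<lambda>k. f k x)"
proof -
  have "(\<integral>\<^sup>+x. (\<Sum>k. ennreal (f k x)) \<partial>M) = (\<Sum>k. \<integral>\<^sup>+x. ennreal (f k x) \<partial>M)"
    by (rule nn_integral_suminf) simp
  also have "\<dots> \<le> (\<Sum>k. ennreal (r k))" by (intro suminf_le le) auto
  also have "\<dots> = ennreal (suminf r)" using r by (intro suminf_ennreal2) auto
  also have "\<dots> < \<infinity>" by simp
  finally have "AE x in M. (\<Sum>k. ennreal (f k x)) \<noteq> \<infinity>"
    by (intro nn_integral_PInf_AE) auto
  then show ?thesis
  proof (rule AE_mp, intro AE_I2 impI)
    fix x assume "x \<in> space M" "(\<Sum>k. ennreal (f k x)) \<noteq> \<infinity>"
    then show "summable (\<lambda>k. f k x)" using nn by (intro summable_suminf_not_top) auto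
  qed
qed

lemma nn_integral_fatou:
  fixes f :: "nat \<Rightarrow> 'a \<Rightarrow> real"
  assumes "\<And>k. f k \<in> borel_measurable M" "AE x in M. (\<lambda>k. f k x) \<longlonglongrightarrow> g x"
  shows "(\<integral>\<^sup>+x. ennreal (g x) \<partial>M) \<le> liminf (\<lambda>k. \<integral>\<^sup>+x. ennreal (f k x) \<partial>M)"
proof -
  have "(\<integral>\<^sup>+x. ennreal (g x) \<partial>M) = (\<integral>\<^sup>+x. liminf (\<lambda>k. ennreal (f k x)) \<partial>M)"
  proof (rule nn_integral_cong_AE)
    show "AE x in M. ennreal (g x) = liminf (\<lambda>k. ennreal (f k x))"
      using assms(2)
    proof eventually_elim
      case (elim x)
      have "(\<lambda>k. ennreal (f k x)) \<longlonglongrightarrow> ennreal (g x)" by (rule tendsto_ennrealI[OF elim])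
      then show ?case by (rule lim_imp_Liminf[OF sequentially_bot, symmetric])
    qed
  qed
  also have "\<dots> \<le> liminf (\<lambda>k. \<integral>\<^sup>+x. ennreal (f k x) \<partial>M)"
    using assms(1) by (intro nn_integral_liminf) simp
  finally show ?thesis .
qed

text \<open>
  Follows from \<open>2 d \<le> 2\<^sup>k d\<^sup>2 + 2\<^bsup>- k\<^esup>\<close>, where \<open>d\<close> is the norm of the \<open>k\<close>th increment.
\<close>
lemma convergent_of_summable_increments:
  fixes a :: "nat \<Rightarrow> 'a::banach"
  assumes "w > 0" "summable (\<lambda>k. g k)" "\<And>k. 2 ^ k * (w * (norm (a (Suc k) - a k))\<^sup>2) \<le> g k"
  shows "\<exists>l. a \<longlonglongrightarrow> l"
proof -
  have bound: "norm (a (Suc k) - a k) \<le> g k / w + (1/2) ^ k" for k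
  proof -
    let ?d = "norm (a (Suc k) - a k)"
    have p: "(2::real) ^ k * (1/2) ^ k = 1" by (simp add: power_mult_distrib[symmetric])
    have "0 \<le> 2 ^ k * (?d - (1/2) ^ k)\<^sup>2" by simp
    also have "\<dots> = 2 ^ k * ?d\<^sup>2 - 2 * ?d * (2 ^ k * (1/2) ^ k) + (2 ^ k * (1/2) ^ k) * (1/2) ^ k"
      by (simp only: power2_eq_square) (simp add: algebra_simps)
    finally have "2 * ?d \<le> 2 ^ k * ?d\<^sup>2 + (1/2) ^ k" unfolding p by simp
    moreover have "2 ^ k * ?d\<^sup>2 \<le> g k / w"
      using assms(3)[of k] assms(1) by (simp add: pos_le_divide_eq mult_ac)
    ultimately show ?thesis using norm_ge_zero[of "a (Suc k) - a k"] by linarith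
  qed
  have "summable (\<lambda>k. g k / w + (1/2) ^ k)"
    by (intro summable_add summable_divide assms(2) summable_geometric) simp
  then have "summable (\<lambda>k. a (Suc k) - a k)"
    by (rule summable_comparison_test'[where N = 0]) (rule bound)
  then obtain s where "(\<lambda>n. \<Sum>k<n. a (Suc k) - a k) \<longlonglongrightarrow> s"
    by (auto simp: summable_def sums_def)
  then have "(\<lambda>n. (\<Sum>k<n. a (Suc k) - a k) + a 0) \<longlonglongrightarrow> s + a 0" by (intro tendsto_add tendsto_const)
  then show ?thesis unfolding sum_lessThan_telescope by auto
qed

lemma integral_test_tendsto:
  fixes f :: "real^'n::finite \<Rightarrow> real"
  assumes fk: "\<And>k::nat. locally_integrable U (fk k)" and f: "locally_integrable U f" and w: "w \<in> test_functions U"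
    and conv: "\<And>C. compact C \<Longrightarrow> C \<subseteq> U \<Longrightarrow> (\<lambda>k. \<integral>\<^sup>+x\<in>C. ennreal \<bar>fk k x - f x\<bar> \<partial>lebesgue) \<longlonglongrightarrow> 0"
  shows "(\<lambda>k. LINT x:U|lebesgue. fk k x * w x) \<longlonglongrightarrow> (LINT x:U|lebesgue. f x * w x)"
proof -
  obtain S where S: "compact S" "S \<subseteq> U" "\<And>x. x \<notin> S \<Longrightarrow> w x = 0" using w by (rule test_functionsE) blast
  obtain b where b: "\<And>x. \<bar>w x\<bar> \<le> b" "b > 0" using test_bounded[OF w] by blast
  note r = integrable_mult_test(2)[OF _ w] and i = integrable_mult_test(1)[OF _ w]
  have iS: "integrable lebesgue (\<lambda>x. indicator S x *\<^sub>R \<bar>fk k x - f x\<bar>)" for k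
  proof -
    have "integrable lebesgue (\<lambda>x. \<bar>indicator S x *\<^sub>R fk k x - indicator S x *\<^sub>R f x\<bar>)"
      by (intro integrable_abs Bochner_Integration.integrable_diff set_integrable_compact[OF fk S(1,2)] set_integrable_compact[OF f S(1,2)])
    moreover have "\<bar>indicator S x *\<^sub>R fk k x - indicator S x *\<^sub>R f x\<bar> = indicator S x *\<^sub>R \<bar>fk k x - f x\<bar>" for x
      by (auto split: split_indicator)
    ultimately show ?thesis by simp
  qed
  have "(\<lambda>k. b * (\<integral>x. indicator S x *\<^sub>R \<bar>fk k x - f x\<bar> \<partial>lebesgue)) \<longlonglongrightarrow> b * 0"
  proof (intro tendsto_mult tendsto_const)
    have "(\<integral>\<^sup>+x\<in>S. ennreal \<bar>fk k x - f x\<bar> \<partial>lebesgue) = ennreal (\<integral>x. indicator S x *\<^sub>R \<bar>fk k x - f x\<bar> \<partial>lebesgue)" for k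
    proof -
      have "(\<integral>\<^sup>+x\<in>S. ennreal \<bar>fk k x - f x\<bar> \<partial>lebesgue) = (\<integral>\<^sup>+x. ennreal (indicator S x *\<^sub>R \<bar>fk k x - f x\<bar>) \<partial>lebesgue)"
        by (intro nn_integral_cong) (auto split: split_indicator)
      also have "\<dots> = ennreal (\<integral>x. indicator S x *\<^sub>R \<bar>fk k x - f x\<bar> \<partial>lebesgue)"
        by (rule nn_integral_eq_integral[OF iS]) auto
      finally show ?thesis .
    qed
    then have "(\<lambda>k. ennreal (\<integral>x. indicator S x *\<^sub>R \<bar>fk k x - f x\<bar> \<partial>lebesgue)) \<longlonglongrightarrow> ennreal 0"
      using conv[OF S(1,2)] by simp
    then show "(\<lambda>k. (\<integral>x. indicator S x *\<^sub>R \<bar>fk k x - f x\<bar> \<partial>lebesgue)) \<longlonglongrightarrow> 0"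
      by (rule tendsto_ennrealD) (auto intro!: always_eventually integral_nonneg_AE)
  qed
  then have lim: "(\<lambda>k. b * (\<integral>x. indicator S x *\<^sub>R \<bar>fk k x - f x\<bar> \<partial>lebesgue)) \<longlonglongrightarrow> 0" by simp
  have "(\<lambda>k. (\<integral>x. fk k x * w x \<partial>lebesgue) - (\<integral>x. f x * w x \<partial>lebesgue)) \<longlonglongrightarrow> 0"
  proof (rule Lim_null_comparison[OF always_eventually lim], rule allI)
    fix k
    have "(\<integral>x. fk k x * w x \<partial>lebesgue) - (\<integral>x. f x * w x \<partial>lebesgue) = (\<integral>x. (fk k x - f x) * w x \<partial>lebesgue)"
      using i[OF fk] i[OF f] by (simp add: left_diff_distrib)
    also have "norm \<dots> \<le> (\<integral>x. \<bar>(fk k x - f x) * w x\<bar> \<partial>lebesgue)"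
      unfolding real_norm_def by (rule integral_abs_bound)
    also have "\<dots> \<le> (\<integral>x. b * (indicator S x *\<^sub>R \<bar>fk k x - f x\<bar>) \<partial>lebesgue)"
    proof (rule integral_mono)
      show "integrable lebesgue (\<lambda>x. \<bar>(fk k x - f x) * w x\<bar>)"
        using Bochner_Integration.integrable_diff[OF i[OF fk] i[OF f]] by (intro integrable_abs) (simp add: left_diff_distrib)
      show "integrable lebesgue (\<lambda>x. b * (indicator S x *\<^sub>R \<bar>fk k x - f x\<bar>))" using iS by (rule integrable_mult_right)
      fix x
      show "\<bar>(fk k x - f x) * w x\<bar> \<le> b * (indicator S x *\<^sub>R \<bar>fk k x - f x\<bar>)"
        using mult_left_mono[OF b(1)[of x], of "\<bar>fk k x - f x\<bar>"] S(3)[of x]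
        by (cases "x \<in> S") (auto simp: abs_mult mult.commute)
    qed
    also have "\<dots> = b * (\<integral>x. indicator S x *\<^sub>R \<bar>fk k x - f x\<bar> \<partial>lebesgue)" by (rule integral_mult_right_zero)
    finally show "norm ((\<integral>x. fk k x * w x \<partial>lebesgue) - (\<integral>x. f x * w x \<partial>lebesgue)) \<le> b * (\<integral>x. indicator S x *\<^sub>R \<bar>fk k x - f x\<bar> \<partial>lebesgue)" .
  qed
  then show ?thesis unfolding r[OF fk] r[OF f] by (rule LIM_zero_cancel)
qed

lemma weak_grad_unique:
  assumes U: "open U" and G: "has_weak_grad U u G" and H: "has_weak_grad U u H"
  shows "AE x in lebesgue. x \<in> U \<longrightarrow> G x = H x"
proof -
  have "AE x in lebesgue. x \<in> U \<longrightarrow> G x $ i - H x $ i = 0" for i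
  proof (rule du_bois_reymond[OF U])
    note G' = has_weak_gradD(2)[OF G, of i] and H' = has_weak_gradD(2)[OF H, of i]
    show li: "locally_integrable U (\<lambda>x. G x $ i - H x $ i)"
      using G' H' unfolding locally_integrable_def by auto
    fix \<psi> assume \<psi>: "\<psi> \<in> test_functions U"
    have "(\<integral>x. G x $ i * \<psi> x \<partial>lebesgue) = (\<integral>x. H x $ i * \<psi> x \<partial>lebesgue)"
      using has_weak_gradD(3)[OF G \<psi>, of i] has_weak_gradD(3)[OF H \<psi>, of i]
      by (simp add: integrable_mult_test(2)[OF G' \<psi>] integrable_mult_test(2)[OF H' \<psi>])
    then show "(LINT x:U|lebesgue. (G x $ i - H x $ i) * \<psi> x) = 0"
      unfolding integrable_mult_test(2)[OF li \<psi>]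
      using integrable_mult_test(1)[OF G' \<psi>] integrable_mult_test(1)[OF H' \<psi>] by (simp add: left_diff_distrib)
  qed
  then have "AE x in lebesgue. \<forall>i. x \<in> U \<longrightarrow> G x $ i - H x $ i = 0" by (simp only: AE_all_countable) simp
  then show ?thesis by eventually_elim (simp add: vec_eq_iff)
qed

context elliptic_harmonic
begin

lemma tendsto_normA:
  assumes "(\<lambda>k. \<xi> k) \<longlonglongrightarrow> \<zeta>"
  shows "(\<lambda>k. normA_sq A x (\<xi> k)) \<longlonglongrightarrow> normA_sq A x \<zeta>"
  unfolding normA_sq_def inner_vec_def matrix_vector_mult_def inner_real_def vec_lambda_beta
  by (intro tendsto_intros assms)

lemma normA_add_le:
  assumes "x \<in> U" "\<delta> > 0"
  shows "normA_sq A x (\<xi> + \<zeta>) \<le> (1 + \<delta>) * normA_sq A x \<xi> + (1 + 1 / \<delta>) * normA_sq A x \<zeta>"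
proof -
  have "0 \<le> normA_sq A x (\<delta> *\<^sub>R \<xi> + (-1) *\<^sub>R \<zeta>)" by (rule normA_nonneg[OF assms(1)])
  then have "2 * \<delta> * ((A x *v \<zeta>) \<bullet> \<xi>) \<le> \<delta>\<^sup>2 * normA_sq A x \<xi> + normA_sq A x \<zeta>"
    unfolding normA_add[OF assms(1)] by simp
  then have "2 * ((A x *v \<zeta>) \<bullet> \<xi>) \<le> \<delta> * normA_sq A x \<xi> + normA_sq A x \<zeta> / \<delta>"
    using assms(2) by (simp add: field_simps power2_eq_square)
  then show ?thesis using normA_add[OF assms(1), of 1 \<xi> 1 \<zeta>] by (simp add: algebra_simps)
qed

lemma energy_density_add_le:
  assumes "x \<in> U" "\<delta> > 0"
  shows "energy_density G x \<le> (1 + \<delta>) * energy_density H x + (1 + 1 / \<delta>) * energy_density (\<lambda>x. G x - H x) x"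
  using mult_left_mono[OF normA_add_le[OF assms, of "H x" "G x - H x"], of "E x powr (2 * t)"]
  by (simp add: energy_density_def algebra_simps)

lemma energy_add_le:
  assumes "\<And>i. (\<lambda>x. G x $ i) \<in> borel_measurable (lebesgue_on U)" "\<And>i. (\<lambda>x. H x $ i) \<in> borel_measurable (lebesgue_on U)" "\<delta> > 0"
  shows "nnint U (energy_density G) \<le> ennreal (1 + \<delta>) * nnint U (energy_density H)
    + ennreal (1 + 1 / \<delta>) * nnint U (energy_density (\<lambda>x. G x - H x))"
proof -
  have m: "energy_density H \<in> borel_measurable (lebesgue_on U)" "energy_density (\<lambda>x. G x - H x) \<in> borel_measurable (lebesgue_on U)"
    using assms by (auto intro!: energy_density_measurable)
  have "nnint U (energy_density G) \<le> (\<integral>\<^sup>+x. ennreal (1 + \<delta>) * ennreal (energy_density H x) + ennreal (1 + 1 / \<delta>) * ennreal (energy_density (\<lambda>x. G x - H x) x) \<partial>lebesgue_on U)"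
  proof (rule nn_integral_mono)
    fix x assume "x \<in> space (lebesgue_on U)"
    then have x: "x \<in> U" by simp
    show "ennreal (energy_density G x) \<le> ennreal (1 + \<delta>) * ennreal (energy_density H x) + ennreal (1 + 1 / \<delta>) * ennreal (energy_density (\<lambda>x. G x - H x) x)"
      using energy_density_add_le[OF x assms(3)] energy_density_nonneg[OF x] assms(3)
      by (simp add: ennreal_mult[symmetric] ennreal_plus[symmetric] del: ennreal_plus)
  qed
  also have "\<dots> = ennreal (1 + \<delta>) * nnint U (energy_density H)
    + ennreal (1 + 1 / \<delta>) * nnint U (energy_density (\<lambda>x. G x - H x))"
    using m by (simp add: nn_integral_add nn_integral_cmult)
  finally show ?thesis .
qed

text \<open>
  On a compact set the weight of the energy is bounded below, so a small energy forces a small integral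
  of the norm.
\<close>
lemma L1_bound_by_energy:
  assumes C: "compact C" "C \<subseteq> U"
  obtains K where "K \<ge> 0" "\<And>H k. (\<And>i. (\<lambda>x. H x $ i) \<in> borel_measurable (lebesgue_on U)) \<Longrightarrow>
    nnint U (energy_density H) \<le> ennreal ((1/4) ^ k) \<Longrightarrow>
    (\<integral>\<^sup>+x\<in>C. ennreal (norm (H x)) \<partial>lebesgue) \<le> ennreal ((1/2) ^ k * K)"
proof -
  have "continuous_on C (\<lambda>x. c * E x powr (2 * t))"
    using continuous_on_subset[OF Cn_continuous_on[OF E_powr_smooth] C(2)] by (intro continuous_on_mult continuous_on_const)
  then obtain w where w: "w > 0" "\<And>x. x \<in> C \<Longrightarrow> w \<le> c * E x powr (2 * t)"
  proof (cases "C = {}")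
    case False
    then obtain y where y: "y \<in> C" "\<forall>x\<in>C. c * E y powr (2 * t) \<le> c * E x powr (2 * t)"
      using continuous_attains_inf[OF C(1) False \<open>continuous_on C _\<close>] by blast
    moreover have "c * E y powr (2 * t) > 0" using y(1) C(2) E_pos[of y] c_pos by auto
    ultimately show ?thesis using that by blast
  qed (use that[of 1] in auto)
  define m where "m = measure lebesgue C"
  have mC: "C \<in> lmeasurable" using C(1) by (rule lmeasurable_compact)
  show ?thesis
  proof (rule that[of "m + 1 / w"])
    show "m + 1 / w \<ge> 0" using w(1) by (simp add: m_def)
    fix H :: "real^'n \<Rightarrow> real^'n" and k
    assume H: "\<And>i. (\<lambda>x. H x $ i) \<in> borel_measurable (lebesgue_on U)"
      and le: "nnint U (energy_density H) \<le> ennreal ((1/4) ^ k)"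
    have mU: "U \<inter> space lebesgue \<in> sets lebesgue" using open_U by simp
    have "(\<integral>\<^sup>+x\<in>C. ennreal (norm (H x)) \<partial>lebesgue) = (\<integral>\<^sup>+x. ennreal (norm (H x)) * indicator C x \<partial>lebesgue_on U)"
      unfolding nn_integral_restrict_space[OF mU] using C(2)
      by (intro nn_integral_cong) (auto split: split_indicator)
    also have "\<dots> \<le> (\<integral>\<^sup>+x. ennreal ((1/2) ^ k) * indicator C x + ennreal (2 ^ k / w) * ennreal (energy_density H x) \<partial>lebesgue_on U)"
    proof (rule nn_integral_mono)
      fix x assume "x \<in> space (lebesgue_on U)"
      then have x: "x \<in> U" by simp
      show "ennreal (norm (H x)) * indicator C x \<le> ennreal ((1/2) ^ k) * indicator C x + ennreal (2 ^ k / w) * ennreal (energy_density H x)"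
      proof (cases "x \<in> C")
        case True
        let ?d = "norm (H x)"
        have p: "(2::real) ^ k * (1/2) ^ k = 1" by (simp add: power_mult_distrib[symmetric])
        have "0 \<le> 2 ^ k * (?d - (1/2) ^ k)\<^sup>2" by simp
        also have "\<dots> = 2 ^ k * ?d\<^sup>2 - 2 * ?d * (2 ^ k * (1/2) ^ k) + (2 ^ k * (1/2) ^ k) * (1/2) ^ k"
          by (simp only: power2_eq_square) (simp add: algebra_simps)
        finally have 1: "2 * ?d \<le> 2 ^ k * ?d\<^sup>2 + (1/2) ^ k" unfolding p by simp
        have "w * ?d\<^sup>2 \<le> energy_density H x"
          using mult_right_mono[OF w(2)[OF True], of "?d\<^sup>2"] energy_density_lower[OF x, of H] by simp
        then have "?d\<^sup>2 \<le> energy_density H x / w" using w(1) by (simp add: field_simps)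
        then have "2 ^ k * ?d\<^sup>2 \<le> 2 ^ k * (energy_density H x / w)" by (intro mult_left_mono) auto
        moreover have "2 ^ k * (energy_density H x / w) = 2 ^ k / w * energy_density H x" by simp
        ultimately have "?d \<le> (1/2) ^ k + 2 ^ k / w * energy_density H x" using 1 norm_ge_zero[of "H x"] by linarith
        then show ?thesis using True energy_density_nonneg[OF x, of H] w(1)
          by (simp add: ennreal_mult[symmetric] ennreal_plus[symmetric] del: ennreal_plus)
      qed simp
    qed
    also have "\<dots> = ennreal ((1/2) ^ k) * emeasure (lebesgue_on U) C + ennreal (2 ^ k / w) * nnint U (energy_density H)"
    proof -
      have "C \<in> sets (lebesgue_on U)" using mC C(2) open_U by (auto simp: sets_restrict_space_iff fmeasurable_def)
      then show ?thesis using energy_density_measurable[OF H] by (simp add: nn_integral_add nn_integral_cmult nn_integral_cmult_indicator)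
    qed
    also have "emeasure (lebesgue_on U) C = ennreal m"
    proof -
      have "emeasure (lebesgue_on U) C = emeasure lebesgue C" using C(2) open_U by (intro emeasure_restrict_space) auto
      also have "\<dots> = ennreal m" unfolding m_def using mC by (intro emeasure_eq_measure2)
      finally show ?thesis .
    qed
    also have "ennreal ((1/2) ^ k) * ennreal m + ennreal (2 ^ k / w) * nnint U (energy_density H)
      \<le> ennreal ((1/2) ^ k) * ennreal m + ennreal (2 ^ k / w) * ennreal ((1/4) ^ k)"
      by (intro add_left_mono mult_left_mono le) auto
    also have "\<dots> = ennreal ((1/2) ^ k * m + 2 ^ k / w * (1/4) ^ k)"
      using w(1) by (simp add: ennreal_mult[symmetric] ennreal_plus[symmetric] m_def del: ennreal_plus)
    also have "(1/2) ^ k * m + 2 ^ k / w * (1/4) ^ k = (1/2) ^ k * (m + 1 / w)"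
    proof -
      have "(2::real) ^ k * (1/4) ^ k = (1/2) ^ k" by (simp add: power_mult_distrib[symmetric])
      then show ?thesis by (simp add: field_simps)
    qed
    finally show "(\<integral>\<^sup>+x\<in>C. ennreal (norm (H x)) \<partial>lebesgue) \<le> ennreal ((1/2) ^ k * (m + 1 / w))" .
  qed
qed

end

section \<open>The Hardy inequality with remainder in the completion\<close>

lemma has_weak_grad_diff_measurable:
  assumes "open U" "has_weak_grad U f F" "has_weak_grad U g H"
  shows "(\<lambda>x. (F x - H x) $ i) \<in> borel_measurable (lebesgue_on U)"
  using locally_integrable_measurable[OF assms(1) has_weak_gradD(2)[OF assms(2)]]
    locally_integrable_measurable[OF assms(1) has_weak_gradD(2)[OF assms(3)]] by simp

context elliptic_harmonic
begin

lemma energy_density_diff_commute: "energy_density (\<lambda>x. F x - G x) = energy_density (\<lambda>x. G x - F x)"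
proof
  fix x
  have "A x *v (F x - G x) = (-1) *\<^sub>R (A x *v (G x - F x))"
    by (simp add: matrix_vector_mult_scaleR[symmetric] matrix_vector_mult_diff_distrib)
  then show "energy_density (\<lambda>x. F x - G x) x = energy_density (\<lambda>x. G x - F x) x"
    unfolding energy_density_def normA_sq_def by (simp add: inner_diff_right)
qed

text \<open>
  The elements of the completion have a weak gradient of finite energy, and the Hardy identity survives
  as an inequality with remainder. The limits are taken along a subsequence that converges so fast
  that functions and gradients converge almost everywhere.
\<close>
lemma hardy_remainder_closure:
  assumes u: "locally_integrable U u"
    and \<phi>: "\<And>m::nat. \<phi> m \<in> lipschitz_functions U" and \<Gamma>: "\<And>m. has_weak_grad U (\<phi> m) (\<Gamma> m)"
    and cauchy: "\<And>\<epsilon>. \<epsilon> > 0 \<Longrightarrow> \<exists>N. \<forall>m\<ge>N. \<forall>k\<ge>N. nnint U (energy_density (\<lambda>x. \<Gamma> m x - \<Gamma> k x)) < ennreal \<epsilon>"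
    and conv: "\<And>C. compact C \<Longrightarrow> C \<subseteq> U \<Longrightarrow> (\<lambda>m. \<integral>\<^sup>+x\<in>C. ennreal \<bar>\<phi> m x - u x\<bar> \<partial>lebesgue) \<longlonglongrightarrow> 0"
  obtains G where "has_weak_grad U u G" "nnint U (energy_density G) < \<infinity>"
    "nnint U (\<lambda>x. remainder_density u G x + (t - 1/2)\<^sup>2 * hardy_density u x) \<le> nnint U (energy_density G)"
proof -
  let ?M = "lebesgue_on U"
  have mU: "U \<inter> space lebesgue \<in> sets lebesgue" using open_U by simp
  obtain C :: "nat \<Rightarrow> (real^'n) set" where C: "\<forall>n. compact (C n)" "\<forall>n. C n \<subseteq> U"
    "\<forall>K. compact K \<longrightarrow> K \<subseteq> U \<longrightarrow> (\<exists>N. \<forall>n\<ge>N. K \<subseteq> C n)"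
    using compact_exhaustion[OF open_U] by blast
  define I where "I m l = nnint U (energy_density (\<lambda>x. \<Gamma> m x - \<Gamma> l x))" for m l
  define J where "J k m = (\<integral>\<^sup>+x\<in>C k. ennreal \<bar>\<phi> m x - u x\<bar> \<partial>lebesgue)" for k m
  \<comment> \<open>Along the subsequence the errors decay geometrically, both for the gradients and for the
    functions on the \<open>k\<close>th set of an exhaustion of \<open>U\<close>.\<close>
  define P where "P k N \<longleftrightarrow> (\<forall>m\<ge>N. \<forall>l\<ge>N. I m l < ennreal ((1/4) ^ k)) \<and> J k N < ennreal ((1/2) ^ k)" for k N
  have exP: "\<exists>N\<ge>a. P k N" for a k
  proof -
    obtain N1 where N1: "\<forall>m\<ge>N1. \<forall>l\<ge>N1. I m l < ennreal ((1/4) ^ k)"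
      using cauchy[of "(1/4) ^ k"] unfolding I_def by auto
    have "(\<lambda>m. J k m) \<longlonglongrightarrow> 0" unfolding J_def using C(1,2) by (intro conv) auto
    then have "eventually (\<lambda>m. J k m < ennreal ((1/2) ^ k)) sequentially"
      by (rule order_tendstoD) simp
    then obtain N2 where N2: "\<forall>m\<ge>N2. J k m < ennreal ((1/2) ^ k)" by (auto simp: eventually_sequentially)
    show ?thesis unfolding P_def
      by (intro exI[of _ "max a (max N1 N2)"] conjI allI impI) (use N1 N2 in auto)
  qed
  have "\<exists>n. \<forall>k. P k (n k) \<and> n k < n (Suc k)"
  proof (rule dependent_nat_choice)
    show "\<exists>N. P 0 N" using exP by blast
    show "\<exists>N. P (Suc k) N \<and> a < N" for a k using exP[of "Suc a" "Suc k"] by (auto simp: Suc_le_eq)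
  qed
  then obtain n where n: "\<And>k. P k (n k)" "\<And>k. n k < n (Suc k)" by blast
  have sm: "strict_mono n" using n(2) by (simp add: strict_mono_Suc_iff)
  define \<phi>' where "\<phi>' k = \<phi> (n k)" for k
  define \<Gamma>' where "\<Gamma>' k = \<Gamma> (n k)" for k
  have \<phi>': "\<phi>' k \<in> lipschitz_functions U" and \<Gamma>': "has_weak_grad U (\<phi>' k) (\<Gamma>' k)" for k
    unfolding \<phi>'_def \<Gamma>'_def by (rule \<phi>, rule \<Gamma>)
  have m\<Gamma>: "(\<lambda>x. \<Gamma>' k x $ i) \<in> borel_measurable ?M" for k i
    by (rule locally_integrable_measurable[OF open_U has_weak_gradD(2)[OF \<Gamma>']])
  have m\<phi>: "\<phi>' k \<in> borel_measurable ?M" for k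
    by (rule locally_integrable_measurable[OF open_U has_weak_gradD(1)[OF \<Gamma>']])
  have mu: "u \<in> borel_measurable ?M" by (rule locally_integrable_measurable[OF open_U u])
  have Ile: "nnint U (energy_density (\<lambda>x. \<Gamma>' l x - \<Gamma>' k x)) \<le> ennreal ((1/4) ^ k)" if "k \<le> l" for k l
    using n(1)[of k] strict_mono_less_eq[OF sm, of k l] that unfolding P_def I_def \<Gamma>'_def by (simp add: less_imp_le)
  have Jle: "(\<integral>\<^sup>+x\<in>C k. ennreal \<bar>\<phi>' k x - u x\<bar> \<partial>lebesgue) \<le> ennreal ((1/2) ^ k)" for k
    using n(1)[of k] unfolding P_def J_def \<phi>'_def by (simp add: less_imp_le)
  have C_ev: "\<exists>N. \<forall>k\<ge>N. x \<in> C k" if "x \<in> U" for x using C(3)[rule_format, of "{x}"] that by auto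

  have ae\<phi>: "AE x in ?M. (\<lambda>k. \<phi>' k x) \<longlonglongrightarrow> u x"
  proof -
    let ?f = "\<lambda>k x. indicator (C k) x * \<bar>\<phi>' k x - u x\<bar>"
    have mC: "C k \<in> sets ?M" for k
      using C(1,2) open_U by (simp add: sets_restrict_space_iff compact_imp_closed)
    have "AE x in ?M. summable (\<lambda>k. ?f k x)"
    proof (rule AE_summable_of_nn_integrals)
      show "?f k \<in> borel_measurable ?M" for k
        using mC m\<phi> mu by (intro borel_measurable_times borel_measurable_indicator borel_measurable_abs borel_measurable_diff)
      show "nnint U (?f k) \<le> ennreal ((1/2) ^ k)" for k
      proof -
        have "nnint U (?f k) = (\<integral>\<^sup>+x\<in>C k. ennreal \<bar>\<phi>' k x - u x\<bar> \<partial>lebesgue)"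
          unfolding nn_integral_restrict_space[OF mU] using C(2)
          by (intro nn_integral_cong) (auto split: split_indicator)
        then show ?thesis using Jle by simp
      qed
    qed (auto simp: summable_geometric)
    then show ?thesis
    proof (rule AE_mp, intro AE_I2 impI)
      fix x assume "x \<in> space ?M" "summable (\<lambda>k. ?f k x)"
      then have "x \<in> U" "(\<lambda>k. ?f k x) \<longlonglongrightarrow> 0" by (auto dest: summable_LIMSEQ_zero)
      obtain N where N: "\<forall>k\<ge>N. x \<in> C k" using C_ev[OF \<open>x \<in> U\<close>] by blast
      have "(\<lambda>k. \<bar>\<phi>' k x - u x\<bar>) \<longlonglongrightarrow> 0"
        by (rule Lim_transform_eventually[OF \<open>(\<lambda>k. ?f k x) \<longlonglongrightarrow> 0\<close>])
           (use N in \<open>auto intro!: eventually_sequentiallyI[of N]\<close>)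
      then show "(\<lambda>k. \<phi>' k x) \<longlonglongrightarrow> u x" by (simp add: tendsto_rabs_zero_iff LIM_zero_iff)
    qed
  qed
  define G where "G x = (\<chi> i. lim (\<lambda>k. \<Gamma>' k x $ i))" for x
  have mG: "(\<lambda>x. G x $ i) \<in> borel_measurable ?M" for i
    unfolding G_def vec_lambda_beta by (rule borel_measurable_lim_metric[OF m\<Gamma>])
  have ae\<Gamma>: "AE x in ?M. (\<lambda>k. \<Gamma>' k x) \<longlonglongrightarrow> G x"
  proof -
    let ?f = "\<lambda>k x. 2 ^ k * energy_density (\<lambda>x. \<Gamma>' (Suc k) x - \<Gamma>' k x) x"
    have men: "energy_density (\<lambda>x. \<Gamma>' (Suc k) x - \<Gamma>' k x) \<in> borel_measurable ?M" for k
      by (intro energy_density_measurable has_weak_grad_diff_measurable[OF open_U \<Gamma>' \<Gamma>'])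
    have "AE x in ?M. summable (\<lambda>k. ?f k x)"
    proof (rule AE_summable_of_nn_integrals)
      show "?f k \<in> borel_measurable ?M" for k using men by simp
      show "nnint U (?f k) \<le> ennreal ((1/2) ^ k)" for k
      proof -
        have "nnint U (?f k) = ennreal (2 ^ k) * nnint U (energy_density (\<lambda>x. \<Gamma>' (Suc k) x - \<Gamma>' k x))"
          using men by (subst nn_integral_cmult[symmetric]) (auto intro!: nn_integral_cong simp: ennreal_mult' )
        also have "\<dots> \<le> ennreal (2 ^ k) * ennreal ((1/4) ^ k)"
          by (intro mult_left_mono Ile) auto
        also have "\<dots> = ennreal (2 ^ k * (1/4) ^ k)" by (simp add: ennreal_mult[symmetric])
        also have "(2::real) ^ k * (1/4) ^ k = (1/2) ^ k" by (simp add: power_mult_distrib[symmetric])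
        finally show ?thesis .
      qed
      show "0 \<le> ?f k x" if "x \<in> space ?M" for k x using that energy_density_nonneg by simp
    qed (auto simp: summable_geometric)
    then show ?thesis
    proof (rule AE_mp, intro AE_I2 impI)
      fix x assume x: "x \<in> space ?M" "summable (\<lambda>k. ?f k x)"
      then have xU: "x \<in> U" by simp
      have "\<exists>l. (\<lambda>k. \<Gamma>' k x) \<longlonglongrightarrow> l"
      proof (rule convergent_of_summable_increments[OF _ x(2)])
        show "c * E x powr (2 * t) > 0" using c_pos E_pos[OF xU] by simp
        show "2 ^ k * (c * E x powr (2 * t) * (norm (\<Gamma>' (Suc k) x - \<Gamma>' k x))\<^sup>2) \<le> ?f k x" for k
          by (intro mult_left_mono energy_density_lower xU) simp
      qed
      then obtain l where l: "(\<lambda>k. \<Gamma>' k x) \<longlonglongrightarrow> l" by blast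
      have "G x $ i = l $ i" for i
        unfolding G_def vec_lambda_beta by (rule limI[OF tendsto_vec_nth[OF l]])
      then have "G x = l" by (simp add: vec_eq_iff)
      then show "(\<lambda>k. \<Gamma>' k x) \<longlonglongrightarrow> G x" using l by simp
    qed
  qed

  \<comment> \<open>By Fatou's lemma \<open>G\<close> is also the limit of the gradients in energy.\<close>
  have liminf_le: "liminf X \<le> b" if "\<And>l. l \<ge> k \<Longrightarrow> X l \<le> b" for X :: "nat \<Rightarrow> ennreal" and b k
    by (rule order_trans[OF Liminf_le_Limsup[OF sequentially_bot] Limsup_bounded])
       (use that in \<open>auto intro!: eventually_sequentiallyI[of k]\<close>)
  have GI: "nnint U (energy_density (\<lambda>x. \<Gamma>' k x - G x)) \<le> ennreal ((1/4) ^ k)" for k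
  proof -
    have "nnint U (energy_density (\<lambda>x. \<Gamma>' k x - G x)) \<le> liminf (\<lambda>l. nnint U (energy_density (\<lambda>x. \<Gamma>' k x - \<Gamma>' l x)))"
    proof (rule nn_integral_fatou)
      show "energy_density (\<lambda>x. \<Gamma>' k x - \<Gamma>' l x) \<in> borel_measurable ?M" for l
        by (intro energy_density_measurable has_weak_grad_diff_measurable[OF open_U \<Gamma>' \<Gamma>'])
      show "AE x in ?M. (\<lambda>l. energy_density (\<lambda>x. \<Gamma>' k x - \<Gamma>' l x) x) \<longlonglongrightarrow> energy_density (\<lambda>x. \<Gamma>' k x - G x) x"
        using ae\<Gamma>
      proof eventually_elim
        case (elim x)
        then show ?case unfolding energy_density_def by (intro tendsto_mult tendsto_const tendsto_normA tendsto_diff)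
      qed
    qed
    also have "\<dots> \<le> ennreal ((1/4) ^ k)"
      by (rule liminf_le[of k]) (subst energy_density_diff_commute, rule Ile)
    finally show ?thesis .
  qed
  define e where "e = nnint U (energy_density G)"
  have mD: "(\<lambda>x. (\<Gamma>' k x - G x) $ i) \<in> borel_measurable ?M" for k i using m\<Gamma> mG by simp
  have e_fin: "e < \<infinity>"
  proof -
    have "e \<le> ennreal (1 + 1) * nnint U (energy_density (\<Gamma>' 0)) + ennreal (1 + 1 / 1) * nnint U (energy_density (\<lambda>x. G x - \<Gamma>' 0 x))"
      unfolding e_def by (rule energy_add_le[OF mG m\<Gamma>]) simp
    moreover have "nnint U (energy_density (\<Gamma>' 0)) < \<infinity>" by (rule energy_finite[OF \<phi>' \<Gamma>'])
    moreover have "nnint U (energy_density (\<lambda>x. G x - \<Gamma>' 0 x)) < \<infinity>"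
    proof -
      have "energy_density (\<lambda>x. G x - \<Gamma>' 0 x) = energy_density (\<lambda>x. \<Gamma>' 0 x - G x)" by (rule energy_density_diff_commute)
      then show ?thesis using le_less_trans[OF GI[of 0] ennreal_less_top] by (simp only: infinity_ennreal_def)
    qed
    ultimately show ?thesis
      by (auto simp: ennreal_mult_less_top intro: le_less_trans)
  qed

  \<comment> \<open>Convergence in energy implies local convergence in mean, so the definition of weak gradients
    passes to the limit.\<close>
  have convG: "(\<lambda>k. \<integral>\<^sup>+x\<in>S. ennreal \<bar>\<Gamma>' k x $ i - G x $ i\<bar> \<partial>lebesgue) \<longlonglongrightarrow> 0"
    and finG: "(\<integral>\<^sup>+x\<in>S. ennreal \<bar>\<Gamma>' k x $ i - G x $ i\<bar> \<partial>lebesgue) < \<infinity>"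
    if S: "compact S" "S \<subseteq> U" for S i k
  proof -
    obtain K where K: "K \<ge> 0" "\<And>H k. (\<And>i. (\<lambda>x. H x $ i) \<in> borel_measurable (lebesgue_on U)) \<Longrightarrow>
      nnint U (energy_density H) \<le> ennreal ((1/4) ^ k) \<Longrightarrow>
      (\<integral>\<^sup>+x\<in>S. ennreal (norm (H x)) \<partial>lebesgue) \<le> ennreal ((1/2) ^ k * K)"
      by (rule L1_bound_by_energy[OF S]) blast
    have le: "(\<integral>\<^sup>+x\<in>S. ennreal \<bar>\<Gamma>' k x $ i - G x $ i\<bar> \<partial>lebesgue) \<le> ennreal ((1/2) ^ k * K)" for k
    proof -
      have "(\<integral>\<^sup>+x\<in>S. ennreal \<bar>\<Gamma>' k x $ i - G x $ i\<bar> \<partial>lebesgue) \<le> (\<integral>\<^sup>+x\<in>S. ennreal (norm (\<Gamma>' k x - G x)) \<partial>lebesgue)"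
      proof (intro nn_integral_mono mult_right_mono ennreal_leI)
        show "\<bar>\<Gamma>' k x $ i - G x $ i\<bar> \<le> norm (\<Gamma>' k x - G x)" for x
          using component_le_norm_cart[of "\<Gamma>' k x - G x" i] by simp
      qed simp
      also have "\<dots> \<le> ennreal ((1/2) ^ k * K)" by (rule K(2)[OF mD GI])
      finally show ?thesis .
    qed
    then show "(\<integral>\<^sup>+x\<in>S. ennreal \<bar>\<Gamma>' k x $ i - G x $ i\<bar> \<partial>lebesgue) < \<infinity>" for k
      using le_less_trans[OF le ennreal_less_top] by simp
    have "(\<lambda>k. (1/2) ^ k * K) \<longlonglongrightarrow> 0 * K" by (intro tendsto_mult tendsto_const LIMSEQ_power_zero) simp
    then have lim: "(\<lambda>k. ennreal ((1/2) ^ k * K)) \<longlonglongrightarrow> ennreal 0" by (intro tendsto_ennrealI) simp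
    show "(\<lambda>k. \<integral>\<^sup>+x\<in>S. ennreal \<bar>\<Gamma>' k x $ i - G x $ i\<bar> \<partial>lebesgue) \<longlonglongrightarrow> 0"
    proof (rule tendsto_sandwich[where f = "\<lambda>_. 0" and h = "\<lambda>k. ennreal ((1/2) ^ k * K)"])
      show "eventually (\<lambda>k. (\<integral>\<^sup>+x\<in>S. ennreal \<bar>\<Gamma>' k x $ i - G x $ i\<bar> \<partial>lebesgue) \<le> ennreal ((1/2) ^ k * K)) sequentially"
        using le by (intro always_eventually allI)
      show "(\<lambda>k. ennreal ((1/2) ^ k * K)) \<longlonglongrightarrow> 0" using lim by simp
      show "eventually (\<lambda>k. 0 \<le> (\<integral>\<^sup>+x\<in>S. ennreal \<bar>\<Gamma>' k x $ i - G x $ i\<bar> \<partial>lebesgue)) sequentially" by simp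
    qed (rule tendsto_const)
  qed
  have liG: "locally_integrable U (\<lambda>x. G x $ i)" for i
    unfolding locally_integrable_def set_integrable_def
  proof (intro allI impI)
    fix S assume "compact S \<and> S \<subseteq> U"
    then have S: "compact S" "S \<subseteq> U" by auto
    have mS: "S \<in> sets lebesgue" using S(1) by (simp add: compact_imp_closed)
    have mDi: "(\<lambda>x. \<Gamma>' 0 x $ i - G x $ i) \<in> borel_measurable ?M" using m\<Gamma> mG by simp
    have iD: "integrable lebesgue (\<lambda>x. indicator S x *\<^sub>R (\<Gamma>' 0 x $ i - G x $ i))"
    proof (rule integrableI_bounded)
      have "(\<lambda>x. indicator U x *\<^sub>R (\<Gamma>' 0 x $ i - G x $ i)) \<in> borel_measurable lebesgue"
        using mDi unfolding borel_measurable_restrict_space_iff[OF mU] .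
      then have "(\<lambda>x. indicator S x *\<^sub>R (indicator U x *\<^sub>R (\<Gamma>' 0 x $ i - G x $ i))) \<in> borel_measurable lebesgue"
        by (rule borel_measurable_scaleR[OF borel_measurable_indicator[OF mS]])
      moreover have "(\<lambda>x. indicator S x *\<^sub>R (indicator U x *\<^sub>R (\<Gamma>' 0 x $ i - G x $ i))) = (\<lambda>x. indicator S x *\<^sub>R (\<Gamma>' 0 x $ i - G x $ i))"
        using S(2) by (intro ext) (auto split: split_indicator)
      ultimately show "(\<lambda>x. indicator S x *\<^sub>R (\<Gamma>' 0 x $ i - G x $ i)) \<in> borel_measurable lebesgue" by simp
      have "(\<integral>\<^sup>+x. ennreal (norm (indicator S x *\<^sub>R (\<Gamma>' 0 x $ i - G x $ i))) \<partial>lebesgue) = (\<integral>\<^sup>+x\<in>S. ennreal \<bar>\<Gamma>' 0 x $ i - G x $ i\<bar> \<partial>lebesgue)"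
        by (intro nn_integral_cong) (auto split: split_indicator)
      then show "(\<integral>\<^sup>+x. ennreal (norm (indicator S x *\<^sub>R (\<Gamma>' 0 x $ i - G x $ i))) \<partial>lebesgue) < \<infinity>"
        using finG[OF S] by simp
    qed
    have "integrable lebesgue (\<lambda>x. indicator S x *\<^sub>R (\<Gamma>' 0 x $ i) - indicator S x *\<^sub>R (\<Gamma>' 0 x $ i - G x $ i))"
      by (intro Bochner_Integration.integrable_diff iD set_integrable_compact[OF has_weak_gradD(2)[OF \<Gamma>'] S])
    moreover have "(\<lambda>x. indicator S x *\<^sub>R (\<Gamma>' 0 x $ i) - indicator S x *\<^sub>R (\<Gamma>' 0 x $ i - G x $ i)) = (\<lambda>x. indicator S x *\<^sub>R (G x $ i))"
      by (simp add: algebra_simps)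
    ultimately show "integrable lebesgue (\<lambda>x. indicator S x *\<^sub>R (G x $ i))" by simp
  qed
  have conv': "(\<lambda>k. \<integral>\<^sup>+x\<in>S. ennreal \<bar>\<phi>' k x - u x\<bar> \<partial>lebesgue) \<longlonglongrightarrow> 0" if "compact S" "S \<subseteq> U" for S
    using LIMSEQ_subseq_LIMSEQ[OF conv[OF that] sm] unfolding \<phi>'_def o_def .
  have wG: "has_weak_grad U u G"
    unfolding has_weak_grad_def
  proof (intro conjI allI ballI u liG)
    fix \<psi> i assume \<psi>: "\<psi> \<in> test_functions U"
    have 1: "(\<lambda>k. LINT x:U|lebesgue. \<phi>' k x * pd i \<psi> x) \<longlonglongrightarrow> (LINT x:U|lebesgue. u x * pd i \<psi> x)"
      by (rule integral_test_tendsto[OF has_weak_gradD(1)[OF \<Gamma>'] u test_functions_pd[OF \<psi>] conv'])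
    have 2: "(\<lambda>k. LINT x:U|lebesgue. \<Gamma>' k x $ i * \<psi> x) \<longlonglongrightarrow> (LINT x:U|lebesgue. G x $ i * \<psi> x)"
      by (rule integral_test_tendsto[OF has_weak_gradD(2)[OF \<Gamma>'] liG \<psi> convG])
    have "(\<lambda>k. LINT x:U|lebesgue. \<phi>' k x * pd i \<psi> x) \<longlonglongrightarrow> - (LINT x:U|lebesgue. G x $ i * \<psi> x)"
      unfolding has_weak_gradD(3)[OF \<Gamma>' \<psi>] by (intro tendsto_minus 2)
    with 1 show "(LINT x:U|lebesgue. u x * pd i \<psi> x) = - (LINT x:U|lebesgue. G x $ i * \<psi> x)"
      by (rule LIMSEQ_unique)
  qed

  \<comment> \<open>Fatou's lemma is applied to Hardy term and remainder together; the energies on the right-hand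
    side of the Hardy identity are bounded by a sequence that converges to that of \<open>G\<close>, by the triangle inequality with \<open>\<delta> = 2\<^bsup>- k\<^esup>\<close>.\<close>
  let ?F = "\<lambda>v H x. remainder_density v H x + (t - 1/2)\<^sup>2 * hardy_density v x"
  have "nnint U (?F u G) \<le> liminf (\<lambda>k. nnint U (?F (\<phi>' k) (\<Gamma>' k)))"
  proof (rule nn_integral_fatou)
    show "?F (\<phi>' k) (\<Gamma>' k) \<in> borel_measurable ?M" for k
      by (intro borel_measurable_add borel_measurable_times borel_measurable_const remainder_density_measurable hardy_density_measurable m\<phi> m\<Gamma>)
    show "AE x in ?M. (\<lambda>k. ?F (\<phi>' k) (\<Gamma>' k) x) \<longlonglongrightarrow> ?F u G x"
      using ae\<phi> ae\<Gamma>
    proof eventually_elim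
      case (elim x)
      then show ?case unfolding remainder_density_def hardy_density_def transformed_grad_def
        by (intro tendsto_intros tendsto_normA)
    qed
  qed
  also have "\<dots> = liminf (\<lambda>k. nnint U (energy_density (\<Gamma>' k)))"
    using hardy_identity[OF \<phi>' \<Gamma>'] by simp
  also have "\<dots> \<le> liminf (\<lambda>k. ennreal ((1 + (1/2) ^ k) * enn2real e + ((1/4) ^ k + (1/2) ^ k)))"
  proof (intro Liminf_mono always_eventually allI)
    fix k
    have ee: "e = ennreal (enn2real e)" using e_fin by (simp add: ennreal_enn2real_if)
    have p: "(1 + 1 / (1/2) ^ k) * (1/4) ^ k = (1/4 :: real) ^ k + (1/2) ^ k"
    proof -
      have q: "(4::real) ^ k = 2 ^ k * 2 ^ k" by (simp add: power_mult_distrib[symmetric])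
      show ?thesis by (simp add: q power_divide field_simps)
    qed
    have "nnint U (energy_density (\<Gamma>' k)) \<le> ennreal (1 + (1/2) ^ k) * e + ennreal (1 + 1 / (1/2) ^ k) * nnint U (energy_density (\<lambda>x. \<Gamma>' k x - G x))"
      unfolding e_def by (rule energy_add_le[OF m\<Gamma> mG]) simp
    also have "\<dots> \<le> ennreal (1 + (1/2) ^ k) * ennreal (enn2real e) + ennreal (1 + 1 / (1/2) ^ k) * ennreal ((1/4) ^ k)"
      by (intro add_mono mult_left_mono GI) (use ee in auto)
    also have "\<dots> = ennreal ((1 + (1/2) ^ k) * enn2real e + (1 + 1 / (1/2) ^ k) * (1/4) ^ k)"
      by (subst ennreal_mult[symmetric], simp, simp, subst ennreal_mult[symmetric], simp, simp, subst ennreal_plus[symmetric]) auto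
    finally show "nnint U (energy_density (\<Gamma>' k)) \<le> ennreal ((1 + (1/2) ^ k) * enn2real e + ((1/4) ^ k + (1/2) ^ k))"
      unfolding p .
  qed
  also have "\<dots> = e"
  proof (rule lim_imp_Liminf[OF sequentially_bot])
    have "(\<lambda>k. (1 + (1/2) ^ k) * enn2real e + ((1/4) ^ k + (1/2) ^ k)) \<longlonglongrightarrow> (1 + 0) * enn2real e + (0 + 0)"
      by (intro tendsto_intros LIMSEQ_power_zero) auto
    then have lim: "(\<lambda>k. ennreal ((1 + (1/2) ^ k) * enn2real e + ((1/4) ^ k + (1/2) ^ k))) \<longlonglongrightarrow> ennreal (enn2real e)"
      by (intro tendsto_ennrealI) simp
    show "(\<lambda>k. ennreal ((1 + (1/2) ^ k) * enn2real e + ((1/4) ^ k + (1/2) ^ k))) \<longlonglongrightarrow> e"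
    proof -
      have "ennreal (enn2real e) = e" using e_fin by (simp add: ennreal_enn2real)
      then show ?thesis using lim by (simp only:)
    qed
  qed
  finally show ?thesis using that[OF wG] e_fin unfolding e_def by blast
qed

end

section \<open>Distribution of the flux over the level sets of the weight\<close>

lemma grad_zero_off_closed:
  "closed S \<Longrightarrow> (\<And>x. x \<notin> S \<Longrightarrow> f x = 0) \<Longrightarrow> x \<notin> S \<Longrightarrow> grad f x = 0"
  using has_derivative_zero_off_closed[of S f x] by (intro grad_eqI) simp

lemma continuous_AE_zero_imp_zero:
  fixes f :: "'a::euclidean_space \<Rightarrow> real"
  assumes "continuous_on UNIV f" "AE x in lebesgue. f x = 0"
  shows "f x = 0"
proof (rule ccontr)
  assume "f x \<noteq> 0"
  have "open (f -` (- {0}))" using assms(1) by (intro open_vimage) auto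
  moreover have "AE x in lebesgue. x \<notin> f -` (- {0})" using assms(2) by eventually_elim simp
  ultimately show False using not_AE_outside_open \<open>f x \<noteq> 0\<close> by blast
qed

text \<open>
  A smooth function on the line that is positive exactly between \<open>a\<close> and \<open>b\<close>.
\<close>
definition bump :: "real \<Rightarrow> real \<Rightarrow> real \<Rightarrow> real" where
  "bump a b s = flat (s - a) * flat (b - s)"

lemma Cn_bump: "Cn n UNIV (bump a b)"
proof -
  have "Cn n UNIV (\<lambda>s::real. s \<bullet> 1)" by (rule Cn_inner)
  then show ?thesis unfolding bump_def[abs_def]
    by (intro Cn_mult Cn_flat_compose Cn_diff Cn_const) simp_all
qed

lemma bump_nonneg: "bump a b s \<ge> 0"
  and bump_pos: "a < s \<Longrightarrow> s < b \<Longrightarrow> bump a b s > 0"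
  and bump_zero: "s \<notin> {a..b} \<Longrightarrow> bump a b s = 0"
  by (auto simp: bump_def flat_pos_iff flat_eq_0_iff flat_nonneg)

lemma bump_le_1: "bump a b s \<le> 1"
  unfolding bump_def by (intro mult_le_one less_imp_le[OF flat_less_1] flat_nonneg)

lemma continuous_supported_integrable:
  fixes g :: "real \<Rightarrow> real"
  assumes "continuous_on UNIV g" "\<And>s. s \<notin> {a..b} \<Longrightarrow> g s = 0"
  shows "integrable lborel g"
proof -
  have "integrable lborel (\<lambda>x. indicator {a..b} x *\<^sub>R g x)"
    using assms by (intro borel_integrable_compact) (auto intro: continuous_on_subset)
  moreover have "(\<lambda>x. indicator {a..b} x *\<^sub>R g x) = g" using assms(2) by (auto split: split_indicator)
  ultimately show ?thesis by simp
qed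

lemma continuous_integral_pos:
  fixes g :: "real \<Rightarrow> real"
  assumes "continuous_on UNIV g" "\<And>s. s \<notin> {a..b} \<Longrightarrow> g s = 0" "\<And>s. g s \<ge> 0" "g s0 \<noteq> 0"
  shows "(\<integral>s. g s \<partial>lborel) > 0"
proof -
  have i: "integrable lborel g" by (rule continuous_supported_integrable[OF assms(1,2)])
  have "(\<integral>s. g s \<partial>lborel) \<noteq> 0"
  proof
    assume "(\<integral>s. g s \<partial>lborel) = 0"
    then have "AE s in lborel. g s = 0" using integral_nonneg_eq_0_iff_AE[OF i] assms(3) by simp
    then have "AE s in lebesgue. g s = 0" by (rule AE_completion)
    then show False using continuous_AE_zero_imp_zero[OF assms(1)] assms(4) by blast
  qed
  moreover have "(\<integral>s. g s \<partial>lborel) \<ge> 0" using assms(3) by simp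
  ultimately show ?thesis by simp
qed

lemma compactly_supported_antiderivative:
  fixes k :: "real \<Rightarrow> real"
  assumes k: "\<And>n. Cn n UNIV k" and supp: "\<And>s. s \<notin> {a..b} \<Longrightarrow> k s = 0" and 0: "(\<integral>s. k s \<partial>lborel) = 0"
  obtains H where "\<And>n. Cn n UNIV H" "\<And>s. (H has_real_derivative k s) (at s)" "\<And>s. s \<notin> {a..b} \<Longrightarrow> H s = 0"
proof -
  have ck: "continuous_on UNIV k" using k by (intro Cn_continuous_on)
  define H where "H s = integral {a - 1..s} k" for s
  have left: "H s = 0" if "s < a" for s
  proof -
    have "integral {a - 1..s} k = integral {a - 1..s} (\<lambda>_. 0)"
      using that by (intro integral_cong supp) auto
    then show ?thesis by (simp add: H_def)
  qed
  have right: "H s = 0" if "s > b" for s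
  proof -
    have si: "set_integrable lborel {a - 1..s} k"
      unfolding set_integrable_def using ck by (intro borel_integrable_compact) (auto intro: continuous_on_subset)
    have "H s = (LINT x:{a - 1..s}|lborel. k x)" unfolding H_def
      by (rule set_borel_integral_eq_integral(2)[OF si, symmetric])
    also have "\<dots> = (\<integral>x. k x \<partial>lborel)"
      by (rule set_integral_restrict_support) (use that in \<open>auto intro!: supp\<close>)
    finally show ?thesis using 0 by simp
  qed
  have der: "(H has_real_derivative k s) (at s)" for s
  proof (cases "s < a")
    case True
    have "((\<lambda>_. 0) has_real_derivative k s) (at s)" using supp[of s] True by simp
    then show ?thesis
      by (rule has_field_derivative_transform_within_open[of _ _ _ "{..<a}"]) (use True left in auto)
  next
    case False
    have "(H has_real_derivative k s) (at s within {a - 1..s + 1})"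
      unfolding H_def using False ck by (intro integral_has_real_derivative) (auto intro: continuous_on_subset)
    moreover have "at s within {a - 1..s + 1} = at s" using False by (intro at_within_interior) auto
    ultimately show ?thesis by simp
  qed
  have "Cn n UNIV H" for n
  proof (cases n)
    case (Suc m)
    have "\<forall>s\<in>UNIV. (H has_derivative (\<lambda>h. k s \<bullet> h)) (at s)"
      using der unfolding has_field_derivative_def by (simp add: inner_real_def[abs_def])
    then show ?thesis unfolding Suc Cn.simps(2) using k by (intro exI[of _ k]) simp
  qed simp
  then show ?thesis using der left right by (intro that[of H]) (auto simp: not_le)
qed

text \<open>
  A connected open part \<open>W\<close> of \<open>U\<close> on which \<open>E\<close> is unbounded, and above the level \<open>exp \<tau>\<close> of which \<open>E\<close> behaves
  like a proper function. It will be a connected component of \<open>U\<close>.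
\<close>
locale elliptic_levels = elliptic_harmonic U A E c t
  for U :: "(real^'n::finite) set" and A E c t +
  fixes W :: "(real^'n) set" and \<tau> :: real
  assumes open_W: "open W" and W_sub: "W \<subseteq> U" and W_connected: "connected W"
    and level_compact: "\<And>a b. \<tau> < a \<Longrightarrow> compact {x\<in>W. a \<le> ln (E x) \<and> ln (E x) \<le> b}"
    and unbounded: "\<And>b. \<exists>x\<in>W. ln (E x) > b"
begin

text \<open>
  The function \<open>h (ln E) |\<nabla>E|\<^sub>A\<^sup>2 / E\<close> on \<open>W\<close>, extended by zero.
\<close>
definition level_fun :: "(real \<Rightarrow> real) \<Rightarrow> real^'n \<Rightarrow> real" where
  "level_fun h x = (if x \<in> W then h (ln (E x)) * (normA_sq A x (grad E x) * E x powr (-1)) else 0)"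

lemma lnE_smooth: "Cn n W (\<lambda>x. ln (E x))"
  by (rule Cn_compose[OF Cn_ln Cn_subset[OF E_smooth W_sub]]) (use E_pos W_sub in auto)

lemma level_test_function:
  assumes h: "\<And>n. Cn n UNIV h" "\<tau> < a" "\<And>s. s \<notin> {a..b} \<Longrightarrow> h s = 0" and f: "\<And>n. Cn n W f"
  shows "(\<lambda>x. if x \<in> W then h (ln (E x)) * f x else 0) \<in> test_functions W"
proof (rule test_functions_extend[OF open_W _ level_compact[OF h(2)]])
  show "Cn n W (\<lambda>x. h (ln (E x)) * f x)" for n
    by (intro Cn_mult f Cn_compose[OF h(1) lnE_smooth]) auto
  show "h (ln (E x)) * f x = 0" if "x \<in> W" "x \<notin> {x \<in> W. a \<le> ln (E x) \<and> ln (E x) \<le> b}" for x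
    using that h(3)[of "ln (E x)"] by auto
qed auto

lemma level_fun_test_function:
  assumes h: "\<And>n. Cn n UNIV h" "\<tau> < a" "\<And>s. s \<notin> {a..b} \<Longrightarrow> h s = 0"
  shows "level_fun h \<in> test_functions W"
  unfolding level_fun_def[abs_def]
  by (rule level_test_function[OF h(1,2)], erule h(3))
    (intro Cn_mult Cn_subset[OF normA_grad_smooth W_sub] Cn_subset[OF E_powr_smooth W_sub])

lemma grad_lnE_compose:
  assumes "x \<in> W" "(h has_real_derivative h') (at (ln (E x)))"
  shows "((\<lambda>x. h (ln (E x))) has_derivative (\<lambda>y. (h' * E x powr (-1)) * (grad E x \<bullet> y))) (at x)"
proof -
  have x: "E x > 0" "x \<in> U" using assms(1) W_sub E_pos by auto
  have dE: "(E has_derivative (\<lambda>h. grad E x \<bullet> h)) (at x)"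
    by (rule has_derivative_grad[OF Cn_differentiable[OF E_smooth x(2)]])
  have dln: "(ln has_derivative (*) (1 / E x)) (at (E x))"
    using DERIV_ln_divide[OF x(1)] unfolding has_field_derivative_def .
  have "((\<lambda>x. ln (E x)) has_derivative (\<lambda>y. (1 / E x) * (grad E x \<bullet> y))) (at x)"
    using diff_chain_at[OF dE dln] unfolding o_def .
  from diff_chain_at[OF this, of h "(*) h'"] assms(2)
  have "((\<lambda>x. h (ln (E x))) has_derivative (\<lambda>y. h' * ((1 / E x) * (grad E x \<bullet> y)))) (at x)"
    unfolding o_def has_field_derivative_def by blast
  then show ?thesis using x(1) by (simp add: powr_minus_divide)
qed

lemma harmonic_weak:
  assumes F: "F \<in> test_functions U"
  shows "(\<integral>x. indicator U x *\<^sub>R (flux x \<bullet> grad F x) \<partial>lebesgue) = 0"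
proof -
  have pf: "Cn n U (pd i (\<lambda>y. flux y $ i))" for n i by (intro Cn_pd flux_smooth open_U)
  have i1: "integrable lebesgue (\<lambda>x. indicator U x *\<^sub>R (flux x $ i * pd i F x))" for i
    by (rule test_extend_integrable[OF open_U flux_smooth test_functions_pd[OF F]])
  have i2: "integrable lebesgue (\<lambda>x. indicator U x *\<^sub>R (pd i (\<lambda>y. flux y $ i) x * F x))" for i
    by (rule test_extend_integrable[OF open_U pf F])
  have "(\<integral>x. indicator U x *\<^sub>R (flux x \<bullet> grad F x) \<partial>lebesgue) = (\<integral>x. (\<Sum>i\<in>UNIV. indicator U x *\<^sub>R (flux x $ i * pd i F x)) \<partial>lebesgue)"
    unfolding inner_vec_def inner_real_def by (simp add: sum_distrib_left)
  also have "\<dots> = (\<Sum>i\<in>UNIV. LINT x:U|lebesgue. flux x $ i * pd i F x)"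
    unfolding set_lebesgue_integral_def by (rule Bochner_Integration.integral_sum[OF i1])
  also have "\<dots> = - (\<Sum>i\<in>UNIV. LINT x:U|lebesgue. pd i (\<lambda>y. flux y $ i) x * F x)"
    by (simp only: integration_by_parts[OF open_U flux_smooth F] sum_negf)
  also have "(\<Sum>i\<in>UNIV. LINT x:U|lebesgue. pd i (\<lambda>y. flux y $ i) x * F x) = (\<integral>x. (\<Sum>i\<in>UNIV. indicator U x *\<^sub>R (pd i (\<lambda>y. flux y $ i) x * F x)) \<partial>lebesgue)"
    unfolding set_lebesgue_integral_def by (rule Bochner_Integration.integral_sum[OF i2, symmetric])
  also have "\<dots> = 0"
  proof (rule integral_eq_zero_AE)
    show "AE x in lebesgue. (\<Sum>i\<in>UNIV. indicator U x *\<^sub>R (pd i (\<lambda>y. flux y $ i) x * F x)) = 0"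
      using harmonic
    proof eventually_elim
      case (elim x)
      show ?case
      proof (cases "x \<in> U")
        case True
        have "(\<Sum>i\<in>UNIV. pd i (\<lambda>y. flux y $ i) x) = 0" using elim True by (simp add: div_A_grad_def flux_def)
        then show ?thesis using True by (simp add: sum_distrib_right[symmetric])
      qed simp
    qed
  qed
  finally show ?thesis by simp
qed

text \<open>
  The equation for \<open>E\<close> is tested with \<open>H (ln E)\<close>.
\<close>
lemma level_fun_integral_derivative:
  assumes H: "\<And>n. Cn n UNIV H" "\<And>s. (H has_real_derivative k s) (at s)" "\<tau> < a" "\<And>s. s \<notin> {a..b} \<Longrightarrow> H s = 0"
  shows "(\<integral>x. level_fun k x \<partial>lebesgue) = 0"
proof -
  let ?F = "\<lambda>x. if x \<in> W then H (ln (E x)) * 1 else 0"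
  have F: "?F \<in> test_functions W" by (rule level_test_function[OF H(1,3,4) Cn_const])
  then have FU: "?F \<in> test_functions U" using W_sub by (rule test_functions_mono)
  obtain S where S: "compact S" "S \<subseteq> W" "\<And>x. x \<notin> S \<Longrightarrow> ?F x = 0" using F by (rule test_functionsE) blast
  have gF: "flux x \<bullet> grad ?F x = level_fun k x" for x
  proof (cases "x \<in> W")
    case True
    have "(?F has_derivative (\<lambda>y. (k (ln (E x)) * E x powr (-1)) * (grad E x \<bullet> y))) (at x)"
      by (rule has_derivative_transform_within_open[OF grad_lnE_compose[OF True H(2)] open_W True]) simp
    then have "grad ?F x = (k (ln (E x)) * E x powr (-1)) *\<^sub>R grad E x"
      by (intro grad_eqI) simp
    then show ?thesis using True by (simp add: level_fun_def flux_def normA_sq_def)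
  next
    case False
    have "grad ?F x = 0"
      by (rule grad_zero_off_closed[OF compact_imp_closed[OF S(1)]], erule S(3)) (use False S(2) in blast)
    then show ?thesis using False by (simp add: level_fun_def)
  qed
  have "(\<integral>x. level_fun k x \<partial>lebesgue) = (\<integral>x. indicator U x *\<^sub>R (flux x \<bullet> grad ?F x) \<partial>lebesgue)"
    unfolding gF by (intro Bochner_Integration.integral_cong refl) (use W_sub in \<open>auto simp: level_fun_def split: split_indicator\<close>)
  also have "\<dots> = 0" by (rule harmonic_weak[OF FU])
  finally show ?thesis .
qed

lemma level_fun_nonneg: "(\<And>s. h s \<ge> 0) \<Longrightarrow> level_fun h x \<ge> 0"
  using W_sub normA_nonneg by (auto simp: level_fun_def intro!: mult_nonneg_nonneg)

text \<open>
  The image of the measure \<open>|\<nabla>E|\<^sub>A\<^sup>2 / E dx\<close> on \<open>W\<close> under \<open>ln E\<close> is a positive multiple of Lebesgue measure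
  above \<open>\<tau>\<close>. This takes the place of the coarea formula together with the constancy of the flux
  through level sets.
\<close>
lemma level_density:
  obtains m where "m > 0" "\<And>g a b. (\<And>n. Cn n UNIV g) \<Longrightarrow> \<tau> < a \<Longrightarrow> (\<And>s. s \<notin> {a..b} \<Longrightarrow> g s = 0) \<Longrightarrow>
    (\<integral>x. level_fun g x \<partial>lebesgue) = m * (\<integral>s. g s \<partial>lborel)"
proof -
  let ?g = "bump (\<tau> + 1) (\<tau> + 2)"
  have cg: "continuous_on UNIV ?g" using Cn_bump by (intro Cn_continuous_on)
  define J where "J = (\<integral>s. ?g s \<partial>lborel)"
  have J: "J > 0" unfolding J_def
  proof (rule continuous_integral_pos[OF cg bump_zero bump_nonneg])
    show "bump (\<tau> + 1) (\<tau> + 2) (\<tau> + 3/2) \<noteq> 0" using bump_pos[of "\<tau> + 1" "\<tau> + 3/2" "\<tau> + 2"] by simp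
  qed
  define m where "m = (\<integral>x. level_fun ?g x \<partial>lebesgue) / J"
  have main: "(\<integral>x. level_fun g x \<partial>lebesgue) = m * (\<integral>s. g s \<partial>lborel)"
    if g: "\<And>n. Cn n UNIV g" "\<tau> < a" "\<And>s. s \<notin> {a..b} \<Longrightarrow> g s = 0" for g a b
  proof -
    define r where "r = (\<integral>s. g s \<partial>lborel) / J"
    \<comment> \<open>The multiple of the fixed bump is subtracted in order to make the integral zero, so that there is
      an antiderivative with compact support.\<close>
    define k where "k s = g s - r * ?g s" for s
    define a' where "a' = min a (\<tau> + 1)"
    define b' where "b' = max b (\<tau> + 2)"
    have Ck: "Cn n UNIV k" for n unfolding k_def by (intro Cn_diff g Cn_cmult Cn_bump)
    have k0: "k s = 0" if "s \<notin> {a'..b'}" for s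
    proof -
      have "g s = 0" by (rule g(3)) (use that in \<open>auto simp: a'_def b'_def\<close>)
      moreover have "?g s = 0" by (rule bump_zero) (use that in \<open>auto simp: a'_def b'_def\<close>)
      ultimately show ?thesis by (simp add: k_def)
    qed
    have a': "\<tau> < a'" using g(2) by (simp add: a'_def)
    have ig: "integrable lborel g" using continuous_supported_integrable[OF Cn_continuous_on[OF g(1)] g(3)] .
    have ib: "integrable lborel ?g" by (rule continuous_supported_integrable[OF cg bump_zero])
    have "(\<integral>s. k s \<partial>lborel) = (\<integral>s. g s \<partial>lborel) - r * J"
      unfolding k_def J_def using ig ib by simp
    then have "(\<integral>s. k s \<partial>lborel) = 0" using J by (simp add: r_def)
    then obtain H where H: "\<And>n. Cn n UNIV H" "\<And>s. (H has_real_derivative k s) (at s)" "\<And>s. s \<notin> {a'..b'} \<Longrightarrow> H s = 0"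
      using compactly_supported_antiderivative[OF Ck k0] by metis
    have "(\<integral>x. level_fun k x \<partial>lebesgue) = 0" by (rule level_fun_integral_derivative[OF H(1,2) a' H(3)])
    moreover have "(\<integral>x. level_fun k x \<partial>lebesgue) = (\<integral>x. level_fun g x \<partial>lebesgue) - r * (\<integral>x. level_fun ?g x \<partial>lebesgue)"
    proof -
      have "integrable lebesgue (level_fun g)" using test_integrable[OF level_fun_test_function[OF g]] .
      moreover have "integrable lebesgue (level_fun ?g)"
      proof (rule test_integrable)
        show "level_fun ?g \<in> test_functions W"
          by (rule level_fun_test_function[of ?g "\<tau> + 1" "\<tau> + 2"], rule Cn_bump, simp, erule bump_zero)
      qed
      moreover have "level_fun k x = level_fun g x - r * level_fun ?g x" for x by (simp add: level_fun_def k_def algebra_simps diff_divide_distrib)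
      ultimately show ?thesis by simp
    qed
    ultimately show ?thesis by (simp add: m_def r_def)
  qed
  have "m \<noteq> 0"
  proof
    assume "m = 0"
    \<comment> \<open>A bump around the value of \<open>ln E\<close> at \<open>y\<close> has a nonnegative continuous integrand with integral zero.\<close>
    have grad0: "grad E y = 0" if y: "y \<in> W" "ln (E y) > \<tau>" for y
    proof -
      let ?a = "(\<tau> + ln (E y)) / 2" and ?b = "ln (E y) + 1"
      let ?h = "bump ?a ?b"
      have a: "\<tau> < ?a" using y(2) by simp
      have t: "level_fun ?h \<in> test_functions W" by (rule level_fun_test_function[OF Cn_bump a bump_zero])
      have "(\<integral>x. level_fun ?h x \<partial>lebesgue) = 0" using main[OF Cn_bump a bump_zero] \<open>m = 0\<close> by simp
      then have "AE x in lebesgue. level_fun ?h x = 0"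
        using integral_nonneg_eq_0_iff_AE[OF test_integrable[OF t]] level_fun_nonneg[OF bump_nonneg] by simp
      then have "level_fun ?h y = 0" by (rule continuous_AE_zero_imp_zero[OF test_continuous[OF t]])
      moreover have "?h (ln (E y)) > 0" using y(2) by (intro bump_pos) auto
      moreover have "E y > 0" using y(1) W_sub E_pos by blast
      ultimately have "normA_sq A y (grad E y) = 0" using y(1) by (simp add: level_fun_def)
      then show ?thesis using elliptic[of y "grad E y"] y(1) W_sub c_pos
        by (auto simp: mult_le_0_iff dest!: subsetD)
    qed
    obtain x1 where x1: "x1 \<in> W" "ln (E x1) > \<tau>" using unbounded by blast
    have cE: "continuous_on W E" using Cn_continuous_on[OF E_smooth] W_sub by (rule continuous_on_subset)
    define T where "T = {y\<in>W. E y = E x1}"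
    have "open T"
      unfolding open_contains_ball
    proof
      fix y assume y: "y \<in> T"
      have "E x1 > 0" using x1 W_sub E_pos by blast
      then have "ln (E y) > \<tau>" using y x1(2) by (simp add: T_def)
      have "open (W \<inter> (\<lambda>x. ln (E x)) -` {\<tau><..})"
        using Cn_continuous_on[OF lnE_smooth] open_W by (intro continuous_open_preimage) auto
      moreover have "y \<in> W \<inter> (\<lambda>x. ln (E x)) -` {\<tau><..}" using y \<open>ln (E y) > \<tau>\<close> by (simp add: T_def)
      ultimately obtain r where r: "r > 0" "ball y r \<subseteq> W \<inter> (\<lambda>x. ln (E x)) -` {\<tau><..}"
        using open_contains_ball by blast
      have "\<exists>k. \<forall>x\<in>ball y r. E x = k"
      proof (rule has_derivative_zero_constant)
        fix x assume "x \<in> ball y r"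
        then have x: "x \<in> W" "ln (E x) > \<tau>" using r(2) by auto
        have "x \<in> U" using x(1) W_sub by blast
        from has_derivative_grad[OF Cn_differentiable[OF E_smooth this]]
        have "(E has_derivative (\<lambda>h. 0)) (at x)" unfolding grad0[OF x] by simp
        then show "(E has_derivative (\<lambda>h. 0)) (at x within ball y r)" by (rule has_derivative_at_withinI)
      qed simp
      then obtain k where "\<forall>x\<in>ball y r. E x = k" by blast
      then have "\<forall>x\<in>ball y r. E x = E y" using r(1) by simp
      then have "ball y r \<subseteq> T" using r(2) y by (auto simp: T_def)
      then show "\<exists>e>0. ball y e \<subseteq> T" using r(1) by blast
    qed
    moreover have "open (W - T)"
    proof -
      have "open (W \<inter> E -` (- {E x1}))" by (rule continuous_open_preimage[OF cE open_W]) auto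
      moreover have "W \<inter> E -` (- {E x1}) = W - T" by (auto simp: T_def)
      ultimately show ?thesis by simp
    qed
    ultimately have "T \<inter> W = {} \<or> (W - T) \<inter> W = {}"
      using connectedD[OF W_connected, of T "W - T"] by blast
    then have "W \<subseteq> T" using x1(1) by (auto simp: T_def)
    obtain x2 where "x2 \<in> W" "ln (E x2) > ln (E x1)" using unbounded by blast
    then show False using \<open>W \<subseteq> T\<close> by (auto simp: T_def)
  qed
  moreover have "m \<ge> 0" unfolding m_def using J level_fun_nonneg[OF bump_nonneg] by simp
  ultimately show ?thesis using main by (intro that[of m]) auto
qed

end

section \<open>Optimality and non-attainment\<close>

lemma Cn_deriv:
  fixes h :: "real \<Rightarrow> real"
  assumes "\<And>n. Cn n UNIV h"
  shows "(h has_real_derivative deriv h s) (at s)" "Cn n UNIV (deriv h)"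
proof -
  from assms[of "Suc n"] obtain g where g: "\<forall>x. (h has_derivative (\<lambda>y. g x \<bullet> y)) (at x)" "Cn n UNIV (\<lambda>x. g x \<bullet> 1)"
    by auto
  have d: "(h has_real_derivative g s) (at s)" for s
    using g(1) unfolding has_field_derivative_def by (simp add: inner_real_def[abs_def])
  have e: "deriv h s = g s" for s using d by (rule DERIV_imp_deriv)
  show "(h has_real_derivative deriv h s) (at s)" using d unfolding e .
  show "Cn n UNIV (deriv h)" using g(2) by (simp add: e[abs_def])
qed

context elliptic_levels
begin

lemma nnint_level_fun:
  assumes h: "\<And>n. Cn n UNIV h" "\<tau> < a" "\<And>s. s \<notin> {a..b} \<Longrightarrow> h s = 0" and nn: "\<And>s. h s \<ge> 0"
  shows "nnint U (level_fun h) = ennreal (\<integral>x. level_fun h x \<partial>lebesgue)"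
proof -
  have t: "level_fun h \<in> test_functions W" by (rule level_fun_test_function[OF h(1,2)]) (erule h(3))
  have mU: "U \<inter> space lebesgue \<in> sets lebesgue" using open_U by simp
  have "nnint U (level_fun h) = (\<integral>\<^sup>+x. ennreal (level_fun h x) \<partial>lebesgue)"
    unfolding nn_integral_restrict_space[OF mU]
    by (intro nn_integral_cong) (use W_sub in \<open>auto simp: level_fun_def split: split_indicator\<close>)
  also have "\<dots> = ennreal (\<integral>x. level_fun h x \<partial>lebesgue)"
    by (rule nn_integral_eq_integral[OF test_integrable[OF t]]) (simp add: level_fun_nonneg nn)
  finally show ?thesis .
qed

text \<open>
  For \<open>u = E\<^bsup>1/2 - t\<^esup> h (ln E)\<close> the transformed function is \<open>v = h (ln E)\<close>.
\<close>
lemma level_function_densities: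
  assumes h: "\<And>n. Cn n UNIV h" and x: "x \<in> W"
    and u: "\<And>y. y \<in> W \<Longrightarrow> u y = h (ln (E y)) * E y powr (1/2 - t)"
  shows "remainder_density u (grad u) x = level_fun (\<lambda>s. (deriv h s)\<^sup>2) x" "hardy_density u x = level_fun (\<lambda>s. (h s)\<^sup>2) x"
proof -
  have xU: "x \<in> U" using x W_sub by blast
  have E: "E x > 0" using E_pos[OF xU] .
  let ?h = "h (ln (E x))" and ?h' = "deriv h (ln (E x))" and ?s = "1/2 - t"
  have d1: "((\<lambda>x. h (ln (E x))) has_derivative (\<lambda>y. (?h' * E x powr (-1)) * (grad E x \<bullet> y))) (at x)"
    by (rule grad_lnE_compose[OF x Cn_deriv(1)[OF h]])
  note d2 = E_powr_derivative[OF xU, of ?s]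
  have "((\<lambda>y. h (ln (E y)) * E y powr ?s) has_derivative
     (\<lambda>y. ?h * ((?s * E x powr (?s - 1)) * (grad E x \<bullet> y)) + ((?h' * E x powr (-1)) * (grad E x \<bullet> y)) * E x powr ?s)) (at x)"
    by (rule has_derivative_mult[OF d1 d2])
  then have "(u has_derivative (\<lambda>y. ?h * ((?s * E x powr (?s - 1)) * (grad E x \<bullet> y)) + ((?h' * E x powr (-1)) * (grad E x \<bullet> y)) * E x powr ?s)) (at x)"
    by (rule has_derivative_transform_within_open[OF _ open_W x]) (simp add: u)
  then have g: "grad u x = (?h * ?s * E x powr (?s - 1) + ?h' * E x powr (-1) * E x powr ?s) *\<^sub>R grad E x"
    by (intro grad_eqI) (simp add: algebra_simps)
  have p: "E x powr (t - 1/2) * E x powr (?s - 1) = E x powr (-1)" "E x powr (t - 1/2) * E x powr ?s = 1"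
     "E x powr (t - 3/2) * E x powr ?s = E x powr (-1)"
    using E by (simp_all flip: powr_add)
  have "transformed_grad u (grad u) x = (?h' * E x powr (-1)) *\<^sub>R grad E x"
  proof -
    have "E x powr (t - 1/2) * (?h * ?s * E x powr (?s - 1) + ?h' * E x powr (-1) * E x powr ?s) + (t - 1/2) * E x powr (t - 3/2) * (?h * E x powr ?s)
      = ?h * ?s * (E x powr (t - 1/2) * E x powr (?s - 1)) + ?h' * E x powr (-1) * (E x powr (t - 1/2) * E x powr ?s)
       + (t - 1/2) * ?h * (E x powr (t - 3/2) * E x powr ?s)" by (simp add: algebra_simps)
    also have "\<dots> = ?h' * E x powr (-1)" unfolding p by (simp add: algebra_simps)
    finally show ?thesis unfolding transformed_grad_def g u[OF x] by (simp flip: scaleR_add_left)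
  qed
  then have "remainder_density u (grad u) x = E x * ((?h' * E x powr (-1))\<^sup>2 * normA_sq A x (grad E x))"
    unfolding remainder_density_def using normA_add[OF xU, of "?h' * E x powr (-1)" "grad E x" 0 0] by simp
  also have "\<dots> = ?h'\<^sup>2 * (normA_sq A x (grad E x) * (E x * (E x powr (-1))\<^sup>2))"
    by (simp only: power_mult_distrib mult.assoc mult.left_commute mult.commute)
  also have "E x * (E x powr (-1))\<^sup>2 = E x powr (-1)" using E by (simp add: powr_minus_divide power2_eq_square)
  finally show "remainder_density u (grad u) x = level_fun (\<lambda>s. (deriv h s)\<^sup>2) x" using x by (simp add: level_fun_def)
  have "hardy_density u x = ?h\<^sup>2 * (normA_sq A x (grad E x) * (E x powr (2 * t - 2) * (E x powr ?s)\<^sup>2))"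
    unfolding hardy_density_def u[OF x] by (simp add: power_mult_distrib)
  also have "E x powr (2 * t - 2) * (E x powr ?s)\<^sup>2 = E x powr (-1)"
    using E by (simp add: power2_eq_square flip: powr_add)
  finally show "hardy_density u x = level_fun (\<lambda>s. (h s)\<^sup>2) x" using x by (simp add: level_fun_def)
qed

text \<open>
  The family is obtained from one bump by stretching it by the factor \<open>R\<close>: the Hardy term grows like \<open>R\<close>
  and the remainder decays like \<open>1 / R\<close>. The last part expresses that
  \<open>\<integral>\<^sub>W |\<nabla>E|\<^sub>A\<^sup>2 / E\<close> is infinite.
\<close>
lemma optimal_family:
  obtains B D where "D > 0" "B \<ge> 0" "\<And>R. R > 0 \<Longrightarrow> \<exists>u\<in>test_functions U.
     nnint U (hardy_density u) = ennreal (R * D) \<and>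
     (nnint U (energy_density (grad u))) = ennreal (B / R + (t - 1/2)\<^sup>2 * (R * D))"
    "\<And>R. R > 0 \<Longrightarrow>
      ennreal (R * D) \<le> nnint U (\<lambda>x. indicator W x * (normA_sq A x (grad E x) * E x powr (-1)))"
proof -
  obtain m where m: "m > 0" "\<And>g a b. (\<And>n. Cn n UNIV g) \<Longrightarrow> \<tau> < a \<Longrightarrow> (\<And>s. s \<notin> {a..b} \<Longrightarrow> g s = 0) \<Longrightarrow>
    (\<integral>x. level_fun g x \<partial>lebesgue) = m * (\<integral>s. g s \<partial>lborel)"
    by (rule level_density) blast
  let ?\<psi> = "bump 1 2"
  define D where "D = m * (\<integral>s. (?\<psi> s)\<^sup>2 \<partial>lborel)"
  define B where "B = m * (\<integral>s. (deriv ?\<psi> s)\<^sup>2 \<partial>lborel)"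
  have \<psi>: "\<And>n. Cn n UNIV ?\<psi>" by (rule Cn_bump)
  have \<psi>0: "?\<psi> s = 0" if "s \<notin> {1..2}" for s using that by (rule bump_zero)
  have "(\<integral>s. (?\<psi> s)\<^sup>2 \<partial>lborel) > 0"
  proof (rule continuous_integral_pos[of _ 1 2 "3/2"])
    show "continuous_on UNIV (\<lambda>s. (?\<psi> s)\<^sup>2)" using Cn_continuous_on[OF \<psi>] by (rule continuous_on_power)
    show "(?\<psi> s)\<^sup>2 = 0" if "s \<notin> {1..2}" for s using \<psi>0[OF that] by simp
    show "(?\<psi> (3/2))\<^sup>2 \<noteq> 0" using bump_pos[of 1 "3/2" 2] by simp
  qed simp
  then have D: "D > 0" using m(1) by (simp add: D_def)
  have B: "B \<ge> 0" using m(1) by (simp add: B_def)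
  define h where "h R s = ?\<psi> ((s - \<tau>) / R)" for R s
  have h: "Cn n UNIV (h R)" for n R
  proof -
    have "Cn n UNIV (\<lambda>s::real. (1 / R) * (s \<bullet> 1 - \<tau>))" by (intro Cn_cmult Cn_diff Cn_inner Cn_const)
    then have "Cn n UNIV (\<lambda>s. (s - \<tau>) / R)" by simp
    then show ?thesis unfolding h_def[abs_def] by (intro Cn_compose[OF \<psi>]) auto
  qed
  have h0: "h R s = 0" if "R > 0" "s \<notin> {\<tau> + R..\<tau> + 2 * R}" for R s
    unfolding h_def by (rule \<psi>0) (use that in \<open>auto simp: field_simps\<close>)
  have h': "deriv (h R) s = deriv ?\<psi> ((s - \<tau>) / R) / R" if "R > 0" for R s
  proof (rule DERIV_imp_deriv)
    have "((\<lambda>s. (s - \<tau>) / R) has_real_derivative 1 / R) (at s)"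
      using that by (auto intro!: derivative_eq_intros)
    from DERIV_chain2[OF Cn_deriv(1)[OF \<psi>] this]
    show "(h R has_real_derivative deriv ?\<psi> ((s - \<tau>) / R) / R) (at s)"
      unfolding h_def[abs_def] by simp
  qed
  have h'0: "deriv (h R) s = 0" if R: "R > 0" and s: "s \<notin> {\<tau> + R..\<tau> + 2 * R}" for R s
  proof (rule DERIV_imp_deriv)
    have "open (- {\<tau> + R..\<tau> + 2 * R})" by auto
    then show "(h R has_real_derivative 0) (at s)"
      by (rule has_field_derivative_transform_within_open[OF DERIV_const[of 0]]) (use s h0[OF R] in auto)
  qed
  have I1: "(\<integral>s. (h R s)\<^sup>2 \<partial>lborel) = R * (\<integral>s. (?\<psi> s)\<^sup>2 \<partial>lborel)" if "R > 0" for R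
    using lborel_integral_real_affine[of R "\<lambda>s. (h R s)\<^sup>2" \<tau>] that by (simp add: h_def)
  have I2: "(\<integral>s. (deriv (h R) s)\<^sup>2 \<partial>lborel) = (\<integral>s. (deriv ?\<psi> s)\<^sup>2 \<partial>lborel) / R" if "R > 0" for R
    using lborel_integral_real_affine[of R "\<lambda>s. (deriv (h R) s)\<^sup>2" \<tau>] that
    by (simp add: h' power_divide power2_eq_square)
  have sq: "Cn n UNIV (\<lambda>s. (h R s)\<^sup>2)" "Cn n UNIV (\<lambda>s. (deriv (h R) s)\<^sup>2)" for n R
    by (intro Cn_power h Cn_deriv(2))+
  have q1: "(\<integral>x. level_fun (\<lambda>s. (h R s)\<^sup>2) x \<partial>lebesgue) = R * D"
    and q2: "(\<integral>x. level_fun (\<lambda>s. (deriv (h R) s)\<^sup>2) x \<partial>lebesgue) = B / R"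
    and n1: "nnint U (level_fun (\<lambda>s. (h R s)\<^sup>2)) = ennreal (R * D)"
    and n2: "nnint U (level_fun (\<lambda>s. (deriv (h R) s)\<^sup>2)) = ennreal (B / R)"
    if R: "R > 0" for R
  proof -
    have a: "\<tau> < \<tau> + R" using R by simp
    have z: "(h R s)\<^sup>2 = 0" "(deriv (h R) s)\<^sup>2 = 0" if "s \<notin> {\<tau> + R..\<tau> + 2 * R}" for s
      using h0[OF R that] h'0[OF R that] by auto
    show 1: "(\<integral>x. level_fun (\<lambda>s. (h R s)\<^sup>2) x \<partial>lebesgue) = R * D"
      using m(2)[OF sq(1) a z(1)] I1[OF R] by (simp add: D_def)
    show 2: "(\<integral>x. level_fun (\<lambda>s. (deriv (h R) s)\<^sup>2) x \<partial>lebesgue) = B / R"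
      using m(2)[OF sq(2) a z(2)] I2[OF R] by (simp add: B_def)
    show "nnint U (level_fun (\<lambda>s. (h R s)\<^sup>2)) = ennreal (R * D)"
      using nnint_level_fun[OF sq(1) a z(1)] 1 by simp
    show "nnint U (level_fun (\<lambda>s. (deriv (h R) s)\<^sup>2)) = ennreal (B / R)"
      using nnint_level_fun[OF sq(2) a z(2)] 2 by simp
  qed
  show ?thesis
  proof (rule that[OF D B])
    fix R :: real assume R: "R > 0"
    define u where "u x = (if x \<in> W then h R (ln (E x)) * E x powr (1/2 - t) else 0)" for x
    have u: "u \<in> test_functions W" unfolding u_def[abs_def]
      by (rule level_test_function[OF h _ h0[OF R]]) (use R in \<open>auto intro: Cn_subset[OF E_powr_smooth W_sub]\<close>)
    then have uU: "u \<in> test_functions U" using W_sub by (rule test_functions_mono)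
    obtain S where S: "compact S" "S \<subseteq> W" "\<And>x. x \<notin> S \<Longrightarrow> u x = 0" using u by (rule test_functionsE) blast
    have grad_out: "grad u x = 0" if "x \<notin> W" for x
      by (rule grad_zero_off_closed[OF compact_imp_closed[OF S(1)]], erule S(3)) (use that S(2) in blast)
    have r: "remainder_density u (grad u) x = level_fun (\<lambda>s. (deriv (h R) s)\<^sup>2) x" and hardy_density: "hardy_density u x = level_fun (\<lambda>s. (h R s)\<^sup>2) x" for x
    proof -
      have "remainder_density u (grad u) x = level_fun (\<lambda>s. (deriv (h R) s)\<^sup>2) x \<and> hardy_density u x = level_fun (\<lambda>s. (h R s)\<^sup>2) x"
      proof (cases "x \<in> W")
        case True
        then show ?thesis using level_function_densities[OF h True, of u R] by (simp add: u_def)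
      next
        case False
        then have "u x = 0" "grad u x = 0" using grad_out by (auto simp: u_def)
        then show ?thesis using False by (simp add: remainder_density_def hardy_density_def transformed_grad_def level_fun_def normA_sq_def)
      qed
      then show "remainder_density u (grad u) x = level_fun (\<lambda>s. (deriv (h R) s)\<^sup>2) x" "hardy_density u x = level_fun (\<lambda>s. (h R s)\<^sup>2) x" by auto
    qed
    have "has_weak_grad U u (grad u)"
      using has_weak_grad_smooth[OF open_U] uU by (auto simp: test_functions_iff intro: Cn_subset)
    from hardy_identity[OF test_lipschitz_functions[OF uU] this]
    have "nnint U (energy_density (grad u)) = nnint U (\<lambda>x. level_fun (\<lambda>s. (deriv (h R) s)\<^sup>2) x + (t - 1/2)\<^sup>2 * level_fun (\<lambda>s. (h R s)\<^sup>2) x)"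
      unfolding r hardy_density by simp
    also have "\<dots> = (\<integral>\<^sup>+x. ennreal (level_fun (\<lambda>s. (deriv (h R) s)\<^sup>2) x) + ennreal ((t - 1/2)\<^sup>2) * ennreal (level_fun (\<lambda>s. (h R s)\<^sup>2) x) \<partial>lebesgue_on U)"
      by (intro nn_integral_cong) (simp add: ennreal_plus ennreal_mult level_fun_nonneg)
    also have "\<dots> = ennreal (B / R) + ennreal ((t - 1/2)\<^sup>2) * ennreal (R * D)"
    proof -
      have "(\<lambda>x. level_fun k x) \<in> borel_measurable (lebesgue_on U)" if "level_fun k \<in> test_functions W" for k
        using continuous_lebesgue_measurable[OF test_continuous[OF that]] by (rule measurable_restrict_space1)
      moreover have "level_fun (\<lambda>s. (h R s)\<^sup>2) \<in> test_functions W"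
        by (rule level_fun_test_function[OF sq(1), of "\<tau> + R" "\<tau> + 2 * R"]) (use R h0[OF R] in auto)
      moreover have "level_fun (\<lambda>s. (deriv (h R) s)\<^sup>2) \<in> test_functions W"
        by (rule level_fun_test_function[OF sq(2), of "\<tau> + R" "\<tau> + 2 * R"]) (use R h'0[OF R] in auto)
      ultimately show ?thesis by (simp add: nn_integral_add nn_integral_cmult n1[OF R] n2[OF R])
    qed
    also have "\<dots> = ennreal (B / R + (t - 1/2)\<^sup>2 * (R * D))"
      using B D R by (simp add: ennreal_plus ennreal_mult)
    finally show "\<exists>u\<in>test_functions U.
       nnint U (hardy_density u) = ennreal (R * D) \<and>
       (nnint U (energy_density (grad u))) = ennreal (B / R + (t - 1/2)\<^sup>2 * (R * D))"
      using uU n1[OF R] unfolding hardy_density[symmetric] by blast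
  next
    fix R :: real assume R: "R > 0"
    show "ennreal (R * D) \<le> nnint U (\<lambda>x. indicator W x * (normA_sq A x (grad E x) * E x powr (-1)))"
      unfolding n1[OF R, symmetric]
    proof (intro nn_integral_mono ennreal_leI)
      fix x
      show "level_fun (\<lambda>s. (h R s)\<^sup>2) x \<le> indicator W x * (normA_sq A x (grad E x) * E x powr (-1))"
      proof (cases "x \<in> W")
        case True
        have "(h R (ln (E x)))\<^sup>2 \<le> 1" unfolding h_def using bump_nonneg bump_le_1 by (simp add: power_le_one)
        moreover have "0 \<le> normA_sq A x (grad E x) * E x powr (-1)"
          using True W_sub normA_nonneg by (intro mult_nonneg_nonneg) auto
        ultimately have "(h R (ln (E x)))\<^sup>2 * (normA_sq A x (grad E x) * E x powr (-1)) \<le> 1 * (normA_sq A x (grad E x) * E x powr (-1))"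
          by (rule mult_right_mono)
        then show ?thesis using True by (simp only: level_fun_def if_True indicator_simps)
      qed (simp add: level_fun_def)
    qed
  qed
qed

text \<open>
  Equality forces \<open>v = E\<^bsup>t - 1/2\<^esup> u\<close> to be constant on \<open>W\<close>, and a nonzero constant would make the Hardy
  term infinite.
\<close>
lemma equality_imp_locally_zero:
  assumes G: "has_weak_grad U u G"
    and fin: "nnint U (energy_density G) < \<infinity>"
    and le: "nnint U (\<lambda>x. remainder_density u G x + (t - 1/2)\<^sup>2 * hardy_density u x) \<le> nnint U (energy_density G)"
    and eq: "nnint U (energy_density G) = ennreal ((t - 1/2)\<^sup>2) * nnint U (hardy_density u)"
    and t: "t \<noteq> 1/2" and x0: "x0 \<in> W"
  shows "\<exists>r>0. AE x in lebesgue. x \<in> ball x0 r \<longrightarrow> u x = 0"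
proof -
  have mU: "U \<inter> space lebesgue \<in> sets lebesgue" using open_U by simp
  have mu: "u \<in> borel_measurable (lebesgue_on U)" and mG: "\<And>i. (\<lambda>x. G x $ i) \<in> borel_measurable (lebesgue_on U)"
    using has_weak_gradD(1,2)[OF G] locally_integrable_measurable[OF open_U] by auto
  have mr: "remainder_density u G \<in> borel_measurable (lebesgue_on U)" and mh: "hardy_density u \<in> borel_measurable (lebesgue_on U)"
    by (intro remainder_density_measurable hardy_density_measurable mu mG)+
  have "nnint U (\<lambda>x. remainder_density u G x + (t - 1/2)\<^sup>2 * hardy_density u x)
     = (\<integral>\<^sup>+x. ennreal (remainder_density u G x) + ennreal ((t - 1/2)\<^sup>2) * ennreal (hardy_density u x) \<partial>lebesgue_on U)"
    by (intro nn_integral_cong) (simp add: ennreal_plus ennreal_mult remainder_density_nonneg hardy_density_nonneg)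
  also have "\<dots> = nnint U (remainder_density u G) + ennreal ((t - 1/2)\<^sup>2) * nnint U (hardy_density u)"
    using mr mh by (simp add: nn_integral_add nn_integral_cmult)
  also have "\<dots> = nnint U (remainder_density u G) + nnint U (energy_density G)"
    unfolding eq ..
  finally have "nnint U (remainder_density u G) + nnint U (energy_density G)
      \<le> nnint U (energy_density G)" using le by simp
  then have "nnint U (energy_density G) + nnint U (remainder_density u G)
      \<le> nnint U (energy_density G) + 0" by (simp only: add.commute add_0)
  then have "nnint U (remainder_density u G) \<le> 0"
    using fin by (subst (asm) ennreal_add_left_cancel_le) auto
  then have "nnint U (remainder_density u G) = 0" by simp
  then have "AE x in lebesgue_on U. ennreal (remainder_density u G x) = 0"
    using mr by (subst (asm) nn_integral_0_iff_AE) auto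
  then have aeW: "AE x in lebesgue. x \<in> U \<longrightarrow> transformed_grad u G x = 0"
    unfolding AE_restrict_space_iff[OF mU]
  proof eventually_elim
    case (elim x)
    show ?case
    proof
      assume x: "x \<in> U"
      then have "remainder_density u G x = 0" using elim remainder_density_nonneg[OF x, of u G] by (simp add: ennreal_eq_0_iff)
      then have "normA_sq A x (transformed_grad u G x) = 0" using E_pos[OF x] by (simp add: remainder_density_def)
      then show "transformed_grad u G x = 0" using elliptic[OF x, of "transformed_grad u G x"] c_pos by (simp add: mult_le_0_iff)
    qed
  qed
  define v where "v x = E x powr (t - 1/2) * u x" for x
  let ?p = "t - 1/2"
  have cp: "continuous_on U (\<lambda>x. E x powr r)" for r by (intro Cn_continuous_on E_powr_smooth)
  have vli: "locally_integrable U v"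
    unfolding locally_integrable_def set_integrable_def
  proof (intro allI impI)
    fix S assume "compact S \<and> S \<subseteq> U"
    then have S: "compact S" "S \<subseteq> U" by auto
    obtain \<eta> V where \<eta>: "\<eta> \<in> test_functions U" "S \<subseteq> V" "\<And>x. x \<in> V \<Longrightarrow> \<eta> x = 1"
      using smooth_cutoff[OF S(1) open_U S(2)] by metis
    let ?w = "\<lambda>x. if x \<in> U then E x powr ?p * \<eta> x else 0"
    have w: "?w \<in> test_functions U" by (rule test_functions_mult_smooth[OF open_U E_powr_smooth \<eta>(1)])
    have i: "integrable lebesgue (\<lambda>x. u x * ?w x)"
      by (rule integrable_mult_test(1)[OF has_weak_gradD(1)[OF G] w])
    have i2: "integrable lebesgue (\<lambda>x. indicator S x *\<^sub>R (u x * ?w x))"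
      using S(1) i by (intro integrable_mult_indicator) (auto simp: compact_imp_closed)
    have eq: "indicator S x *\<^sub>R (u x * ?w x) = indicator S x *\<^sub>R v x" for x
      using S(2) \<eta>(2,3) by (cases "x \<in> S") (auto simp: v_def dest!: subsetD)
    show "integrable lebesgue (\<lambda>x. indicator S x *\<^sub>R v x)" using i2 unfolding eq .
  qed
  have v0: "(LINT x:U|lebesgue. v x * pd i \<psi> x) = 0" if \<psi>: "\<psi> \<in> test_functions U" for \<psi> i
  proof -
    let ?w = "\<lambda>x. if x \<in> U then E x powr ?p * \<psi> x else 0"
    have w: "?w \<in> test_functions U" by (rule test_functions_mult_smooth[OF open_U E_powr_smooth \<psi>])
    let ?k = "\<lambda>x. if x \<in> U then (?p * E x powr (t - 3/2) * pd i E x) * \<psi> x else 0"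
    have k: "?k \<in> test_functions U"
      by (intro test_functions_mult_smooth[OF open_U _ \<psi>] Cn_mult Cn_const E_powr_smooth Cn_pd E_smooth open_U)
    let ?l = "\<lambda>x. if x \<in> U then E x powr ?p * pd i \<psi> x else 0"
    have l: "?l \<in> test_functions U"
      by (rule test_functions_mult_smooth[OF open_U E_powr_smooth test_functions_pd[OF \<psi>]])
    have pw: "pd i ?w x = ?l x + ?k x" if x: "x \<in> U" for x
    proof -
      have d: "(\<lambda>x. E x powr ?p) differentiable (at x)" "\<psi> differentiable (at x)"
        using Cn_differentiable[OF E_powr_smooth x] test_differentiable[OF \<psi>] by auto
      from has_derivative_pd[OF E_powr_derivative[OF x, of ?p], of i]
      have p: "pd i (\<lambda>y. E y powr ?p) x = ?p * E x powr (t - 3/2) * pd i E x" by (simp add: inner_axis)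
      have "pd i ?w x = pd i (\<lambda>x. E x powr ?p * \<psi> x) x"
        by (rule pd_cong[OF open_U x]) (use d in auto)
      then show ?thesis using x by (simp add: pd_mult[OF d] p)
    qed
    note int = set_integrable_mult_test[OF open_U]
    have e0: "(LINT x:U|lebesgue. u x * pd i ?w x) = - (LINT x:U|lebesgue. G x $ i * ?w x)"
      by (rule has_weak_gradD(3)[OF G w])
    have e1: "(LINT x:U|lebesgue. u x * pd i ?w x) = (LINT x:U|lebesgue. u x * ?l x) + (LINT x:U|lebesgue. u x * ?k x)"
    proof -
      have "(LINT x:U|lebesgue. u x * pd i ?w x) = (LINT x:U|lebesgue. u x * ?l x + u x * ?k x)"
        unfolding set_lebesgue_integral_def
      proof (intro Bochner_Integration.integral_cong refl)
        fix x
        show "indicat_real U x *\<^sub>R (u x * pd i ?w x) = indicat_real U x *\<^sub>R (u x * ?l x + u x * ?k x)"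
        proof (cases "x \<in> U")
          case True
          show ?thesis unfolding pw[OF True] by (simp add: distrib_left)
        qed simp
      qed
      also have "\<dots> = (LINT x:U|lebesgue. u x * ?l x) + (LINT x:U|lebesgue. u x * ?k x)"
        by (intro set_integral_add(2) int l k has_weak_gradD(1)[OF G])
      finally show ?thesis .
    qed
    have e2: "(LINT x:U|lebesgue. u x * ?k x) + (LINT x:U|lebesgue. G x $ i * ?w x) = 0"
    proof -
      have "(LINT x:U|lebesgue. u x * ?k x) + (LINT x:U|lebesgue. G x $ i * ?w x) = (LINT x:U|lebesgue. u x * ?k x + G x $ i * ?w x)"
        by (intro set_integral_add(2)[symmetric] int w k has_weak_gradD[OF G])
      also have "\<dots> = 0" unfolding set_lebesgue_integral_def
      proof (rule integral_eq_zero_AE)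
        show "AE x in lebesgue. indicat_real U x *\<^sub>R (u x * ?k x + G x $ i * ?w x) = 0"
          using aeW
        proof eventually_elim
          case (elim x)
          show ?case
          proof (cases "x \<in> U")
            case True
            have "u x * ?k x + G x $ i * ?w x = (transformed_grad u G x $ i) * \<psi> x"
              using True by (simp add: transformed_grad_def algebra_simps)
            then show ?thesis using elim True by simp
          qed simp
        qed
      qed
      finally show ?thesis .
    qed
    have "(LINT x:U|lebesgue. v x * pd i \<psi> x) = (LINT x:U|lebesgue. u x * ?l x)"
      unfolding set_lebesgue_integral_def v_def
      by (intro Bochner_Integration.integral_cong refl) (auto split: split_indicator)
    then show ?thesis using e0 e1 e2 by simp
  qed
  have lc: "\<exists>r>0. \<exists>c. AE x in lebesgue. x \<in> ball y r \<longrightarrow> v x = c" if "y \<in> U" for y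
    by (rule weak_grad_zero_locally_constant[OF open_U vli v0 that])
  have "\<forall>y. \<exists>p. y \<in> U \<longrightarrow> fst p > 0 \<and> (AE x in lebesgue. x \<in> ball y (fst p) \<longrightarrow> v x = snd p)"
  proof
    fix y
    show "\<exists>p. y \<in> U \<longrightarrow> fst p > 0 \<and> (AE x in lebesgue. x \<in> ball y (fst p) \<longrightarrow> v x = snd p)"
    proof (cases "y \<in> U")
      case True
      then obtain r c where "r > 0" "AE x in lebesgue. x \<in> ball y r \<longrightarrow> v x = c" using lc by blast
      then show ?thesis by (intro exI[of _ "(r, c)"]) simp
    qed simp
  qed
  from choice[OF this] obtain P where P: "\<forall>y. y \<in> U \<longrightarrow> fst (P y) > 0 \<and> (AE x in lebesgue. x \<in> ball y (fst (P y)) \<longrightarrow> v x = snd (P y))"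
    by blast
  define r where "r y = fst (P y)" for y
  define k where "k y = snd (P y)" for y
  have rk: "r y > 0" "AE x in lebesgue. x \<in> ball y (r y) \<longrightarrow> v x = k y" if "y \<in> U" for y
    using P that by (auto simp: r_def k_def)
  \<comment> \<open>Two overlapping balls have the same constant, as their intersection is not a null set.\<close>
  have kloc: "k y = k z" if "y \<in> U" "z \<in> U" "z \<in> ball y (r y)" for y z
  proof (rule ccontr)
    assume ne: "k y \<noteq> k z"
    have "AE x in lebesgue. x \<notin> ball y (r y) \<inter> ball z (r z)"
      using rk(2)[OF that(1)] rk(2)[OF that(2)] by eventually_elim (use ne in auto)
    moreover have "z \<in> ball y (r y) \<inter> ball z (r z)" using that rk(1) by simp
    ultimately show False using not_AE_outside_open[of "ball y (r y) \<inter> ball z (r z)"] by blast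
  qed
  have kW: "k y = k x0" if "y \<in> W" for y
  proof (rule connected_local_const[OF W_connected that x0], intro ballI)
    fix a assume a: "a \<in> W"
    then have aU: "a \<in> U" using W_sub by blast
    have "eventually (\<lambda>b. b \<in> ball a (r a) \<and> b \<in> W) (at a within W)"
      unfolding eventually_at using rk(1)[OF aU] by (intro exI[of _ "r a"]) (auto simp: dist_commute)
    then show "eventually (\<lambda>b. k a = k b) (at a within W)"
      by eventually_elim (use kloc aU W_sub in blast)
  qed
  have aeW': "AE x in lebesgue. x \<in> W \<longrightarrow> v x = k x0"
  proof (rule AE_local)
    fix y assume y: "y \<in> W"
    then have "y \<in> U" using W_sub by blast
    then show "\<exists>V. open V \<and> y \<in> V \<and> (AE x in lebesgue. x \<in> V \<longrightarrow> v x = k x0)"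
      using rk[of y] kW[OF y] by (intro exI[of _ "ball y (r y)"]) simp
  qed
  have "k x0 = 0"
  proof (rule ccontr)
    assume k0: "k x0 \<noteq> 0"
    \<comment> \<open>The Hardy term of \<open>u\<close> is at least \<open>(k x0)\<^sup>2 * (R * D)\<close> for every \<open>R\<close>.\<close>
    obtain B D where D: "D > 0" and 
      lower: "\<And>R. R > 0 \<Longrightarrow>
      ennreal (R * D) \<le> nnint U (\<lambda>x. indicator W x * (normA_sq A x (grad E x) * E x powr (-1)))"
      by (rule optimal_family) blast
    let ?K = "(k x0)\<^sup>2"
    let ?f = "\<lambda>x. indicator W x * (normA_sq A x (grad E x) * E x powr (-1))"
    have "AE x in lebesgue_on U. ennreal ?K * ennreal (?f x) \<le> ennreal (hardy_density u x)"
      unfolding AE_restrict_space_iff[OF mU] using aeW'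
    proof eventually_elim
      case (elim x)
      show ?case
      proof
        assume x: "x \<in> U"
        show "ennreal ?K * ennreal (?f x) \<le> ennreal (hardy_density u x)"
        proof (cases "x \<in> W")
          case True
          have Ex: "E x > 0" using E_pos[OF x] .
          have "k x0 = E x powr ?p * u x" using elim True by (simp add: v_def)
          then have K: "?K = (E x powr ?p)\<^sup>2 * (u x)\<^sup>2" by (simp only: power_mult_distrib)
          have p: "(E x powr ?p)\<^sup>2 * E x powr (-1) = E x powr (2 * t - 2)"
          proof -
            have "(E x powr ?p)\<^sup>2 * E x powr (-1) = E x powr (?p + ?p + (-1))"
              by (simp only: power2_eq_square powr_add)
            also have "?p + ?p + (-1) = 2 * t - 2" by simp
            finally show ?thesis .
          qed
          have f: "?f x = normA_sq A x (grad E x) * E x powr (-1)" using True by (simp only: indicator_simps mult_1)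
          have "?K * ?f x = normA_sq A x (grad E x) * ((E x powr ?p)\<^sup>2 * E x powr (-1)) * (u x)\<^sup>2"
            unfolding K f by (simp only: mult_ac)
          also have "\<dots> = hardy_density u x" unfolding p hardy_density_def ..
          finally have "?K * ?f x = hardy_density u x" .
          moreover have "0 \<le> ?f x" unfolding f using normA_nonneg[OF x] by (intro mult_nonneg_nonneg) auto
          ultimately show ?thesis by (simp only: ennreal_mult[symmetric] zero_le_power2 order_refl)
        qed simp
      qed
    qed
    then have "(\<integral>\<^sup>+x. ennreal ?K * ennreal (?f x) \<partial>lebesgue_on U) \<le> nnint U (hardy_density u)"
      by (rule nn_integral_mono_AE)
    moreover have "(\<integral>\<^sup>+x. ennreal ?K * ennreal (?f x) \<partial>lebesgue_on U) = ennreal ?K * nnint U ?f"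
    proof (rule nn_integral_cmult)
      have "W \<inter> U \<in> sets (lebesgue_on U)" using open_W open_U by (auto simp: sets_restrict_space_iff)
      then have "W \<in> sets (lebesgue_on U)" using W_sub by (simp add: inf.absorb1)
      moreover have "(\<lambda>x. grad E x $ i) \<in> borel_measurable (lebesgue_on U)" for i
        unfolding grad_nth by (rule gradE_measurable)
      ultimately have "?f \<in> borel_measurable (lebesgue_on U)"
        by (intro borel_measurable_times borel_measurable_indicator normA_measurable powr_measurable)
      then show "(\<lambda>x. ennreal (?f x)) \<in> borel_measurable (lebesgue_on U)" by simp
    qed
    moreover have "nnint U (hardy_density u) < \<infinity>"
    proof -
      have "(t - 1/2)\<^sup>2 > 0" using t by simp
      then show ?thesis using fin unfolding eq by (auto simp: ennreal_mult_less_top)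
    qed
    ultimately have "ennreal ?K * nnint U ?f < \<infinity>" by simp
    then have "nnint U ?f < \<infinity>" using k0 by (auto simp: ennreal_mult_less_top)
    then obtain z where z: "z \<ge> 0" "nnint U ?f = ennreal z"
      by (cases "nnint U ?f") auto
    have "ennreal ((z + 1) / D * D) \<le> ennreal z" unfolding z(2)[symmetric]
      by (rule lower) (use z(1) D in auto)
    then show False using D z(1) by (simp add: ennreal_le_iff)
  qed
  have x0U: "x0 \<in> U" using x0 W_sub by blast
  obtain r1 where r1: "r1 > 0" "ball x0 r1 \<subseteq> U" using open_contains_ball[of U] open_U x0U by blast
  have "AE x in lebesgue. x \<in> ball x0 (min (r x0) r1) \<longrightarrow> u x = 0"
    using rk(2)[OF x0U]
  proof eventually_elim
    case (elim x)
    show ?case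
    proof
      assume x: "x \<in> ball x0 (min (r x0) r1)"
      then have "v x = 0" using elim \<open>k x0 = 0\<close> by simp
      moreover have "E x > 0" using x r1(2) by (intro E_pos) auto
      ultimately show "u x = 0" by (simp add: v_def)
    qed
  qed
  then show ?thesis using rk(1)[OF x0U] r1(1) by (intro exI[of _ "min (r x0) r1"]) simp
qed

end

section \<open>Interior weights\<close>

lemma smooth_up_to_Cn: "open U \<Longrightarrow> smooth_up_to U T f \<Longrightarrow> Cn n U f"
  by (simp add: smooth_up_to_def smooth_in_iff_Cn)

text \<open>
  The limit in the definition of the box dimension exceeds 2, so the neighbourhoods \<open>K\<^sub>r\<close> satisfy
  \<open>0 < |K\<^sub>r| < r\<close> for small \<open>r\<close>.
\<close>
lemma box_dim_imp_null:
  fixes \<Omega> :: "(real^'n::finite) set"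
  assumes "open \<Omega>" "\<Omega> \<noteq> {}" "bounded \<Omega>" "K \<subseteq> \<Omega>" "compact K" "has_box_dim \<Omega> K d" "d < real CARD('n) - 2"
  shows "K \<noteq> {}" "K \<in> null_sets lebesgue"
proof -
  let ?N = "\<lambda>r. {x\<in>\<Omega>. infdist x K < r}"
  have oN: "open (?N r)" for r
  proof -
    have "open {x. infdist x K < r}" by (intro open_Collect_less continuous_intros)
    then have "open (\<Omega> \<inter> {x. infdist x K < r})" using assms(1) by (rule open_Int[rotated])
    then show ?thesis by (simp add: Int_def)
  qed
  have lN: "?N r \<in> lmeasurable" for r
    using oN[of r] assms(3) by (intro lmeasurable_open) (auto intro: bounded_subset)
  have "eventually (\<lambda>r. 1 < ln (measure lebesgue (?N r)) / ln r) (at_right 0)"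
    using assms(6,7) unfolding has_box_dim_def by (intro order_tendstoD) auto
  moreover have "eventually (\<lambda>r::real. r \<in> {0<..<1}) (at_right 0)" by (rule eventually_at_right_real) simp
  ultimately have ev: "eventually (\<lambda>r. 0 < r \<and> 0 < measure lebesgue (?N r) \<and> measure lebesgue (?N r) < r) (at_right 0)"
  proof eventually_elim
    case (elim r)
    then have r: "0 < r" "ln r < 0" by auto
    \<comment> \<open>The default value \<open>ln 0 = 0\<close> would make the quotient of logarithms zero.\<close>
    have m0: "measure lebesgue (?N r) > 0"
    proof (rule ccontr)
      assume "\<not> ?thesis"
      then have "measure lebesgue (?N r) = 0" using measure_nonneg[of lebesgue "?N r"] by linarith
      then show False using elim by simp
    qed
    have "ln (measure lebesgue (?N r)) < ln r" using elim(1) r(2) by (simp add: neg_less_divide_eq)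
    then have "measure lebesgue (?N r) < r" using m0 r(1) by simp
    then show ?case using r m0 by simp
  qed
  show "K \<noteq> {}"
  proof
    assume "K = {}"
    then have e: "?N r = \<Omega>" if "0 < r" for r using that by (simp add: infdist_def)
    have ev1: "eventually (\<lambda>r. measure lebesgue \<Omega> < r \<and> 0 < measure lebesgue \<Omega>) (at_right 0)"
      using ev
    proof eventually_elim
      case (elim r)
      then show ?case using e[of r] by simp
    qed
    then have "0 < measure lebesgue \<Omega>"
      using eventually_happens'[OF _ ev1] by auto
    then have "eventually (\<lambda>r. r \<in> {0<..<measure lebesgue \<Omega>}) (at_right 0)" by (rule eventually_at_right_real)
    with ev1 have "eventually (\<lambda>r::real. False) (at_right 0)" by eventually_elim auto
    then show False by simp
  qed
  have mK: "K \<in> lmeasurable" using assms(5) by (rule lmeasurable_compact)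
  have "eventually (\<lambda>r. measure lebesgue K < r) (at_right 0)"
    using ev
  proof eventually_elim
    case (elim r)
    have "K \<subseteq> ?N r" using elim assms(4) by auto
    then have "measure lebesgue K \<le> measure lebesgue (?N r)" by (rule measure_mono_fmeasurable[OF _ fmeasurableD[OF mK] lN])
    then show ?case using elim by linarith
  qed
  then have "measure lebesgue K = 0"
  proof -
    have "\<not> 0 < measure lebesgue K"
    proof
      assume "0 < measure lebesgue K"
      have "eventually (\<lambda>r. r < measure lebesgue K) (at_right 0)"
        using eventually_at_right_real[OF \<open>0 < measure lebesgue K\<close>] by eventually_elim simp
      with \<open>eventually (\<lambda>r. measure lebesgue K < r) (at_right 0)\<close>
      have "eventually (\<lambda>r::real. False) (at_right 0)" by eventually_elim simp
      then show False by simp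
    qed
    then show ?thesis using measure_nonneg[of lebesgue K] by linarith
  qed
  then show "K \<in> null_sets lebesgue" 
    by (intro null_setsI fmeasurableD[OF mK]) (simp only: emeasure_eq_measure2[OF mK] ennreal_0)
qed

lemma integral_outside_support_zero:
  fixes \<Omega> :: "(real^'n::finite) set"
  assumes sets: "sets \<mu> = sets (restrict_space borel \<Omega>)" and "open \<Omega>"
    and \<phi>: "\<And>x. x \<notin> \<Omega> - supp_measure \<Omega> \<mu> \<Longrightarrow> \<phi> x = 0"
  shows "(\<integral>x. \<phi> x \<partial>\<mu>) = (0::real)"
proof (rule integral_eq_zero_AE)
  let ?U = "\<Omega> - supp_measure \<Omega> \<mu>"
  have "AE y in \<mu>. y \<in> ?U \<longrightarrow> False"
  proof (rule AE_local)
    fix x assume "x \<in> ?U"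
    then obtain V where V: "open V" "x \<in> V" "emeasure \<mu> (V \<inter> \<Omega>) = 0"
      by (auto simp: supp_measure_def not_gr_zero)
    have "V \<inter> \<Omega> \<in> sets \<mu>" unfolding sets using V(1) assms(2) by (auto simp: sets_restrict_space_iff)
    then have "V \<inter> \<Omega> \<in> null_sets \<mu>" using V(3) by (simp add: null_sets_def)
    then have "AE y in \<mu>. y \<notin> V \<inter> \<Omega>" by (rule AE_not_in)
    then have "AE y in \<mu>. y \<in> V \<inter> \<Omega> \<longrightarrow> False" by eventually_elim simp
    moreover have "open (V \<inter> \<Omega>)" using V(1) assms(2) by (rule open_Int)
    moreover have "x \<in> V \<inter> \<Omega>" using V(2) \<open>x \<in> ?U\<close> by blast
    ultimately show "\<exists>V. open V \<and> x \<in> V \<and> (AE y in \<mu>. y \<in> V \<longrightarrow> False)"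
      by blast
  qed
  then show "AE x in \<mu>. \<phi> x = 0" by eventually_elim (use \<phi> in blast)
qed

text \<open>
  A smooth solution in the sense of distributions is a solution almost everywhere; both derivatives are
  moved back from the test function to \<open>E\<close>, using the symmetry of \<open>A\<close>.
\<close>
lemma distributional_harmonic:
  fixes \<Omega> :: "(real^'n::finite) set"
  assumes \<Omega>: "open \<Omega>" and U: "open U" "U \<subseteq> \<Omega>"
    and A: "\<And>n i j. Cn n U (\<lambda>x. A x $ i $ j)" and sym: "\<And>x. x \<in> U \<Longrightarrow> transpose (A x) = A x"
    and E: "\<And>n. Cn n U E"
    and 0: "\<And>\<phi>. \<phi> \<in> test_functions U \<Longrightarrow> (LINT x:\<Omega>|lebesgue. E x * div_A_grad A \<phi> x) = 0"
  shows "AE x in lebesgue. x \<in> U \<longrightarrow> div_A_grad A E x = 0"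
proof -
  let ?b = "\<lambda>f i x. (A x *v grad f x) $ i"
  have b_eq: "?b f i x = (\<Sum>j\<in>UNIV. A x $ i $ j * pd j f x)" for f i x
    by (simp add: matrix_vector_mult_def)
  have bC: "Cn n U (?b f i)" if "\<And>n. Cn n U f" for f n i
    unfolding b_eq by (intro Cn_sum Cn_mult A Cn_pd that U(1))
  have dC: "Cn n U (div_A_grad A E)" for n
    unfolding div_A_grad_def[abs_def] by (intro Cn_sum Cn_pd bC E U(1))
  show ?thesis
  proof (rule du_bois_reymond[OF U(1)])
    show "locally_integrable U (div_A_grad A E)" by (intro continuous_locally_integrable Cn_continuous_on dC)
    fix \<phi> assume \<phi>: "\<phi> \<in> test_functions U"
    obtain S where S: "compact S" "S \<subseteq> U" "\<And>x. x \<notin> S \<Longrightarrow> \<phi> x = 0" using \<phi> by (rule test_functionsE) blast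
    have \<phi>C: "Cn n U \<phi>" for n using \<phi> by (auto simp: test_functions_iff intro: Cn_subset)
    define w where "w i x = (if x \<in> U then ?b \<phi> i x else 0)" for i x
    have g0: "pd j \<phi> x = 0" if "x \<notin> S" for x j
      using has_derivative_pd[OF has_derivative_zero_off_closed[OF compact_imp_closed[OF S(1)] S(3) that]] .
    have b0: "?b \<phi> i x = 0" if "x \<notin> S" for x i unfolding b_eq by (simp add: g0[OF that])
    have w: "w i \<in> test_functions U" for i
      unfolding w_def[abs_def] by (rule test_functions_extend[OF U(1) bC[OF \<phi>C] S(1,2,2)]) (rule b0)
    have div: "indicator \<Omega> x *\<^sub>R (E x * div_A_grad A \<phi> x) = (\<Sum>i\<in>UNIV. indicator U x *\<^sub>R (E x * pd i (w i) x))" for x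
    proof (cases "x \<in> U")
      case True
      have "pd i (w i) x = pd i (?b \<phi> i) x" for i
        by (rule pd_cong[OF U(1) True _ Cn_differentiable[OF bC[OF \<phi>C] True]]) (simp add: w_def)
      then show ?thesis using True U(2) by (auto simp: div_A_grad_def sum_distrib_left)
    next
      case False
      then have "x \<in> - S" using S(2) by blast
      have "pd i (?b \<phi> i) x = 0" for i
      proof (rule has_derivative_pd[OF has_derivative_zero_off_closed[OF compact_imp_closed[OF S(1)]]])
        show "x \<notin> S" using \<open>x \<in> - S\<close> by simp
      qed (rule b0)
      then show ?thesis using False by (simp add: div_A_grad_def)
    qed
    have pE: "Cn n U (pd i E)" for n i by (intro Cn_pd E U(1))
    have i1: "integrable lebesgue (\<lambda>x. indicator U x *\<^sub>R (E x * pd i (w i) x))" for i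
      by (rule test_extend_integrable[OF U(1) E test_functions_pd[OF w]])
    have i2: "integrable lebesgue (\<lambda>x. indicator U x *\<^sub>R (pd i E x * w i x))" for i
      by (rule test_extend_integrable[OF U(1) pE w])
    have i3: "integrable lebesgue (\<lambda>x. indicator U x *\<^sub>R (?b E i x * pd i \<phi> x))" for i
      by (rule test_extend_integrable[OF U(1) bC[OF E] test_functions_pd[OF \<phi>]])
    have i4: "integrable lebesgue (\<lambda>x. indicator U x *\<^sub>R (pd i (?b E i) x * \<phi> x))" for i
      by (rule test_extend_integrable[OF U(1) Cn_pd[OF bC[OF E] U(1)] \<phi>])
    have "0 = (LINT x:\<Omega>|lebesgue. E x * div_A_grad A \<phi> x)" using 0[OF \<phi>] by simp
    also have "\<dots> = (\<Sum>i\<in>UNIV. LINT x:U|lebesgue. E x * pd i (w i) x)"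
      unfolding set_lebesgue_integral_def div by (rule Bochner_Integration.integral_sum[OF i1])
    also have "\<dots> = - (\<Sum>i\<in>UNIV. LINT x:U|lebesgue. pd i E x * w i x)"
      by (simp only: integration_by_parts[OF U(1) E w] sum_negf)
    also have "(\<Sum>i\<in>UNIV. LINT x:U|lebesgue. pd i E x * w i x) = (\<integral>x. (\<Sum>i\<in>UNIV. indicator U x *\<^sub>R (pd i E x * w i x)) \<partial>lebesgue)"
      unfolding set_lebesgue_integral_def by (rule Bochner_Integration.integral_sum[OF i2, symmetric])
    also have "\<dots> = (\<integral>x. (\<Sum>i\<in>UNIV. indicator U x *\<^sub>R (?b E i x * pd i \<phi> x)) \<partial>lebesgue)"
    proof (intro Bochner_Integration.integral_cong refl)
      fix x
      show "(\<Sum>i\<in>UNIV. indicat_real U x *\<^sub>R (pd i E x * w i x)) = (\<Sum>i\<in>UNIV. indicat_real U x *\<^sub>R (?b E i x * pd i \<phi> x))"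
      proof (cases "x \<in> U")
        case True
        have "(\<Sum>i\<in>UNIV. pd i E x * w i x) = grad E x \<bullet> (A x *v grad \<phi> x)"
          using True by (simp add: w_def inner_vec_def)
        also have "\<dots> = (A x *v grad E x) \<bullet> grad \<phi> x"
          using sym[OF True] by (metis dot_lmul_matrix transpose_matrix_vector)
        also have "\<dots> = (\<Sum>i\<in>UNIV. ?b E i x * pd i \<phi> x)" by (simp add: inner_vec_def)
        finally show ?thesis using True by simp
      qed simp
    qed
    also have "\<dots> = (\<Sum>i\<in>UNIV. LINT x:U|lebesgue. ?b E i x * pd i \<phi> x)"
      unfolding set_lebesgue_integral_def by (rule Bochner_Integration.integral_sum[OF i3])
    also have "\<dots> = - (\<Sum>i\<in>UNIV. LINT x:U|lebesgue. pd i (?b E i) x * \<phi> x)"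
      by (simp only: integration_by_parts[OF U(1) bC[OF E] \<phi>] sum_negf)
    also have "(\<Sum>i\<in>UNIV. LINT x:U|lebesgue. pd i (?b E i) x * \<phi> x) = (\<integral>x. (\<Sum>i\<in>UNIV. indicator U x *\<^sub>R (pd i (?b E i) x * \<phi> x)) \<partial>lebesgue)"
      unfolding set_lebesgue_integral_def by (rule Bochner_Integration.integral_sum[OF i4, symmetric])
    also have "\<dots> = (LINT x:U|lebesgue. div_A_grad A E x * \<phi> x)"
      unfolding set_lebesgue_integral_def div_A_grad_def
      by (intro Bochner_Integration.integral_cong refl) (auto simp: sum_distrib_right split: split_indicator)
    finally show "(LINT x:U|lebesgue. div_A_grad A E x * \<phi> x) = 0" by simp
  qed
qed

text \<open>
  Near the boundary of \<open>\<Omega>\<close> the weight is bounded, because it extends continuously; so high level sets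
  stay near \<open>K\<close>. They are closed because \<open>E\<close> tends to infinity at \<open>K\<close>. A component of \<open>\<Omega> - K\<close> whose
  closure misses \<open>K\<close> would be open and closed in \<open>\<Omega>\<close>.
\<close>
lemma level_sets_of_weight:
  fixes \<Omega> :: "(real^'n::finite) set" and E g :: "real^'n \<Rightarrow> real"
  assumes \<Omega>: "open \<Omega>" "connected \<Omega>" "bounded \<Omega>" and K: "compact K" "K \<subseteq> \<Omega>" "K \<noteq> {}"
    and E: "continuous_on (\<Omega> - K) E" "\<And>x. x \<in> \<Omega> - K \<Longrightarrow> E x > 0"
    and g: "continuous_on (closure \<Omega> - K) g" "\<And>x. x \<in> \<Omega> - K \<Longrightarrow> g x = E x"
    and blow: "\<And>x. x \<in> K \<Longrightarrow> filterlim E at_top (at x within \<Omega> - K)"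
  obtains \<tau> where "\<And>x0 a b. x0 \<in> \<Omega> - K \<Longrightarrow> \<tau> < a \<Longrightarrow>
      compact {x\<in>connected_component_set (\<Omega> - K) x0. a \<le> ln (E x) \<and> ln (E x) \<le> b}"
    "\<And>x0 b. x0 \<in> \<Omega> - K \<Longrightarrow> \<exists>x\<in>connected_component_set (\<Omega> - K) x0. ln (E x) > b"
proof -
  let ?U = "\<Omega> - K"
  have cK: "closed K" using K(1) by (rule compact_imp_closed)
  have oU: "open ?U" using \<Omega>(1) cK by (rule open_Diff)
  obtain \<delta> where \<delta>: "\<delta> > 0" "(\<Union>x\<in>K. cball x \<delta>) \<subseteq> \<Omega>"
    by (rule compact_subset_open_imp_cball_epsilon_subset[OF K(1) \<Omega>(1) K(2)])
  have near: "x \<in> \<Omega>" if x: "infdist x K \<le> \<delta>" for x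
  proof -
    obtain k where "k \<in> K" "infdist x K = dist x k" using infdist_attains_inf[OF cK K(3)] by blast
    then have "x \<in> cball k \<delta>" using x by (simp add: dist_commute)
    then show ?thesis using \<delta>(2) \<open>k \<in> K\<close> by blast
  qed
  \<comment> \<open>The part of the closure of \<open>\<Omega>\<close> away from \<open>K\<close> is compact, so the continuous extension \<open>g\<close> of \<open>E\<close>
    is bounded there.\<close>
  define D where "D = closure \<Omega> \<inter> {x. \<delta> \<le> infdist x K}"
  have "closed {x. \<delta> \<le> infdist x K}" by (intro closed_Collect_le continuous_intros)
  then have cD: "compact D" unfolding D_def using \<Omega>(3) by (intro compact_Int_closed) (auto simp: compact_closure)
  have "D \<subseteq> closure \<Omega> - K" using \<delta>(1) by (auto simp: D_def)
  then have "compact (g ` D)" using cD g(1) by (intro compact_continuous_image) (auto intro: continuous_on_subset)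
  then obtain M where M: "M > 0" "\<And>x. x \<in> D \<Longrightarrow> \<bar>g x\<bar> \<le> M" using compact_imp_bounded bounded_pos by (metis imageI real_norm_def)
  have high: "infdist x K < \<delta>" if x: "x \<in> ?U" "ln M < ln (E x)" for x
  proof (rule ccontr)
    assume "\<not> ?thesis"
    then have "x \<in> D" using x(1) closure_subset[of \<Omega>] by (auto simp: D_def)
    then have "E x \<le> M" using M(2)[of x] g(2)[OF x(1)] by simp
    then show False using x(2) E(2)[OF x(1)] M(1) by simp
  qed
  show ?thesis
  proof (rule that[of "ln M"])
    fix x0 a b assume x0: "x0 \<in> ?U" and a: "ln M < a"
    let ?W = "connected_component_set ?U x0"
    let ?T = "{x\<in>?W. a \<le> ln (E x) \<and> ln (E x) \<le> b}"
    have WU: "?W \<subseteq> ?U" by (rule connected_component_subset)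
    have "bounded ?T" using \<Omega>(3) WU by (intro bounded_subset[OF \<Omega>(3)]) auto
    moreover have "closed ?T"
      unfolding closed_sequential_limits
    proof (intro allI impI, elim conjE)
      fix X l assume X: "\<forall>n. X n \<in> ?T" "X \<longlonglongrightarrow> l"
      have XU: "X n \<in> ?U" for n using X(1) WU by blast
      have "(\<lambda>n. infdist (X n) K) \<longlonglongrightarrow> infdist l K" by (intro tendsto_infdist X(2))
      moreover have "infdist (X n) K \<le> \<delta>" for n
      proof -
        have "a \<le> ln (E (X n))" using X(1) by blast
        then have "ln M < ln (E (X n))" using a by (rule less_le_trans[rotated])
        then show ?thesis using high[OF XU[of n]] by simp
      qed
      ultimately have "infdist l K \<le> \<delta>" by (intro LIMSEQ_le_const2) auto
      then have "l \<in> \<Omega>" by (rule near)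
      have "l \<notin> K"
      proof
        assume "l \<in> K"
        then have "filterlim E at_top (at l within ?U)" by (rule blow)
        moreover have "filterlim X (at l within ?U) sequentially"
          using X(2) XU \<open>l \<in> K\<close> unfolding filterlim_at by (auto intro!: always_eventually)
        ultimately have "filterlim (\<lambda>n. E (X n)) at_top sequentially" by (rule filterlim_compose)
        then have "eventually (\<lambda>n. E (X n) > exp b) sequentially" by (simp add: filterlim_at_top_dense)
        then obtain n where "E (X n) > exp b" using eventually_happens'[OF sequentially_bot] by blast
        then have "ln (E (X n)) > b" using E(2)[OF XU[of n]] by (metis exp_less_cancel_iff exp_ln)
        then show False using X(1) by (auto simp: not_less[symmetric])
      qed
      then have lU: "l \<in> ?U" using \<open>l \<in> \<Omega>\<close> by blast
      obtain r where r: "r > 0" "ball l r \<subseteq> ?U" using oU lU open_contains_ball by blast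
      have "eventually (\<lambda>n. X n \<in> ball l r) sequentially"
        using X(2) r(1) by (auto simp: tendsto_iff dist_commute)
      then obtain n where n: "X n \<in> ball l r" using eventually_happens'[OF sequentially_bot] by blast
      have "connected_component ?U (X n) l"
        using n r by (intro connected_componentI[of "ball l r"]) auto
      moreover have "connected_component ?U x0 (X n)" using X(1) by auto
      ultimately have "l \<in> ?W" using connected_component_trans by (metis mem_Collect_eq)
      have "isCont E l" using E(1) oU lU by (simp add: continuous_on_eq_continuous_at)
      then have "(\<lambda>n. E (X n)) \<longlonglongrightarrow> E l" using X(2) by (rule isCont_tendsto_compose)
      then have "(\<lambda>n. ln (E (X n))) \<longlonglongrightarrow> ln (E l)" by (rule tendsto_ln) (use E(2)[OF lU] in simp)
      then have "a \<le> ln (E l)" "ln (E l) \<le> b" using X(1) by (auto intro: LIMSEQ_le_const LIMSEQ_le_const2)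
      with \<open>l \<in> ?W\<close> show "l \<in> ?T" by blast
    qed
    ultimately show "compact ?T" by (simp add: compact_eq_bounded_closed)
  next
    fix x0 and b :: real assume x0: "x0 \<in> ?U"
    let ?W = "connected_component_set ?U x0"
    have WU: "?W \<subseteq> ?U" by (rule connected_component_subset)
    have oW: "open ?W" using oU by (rule open_connected_component)
    have x0W: "x0 \<in> ?W" using x0 by simp
    have "K \<inter> closure ?W \<noteq> {}"
    proof
      assume e: "K \<inter> closure ?W = {}"
      have "open (\<Omega> - ?W)"
        unfolding open_contains_ball
      proof
        fix y assume y: "y \<in> \<Omega> - ?W"
        show "\<exists>r>0. ball y r \<subseteq> \<Omega> - ?W"
        proof (cases "y \<in> K")
          case True
          then have "y \<in> \<Omega> - closure ?W" using e y by blast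
          then obtain r where "r > 0" "ball y r \<subseteq> \<Omega> - closure ?W"
            using open_contains_ball[of "\<Omega> - closure ?W"] \<Omega>(1) by (auto simp: open_Diff)
          then show ?thesis using closure_subset[of ?W] by blast
        next
          case False
          then have yU: "y \<in> ?U" using y by blast
          obtain r where r: "r > 0" "ball y r \<subseteq> ?U" using oU yU open_contains_ball by blast
          have "z \<notin> ?W" if z: "z \<in> ball y r" for z
          proof
            assume "z \<in> ?W"
            moreover have "connected_component ?U z y"
              using z r by (intro connected_componentI[of "ball y r"]) auto
            ultimately have "y \<in> ?W" using connected_component_trans by (metis mem_Collect_eq)
            then show False using y by blast
          qed
          then show ?thesis using r by blast
        qed
      qed
      then have "?W \<inter> \<Omega> = {} \<or> (\<Omega> - ?W) \<inter> \<Omega> = {}"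
        using connectedD[OF \<Omega>(2) oW, of "\<Omega> - ?W"] by blast
      then have "\<Omega> \<subseteq> ?W" using x0W WU by blast
      then show False using WU K(2,3) by blast
    qed
    then obtain k where k: "k \<in> K" "k \<in> closure ?W" by blast
    have "eventually (\<lambda>x. E x > exp b) (at k within ?U)"
      using blow[OF k(1)] by (simp add: filterlim_at_top_dense)
    then obtain d where d: "d > 0" "\<And>x. x \<in> ?U \<Longrightarrow> x \<noteq> k \<Longrightarrow> dist x k < d \<Longrightarrow> E x > exp b"
      unfolding eventually_at by blast
    obtain x where x: "x \<in> ?W" "dist x k < d" using k(2) d(1) closure_approachable by blast
    then have xU: "x \<in> ?U" using WU by blast
    then have "E x > exp b" using d(2)[OF xU _ x(2)] k(1) by blast
    then have "ln (E x) > b" using E(2)[OF xU] by (metis exp_less_cancel_iff exp_ln)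
    then show "\<exists>x\<in>?W. ln (E x) > b" using x(1) by blast
  qed
qed

theorem theorem2p3:
  fixes \<Omega> :: "(real^'n::finite) set"
    and A :: "real^'n \<Rightarrow> real^'n^'n"
    and E :: "real^'n \<Rightarrow> real"
    and \<mu> :: "(real^'n) measure"
    and K :: "(real^'n) set"
    and t :: real
  assumes "smooth_bounded_domain \<Omega>"
    and "elliptic_coefficients \<Omega> A"
    and "interior_weight \<Omega> A E \<mu> K"
    and "t \<noteq> 1/2"
  shows "(\<forall>u\<in>X_space \<Omega> A E K t.
            energy \<Omega> A E t (weak_grad (\<Omega> - K) u) \<ge> ennreal ((t - 1/2)\<^sup>2) * hardy_term \<Omega> A E t u)
       \<and> (\<forall>C>(t - 1/2)\<^sup>2. \<not> (\<forall>u\<in>X_space \<Omega> A E K t.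
            energy \<Omega> A E t (weak_grad (\<Omega> - K) u) \<ge> ennreal C * hardy_term \<Omega> A E t u))
       \<and> (\<forall>u\<in>X_space \<Omega> A E K t. \<not> (AE x in lebesgue. x \<in> \<Omega> \<longrightarrow> u x = 0) \<longrightarrow>
            energy \<Omega> A E t (weak_grad (\<Omega> - K) u) \<noteq> ennreal ((t - 1/2)\<^sup>2) * hardy_term \<Omega> A E t u)"
proof -
  have \<Omega>: "open \<Omega>" "connected \<Omega>" "\<Omega> \<noteq> {}" "bounded \<Omega>"
    using assms(1) by (auto simp: smooth_bounded_domain_def)
  have sets\<mu>: "sets \<mu> = sets (restrict_space borel \<Omega>)" and dist: "distributional_L_A_eq \<Omega> A E \<mu>"
    and Ksupp: "K = supp_measure \<Omega> \<mu>" and K: "compact K" and Epos: "\<And>x. x \<in> \<Omega> - K \<Longrightarrow> E x > 0"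
    and Esm: "smooth_up_to (\<Omega> - K) (closure \<Omega> - K) E" and blow: "\<And>x. x \<in> K \<Longrightarrow> filterlim E at_top (at x within \<Omega> - K)"
    and dim: "\<exists>d. has_box_dim \<Omega> K d \<and> d < real CARD('n) - 2"
    using assms(3) by (auto simp: interior_weight_def)
  have K\<Omega>: "K \<subseteq> \<Omega>" unfolding Ksupp supp_measure_def by blast
  have Kne: "K \<noteq> {}" and Knull: "K \<in> null_sets lebesgue" using box_dim_imp_null[OF \<Omega>(1,3,4) K\<Omega> K] dim by auto
  define U where "U = \<Omega> - K"
  have oU: "open U" unfolding U_def using \<Omega>(1) K by (intro open_Diff compact_imp_closed)
  have U\<Omega>: "U \<subseteq> \<Omega>" by (auto simp: U_def)
  have EC: "Cn n U E" for n using smooth_up_to_Cn[OF oU] Esm unfolding U_def by blast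
  have AC: "Cn n U (\<lambda>x. A x $ i $ j)" for n i j
    using assms(2) smooth_up_to_Cn[OF \<Omega>(1)] Cn_subset[OF _ U\<Omega>] unfolding elliptic_coefficients_def by blast
  have Asym: "\<And>x. x \<in> \<Omega> \<Longrightarrow> transpose (A x) = A x" using assms(2) by (auto simp: elliptic_coefficients_def)
  obtain c where c: "c > 0" "\<And>x \<xi>. x \<in> \<Omega> \<Longrightarrow> c * (norm \<xi>)\<^sup>2 \<le> normA_sq A x \<xi>"
    using assms(2) by (auto simp: elliptic_coefficients_def)
  have harm: "AE x in lebesgue. x \<in> U \<longrightarrow> div_A_grad A E x = 0"
  proof (rule distributional_harmonic[OF \<Omega>(1) oU U\<Omega> AC _ EC])
    show "transpose (A x) = A x" if "x \<in> U" for x using Asym that U\<Omega> by blast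
    fix \<phi> assume \<phi>: "\<phi> \<in> test_functions U"
    obtain S where S: "S \<subseteq> U" "\<And>x. x \<notin> S \<Longrightarrow> \<phi> x = 0" using \<phi> by (rule test_functionsE) blast
    have "- (LINT x:\<Omega>|lebesgue. E x * div_A_grad A \<phi> x) = (\<integral>x. \<phi> x \<partial>\<mu>)"
      using dist test_functions_mono[OF \<phi> U\<Omega>] by (auto simp: distributional_L_A_eq_def)
    also have "\<dots> = 0"
      by (rule integral_outside_support_zero[OF sets\<mu> \<Omega>(1)]) (use S in \<open>auto simp: U_def Ksupp\<close>)
    finally show "(LINT x:\<Omega>|lebesgue. E x * div_A_grad A \<phi> x) = 0" by simp
  qed
  interpret elliptic_harmonic U A E c t
    using oU AC Asym U\<Omega> c EC Epos harm by unfold_locales (auto simp: U_def)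
  obtain g where g: "continuous_on (closure \<Omega> - K) g" "\<And>x. x \<in> \<Omega> - K \<Longrightarrow> g x = E x"
  proof -
    have "\<exists>g. continuous_on (closure \<Omega> - K) g \<and> (\<forall>x\<in>\<Omega> - K. g x = pds [] E x)"
      using Esm unfolding smooth_up_to_def by blast
    then show ?thesis using that by (auto simp: pds_def)
  qed
  obtain \<tau> where \<tau>: "\<And>x0 a b. x0 \<in> U \<Longrightarrow> \<tau> < a \<Longrightarrow>
      compact {x\<in>connected_component_set U x0. a \<le> ln (E x) \<and> ln (E x) \<le> b}"
    "\<And>x0 b. x0 \<in> U \<Longrightarrow> \<exists>x\<in>connected_component_set U x0. ln (E x) > b"
    unfolding U_def
    by (rule level_sets_of_weight[OF \<Omega>(1,2,4) K K\<Omega> Kne Cn_continuous_on[OF EC[unfolded U_def]] Epos g blow]) blast+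
  have levels: "elliptic_levels U A E c (connected_component_set U x0) \<tau>" if "x0 \<in> U" for x0
  proof unfold_locales
    show "open (connected_component_set U x0)" using oU by (rule open_connected_component)
    show "connected_component_set U x0 \<subseteq> U" by (rule connected_component_subset)
    show "connected (connected_component_set U x0)" by (rule connected_connected_component)
  qed (use \<tau> that in auto)
  have mU: "U \<inter> space lebesgue \<in> sets lebesgue" using oU by simp
  have aeK: "AE x in lebesgue. x \<notin> K" using Knull by (rule AE_not_in)
  have energy_eq: "energy \<Omega> A E t G = nnint U (energy_density G)" for G
    unfolding energy_def nn_integral_restrict_space[OF mU] energy_density_def
    by (rule nn_integral_cong_AE) (use aeK in \<open>eventually_elim, auto simp: U_def split: split_indicator\<close>)
  have hardy_eq: "hardy_term \<Omega> A E t u = nnint U (hardy_density u)" for u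
    unfolding hardy_term_def nn_integral_restrict_space[OF mU] hardy_density_def
    by (rule nn_integral_cong_AE) (use aeK in \<open>eventually_elim, auto simp: U_def split: split_indicator\<close>)
  \<comment> \<open>The weak gradient is chosen arbitrarily among those that agree almost everywhere on \<open>U\<close>.\<close>
  have en_weak: "energy \<Omega> A E t (weak_grad (\<Omega> - K) u) = nnint U (energy_density G)"
    if G: "has_weak_grad U u G" for u G
  proof -
    have "has_weak_grad U u (weak_grad U u)" unfolding weak_grad_def by (rule someI[of "has_weak_grad U u", OF G])
    then have ae: "AE x in lebesgue. x \<in> U \<longrightarrow> weak_grad U u x = G x" using G by (rule weak_grad_unique[OF oU])
    have "nnint U (energy_density (weak_grad U u)) = nnint U (energy_density G)"
    proof (rule nn_integral_cong_AE)
      show "AE x in lebesgue_on U. ennreal (energy_density (weak_grad U u) x) = ennreal (energy_density G x)"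
        unfolding AE_restrict_space_iff[OF mU] using ae by eventually_elim (simp add: energy_density_def)
    qed
    then show ?thesis unfolding energy_eq U_def .
  qed
  have clos: "\<exists>G. has_weak_grad U u G \<and> (nnint U (energy_density G)) < \<infinity> \<and>
    (nnint U (\<lambda>x. remainder_density u G x + (t - 1/2)\<^sup>2 * hardy_density u x)) \<le> nnint U (energy_density G)"
    if u: "u \<in> X_space \<Omega> A E K t" for u
  proof -
    from u obtain \<phi> \<Gamma> where li: "locally_integrable U u"
      and \<phi>: "\<And>m::nat. \<phi> m \<in> lipschitz_functions U \<and> has_weak_grad U (\<phi> m) (\<Gamma> m)"
      and cau: "\<forall>\<epsilon>>0. \<exists>N. \<forall>m\<ge>N. \<forall>k\<ge>N. energy \<Omega> A E t (\<lambda>x. \<Gamma> m x - \<Gamma> k x) < ennreal \<epsilon>"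
      and conv: "\<forall>C. compact C \<and> C \<subseteq> U \<longrightarrow> (\<lambda>m. \<integral>\<^sup>+x\<in>C. ennreal \<bar>\<phi> m x - u x\<bar> \<partial>lebesgue) \<longlonglongrightarrow> 0"
      unfolding X_space_def U_def by blast
    show ?thesis
    proof (rule hardy_remainder_closure[OF li])
      show "\<phi> m \<in> lipschitz_functions U" "has_weak_grad U (\<phi> m) (\<Gamma> m)" for m using \<phi> by auto
      show "\<exists>N. \<forall>m\<ge>N. \<forall>k\<ge>N. nnint U (energy_density (\<lambda>x. \<Gamma> m x - \<Gamma> k x)) < ennreal \<epsilon>"
        if "\<epsilon> > 0" for \<epsilon> using cau that unfolding energy_eq by blast
      show "(\<lambda>m. \<integral>\<^sup>+x\<in>C. ennreal \<bar>\<phi> m x - u x\<bar> \<partial>lebesgue) \<longlonglongrightarrow> 0" if "compact C" "C \<subseteq> U" for C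
        using conv that by blast
    qed blast
  qed
  have low: "ennreal ((t - 1/2)\<^sup>2) * nnint U (hardy_density u) \<le> nnint U (\<lambda>x. remainder_density u G x + (t - 1/2)\<^sup>2 * hardy_density u x)"
    if "has_weak_grad U u G" for u G
  proof -
    have "u \<in> borel_measurable (lebesgue_on U)" using locally_integrable_measurable[OF oU has_weak_gradD(1)[OF that]] .
    then have "ennreal ((t - 1/2)\<^sup>2) * nnint U (hardy_density u) = (\<integral>\<^sup>+x. ennreal ((t - 1/2)\<^sup>2) * ennreal (hardy_density u x) \<partial>lebesgue_on U)"
      using hardy_density_measurable by (intro nn_integral_cmult[symmetric]) simp
    also have "\<dots> \<le> nnint U (\<lambda>x. remainder_density u G x + (t - 1/2)\<^sup>2 * hardy_density u x)"
      by (intro nn_integral_mono) (auto simp: ennreal_mult[symmetric] hardy_density_nonneg remainder_density_nonneg intro!: ennreal_leI)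
    finally show ?thesis .
  qed
  show ?thesis
  proof (intro conjI ballI allI impI)
    fix u assume u: "u \<in> X_space \<Omega> A E K t"
    from clos[OF u] obtain G where G: "has_weak_grad U u G"
      "nnint U (\<lambda>x. remainder_density u G x + (t - 1/2)\<^sup>2 * hardy_density u x) \<le> nnint U (energy_density G)" by blast
    show "ennreal ((t - 1/2)\<^sup>2) * hardy_term \<Omega> A E t u \<le> energy \<Omega> A E t (weak_grad (\<Omega> - K) u)"
      unfolding en_weak[OF G(1)] hardy_eq using low[OF G(1)] G(2) by (rule order_trans)
  next
    fix C assume C: "(t - 1/2)\<^sup>2 < C"
    show "\<not> (\<forall>u\<in>X_space \<Omega> A E K t. ennreal C * hardy_term \<Omega> A E t u \<le> energy \<Omega> A E t (weak_grad (\<Omega> - K) u))"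
    proof
      assume all: "\<forall>u\<in>X_space \<Omega> A E K t. ennreal C * hardy_term \<Omega> A E t u \<le> energy \<Omega> A E t (weak_grad (\<Omega> - K) u)"
      have "U \<noteq> {}"
      proof
        assume "U = {}"
        then have "\<Omega> \<subseteq> K" by (auto simp: U_def)
        then have "AE x in lebesgue. x \<notin> \<Omega>" using aeK by (auto elim: eventually_mono)
        then show False using not_AE_outside_open[OF \<Omega>(1,3)] by blast
      qed
      then obtain x0 where x0: "x0 \<in> U" by blast
      interpret L: elliptic_levels U A E c t "connected_component_set U x0" \<tau> by (rule levels[OF x0])
      obtain B D where D: "D > 0" "B \<ge> 0" and fam: "\<And>R. R > 0 \<Longrightarrow> \<exists>u\<in>test_functions U.
         nnint U (hardy_density u) = ennreal (R * D) \<and>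
         (nnint U (energy_density (grad u))) = ennreal (B / R + (t - 1/2)\<^sup>2 * (R * D))"
        by (rule L.optimal_family) blast
      have ineq: "C * (R * D) \<le> B / R + (t - 1/2)\<^sup>2 * (R * D)" if R: "R > 0" for R
      proof -
        obtain u where u: "u \<in> test_functions U" "nnint U (hardy_density u) = ennreal (R * D)"
          "nnint U (energy_density (grad u)) = ennreal (B / R + (t - 1/2)\<^sup>2 * (R * D))"
          using fam[OF R] by blast
        have wg: "has_weak_grad U u (grad u)"
          using has_weak_grad_smooth[OF oU] u(1) by (auto simp: test_functions_iff intro: Cn_subset)
        have "u \<in> X_space \<Omega> A E K t"
          unfolding X_space_def U_def[symmetric] mem_Collect_eq
        proof (intro conjI exI[of _ "\<lambda>m::nat. u"] exI[of _ "\<lambda>m::nat. grad u"] allI impI)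
          show "locally_integrable U u" by (rule has_weak_gradD(1)[OF wg])
          show "u \<in> lipschitz_functions U" by (rule test_lipschitz_functions[OF u(1)])
          show "has_weak_grad U u (grad u)" by (rule wg)
          show "\<exists>N. \<forall>m\<ge>N. \<forall>k\<ge>N. energy \<Omega> A E t (\<lambda>x. grad u x - grad u x) < ennreal \<epsilon>" if "\<epsilon> > 0" for \<epsilon>
            using that by (simp add: energy_def normA_sq_def)
        qed simp
        from all[rule_format, OF this] have "ennreal C * ennreal (R * D) \<le> ennreal (B / R + (t - 1/2)\<^sup>2 * (R * D))"
          unfolding en_weak[OF wg] hardy_eq u(2,3) .
        moreover have "C \<ge> 0" using C zero_le_power2[of "t - 1/2"] by linarith
        then have "ennreal C * ennreal (R * D) = ennreal (C * (R * D))"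
          using D R by (intro ennreal_mult[symmetric]) auto
        ultimately have "ennreal (C * (R * D)) \<le> ennreal (B / R + (t - 1/2)\<^sup>2 * (R * D))" by (simp only:)
        moreover have "0 \<le> B / R + (t - 1/2)\<^sup>2 * (R * D)" using D R by simp
        ultimately show ?thesis by (simp only: ennreal_le_iff)
      qed
      define \<delta> where "\<delta> = (C - (t - 1/2)\<^sup>2) * D"
      have \<delta>: "\<delta> > 0" using C D by (simp add: \<delta>_def)
      \<comment> \<open>Chosen such that \<open>R \<ge> 1\<close> and \<open>\<delta> * R > B\<close>.\<close>
      define R where "R = 1 + B / \<delta>"
      have R: "R \<ge> 1" "R > 0" using D \<delta> by (auto simp: R_def add_pos_nonneg)
      have "\<delta> * R \<le> B / R" using ineq[OF R(2)] by (simp add: \<delta>_def algebra_simps)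
      also have "B / R \<le> B" using mult_left_mono[of 1 R B] D R by (simp add: divide_le_eq)
      finally have "\<delta> + B \<le> B" using \<delta> by (simp add: R_def distrib_left)
      then show False using \<delta> by simp
    qed
  next
    fix u assume u: "u \<in> X_space \<Omega> A E K t" and nz: "\<not> (AE x in lebesgue. x \<in> \<Omega> \<longrightarrow> u x = 0)"
    from clos[OF u] obtain G where G: "has_weak_grad U u G" "nnint U (energy_density G) < \<infinity>"
      "nnint U (\<lambda>x. remainder_density u G x + (t - 1/2)\<^sup>2 * hardy_density u x) \<le> nnint U (energy_density G)" by blast
    show "energy \<Omega> A E t (weak_grad (\<Omega> - K) u) \<noteq> ennreal ((t - 1/2)\<^sup>2) * hardy_term \<Omega> A E t u"
    proof
      assume "energy \<Omega> A E t (weak_grad (\<Omega> - K) u) = ennreal ((t - 1/2)\<^sup>2) * hardy_term \<Omega> A E t u"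
      then have eq: "nnint U (energy_density G) = ennreal ((t - 1/2)\<^sup>2) * nnint U (hardy_density u)"
        unfolding en_weak[OF G(1)] hardy_eq .
      have "AE x in lebesgue. x \<in> U \<longrightarrow> u x = 0"
      proof (rule AE_local)
        fix x0 assume x0: "x0 \<in> U"
        have "\<exists>r>0. AE x in lebesgue. x \<in> ball x0 r \<longrightarrow> u x = 0"
          by (rule elliptic_levels.equality_imp_locally_zero[OF levels[OF x0] G eq assms(4)]) (use x0 in simp)
        then obtain r where "r > 0" "AE x in lebesgue. x \<in> ball x0 r \<longrightarrow> u x = 0" by blast
        then show "\<exists>V. open V \<and> x0 \<in> V \<and> (AE x in lebesgue. x \<in> V \<longrightarrow> u x = 0)"
          by (intro exI[of _ "ball x0 r"]) simp
      qed
      then have "AE x in lebesgue. x \<in> \<Omega> \<longrightarrow> u x = 0"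
        using aeK by eventually_elim (auto simp: U_def)
      then show False using nz by blast
    qed
  qed
qed

end
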